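(* Let $a\in[0,1]$, $p\in(0,1]$ and $q\in(0,1]$ be real numbers, set $A:=[0,a)$ and $B:=[a,1]$, and let $W:[0,1]^2\to[0,1]$ be the graphon which takes the value $0$ on $A^2$, the value $p$ on $(A\times B)\cup(B\times A)$, and the value $q$ on $B^2$. If $(1-a)q\le(1-2a)p$, then $W$ is forced by the sequence $(X_k)_{k\in\mathbb N}$; that is, every graphon $U$ such that for every $k\in\mathbb N$ the random variables $X_k(U)$ and $X_k(W)$ have the same distribution is weakly isomorphic to $W$.
   Context: A graphon is a measurable symmetric function $W:[0,1]^2\to[0,1]$ (Lebesgue measure on $[0,1]$). For an integer $k\ge 1$, the $k$-sample $\mathbb G(k,W)$ is the random graph on $\{1,\dots,k\}$ obtained by sampling $x_1,\dots,x_k\in[0,1]$ uniformly at random and making each pair $\{i,j\}\subseteq\{1,\dots,k\}$ with $i\ne j$ an edge with probability $W(x_i,x_j)$, all these choices being mutually independent. $X_k(W)$ denotes the number of edges of $\mathbb G(k,W)$. Two graphons $U,W$ are weakly isomorphic if $\mathbb G(k,U)$ and $\mathbb G(k,W)$ have the same distribution for every $k\in\mathbb N$. *)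

theory Defs
  imports "HOL-Probability.Probability"
begin

(* Only the values of W on the unit square matter.  Measurability is Lebesgue
   (not just Borel) measurability. *)
definition graphon :: "(real \<times> real \<Rightarrow> real) \<Rightarrow> bool" where
  "graphon W \<longleftrightarrow>
     W \<in> borel_measurable (lebesgue_on ({0..1} \<times> {0..1})) \<and>
     (\<forall>x\<in>{0..1}. \<forall>y\<in>{0..1}. 0 \<le> W (x, y) \<and> W (x, y) \<le> 1 \<and> W (x, y) = W (y, x))"

definition vertex_pairs :: "nat \<Rightarrow> nat set set" where
  "vertex_pairs k = {e. e \<subseteq> {1..k} \<and> card e = 2}"

(* The conditional law of the sample given the points x_1, ..., x_k: a graph on {1..k}
   is identified with its edge set.  As W is symmetric, reading an unordered pair as
   (Min, Max) is immaterial. *)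
definition random_edges :: "nat \<Rightarrow> (real \<times> real \<Rightarrow> real) \<Rightarrow> (nat \<Rightarrow> real) \<Rightarrow> nat set set pmf" where
  "random_edges k W x =
     map_pmf (\<lambda>g. {e \<in> vertex_pairs k. g e})
       (Pi_pmf (vertex_pairs k) False (\<lambda>e. bernoulli_pmf (W (x (Min e), x (Max e)))))"

(* The law of the k-sample.  The product measure is completed because, for a merely
   Lebesgue measurable W, the map x \<mapsto> W (x i, x j) need not be measurable with
   respect to the uncompleted product sigma-algebra. *)
definition k_sample :: "nat \<Rightarrow> (real \<times> real \<Rightarrow> real) \<Rightarrow> nat set set measure" where
  "k_sample k W =
     completion (\<Pi>\<^sub>M i\<in>{1..k}. restrict_space lborel {0..1}) \<bind>
       (\<lambda>x. measure_pmf (random_edges k W x))"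

definition edge_count_distr :: "nat \<Rightarrow> (real \<times> real \<Rightarrow> real) \<Rightarrow> nat measure" where
  "edge_count_distr k W = distr (k_sample k W) (count_space UNIV) card"

definition weakly_isomorphic :: "(real \<times> real \<Rightarrow> real) \<Rightarrow> (real \<times> real \<Rightarrow> real) \<Rightarrow> bool" where
  "weakly_isomorphic U W \<longleftrightarrow> (\<forall>k\<ge>1. k_sample k U = k_sample k W)"

definition forced_by_edge_counts :: "(real \<times> real \<Rightarrow> real) \<Rightarrow> bool" where
  "forced_by_edge_counts W \<longleftrightarrow>
     (\<forall>U. graphon U \<longrightarrow> (\<forall>k\<ge>1. edge_count_distr k U = edge_count_distr k W) \<longrightarrow>
        weakly_isomorphic U W)"

end

theory Submission
  imports Defs
begin

text \<open>The law of \<open>X\<^sub>k\<close> determines \<open>F\<^sub>k(s) = \<integral> \<Prod>\<^sub>i\<^sub><\<^sub>j (1 - s U(x\<^sub>i, x\<^sub>j)) = E (1 - s)\<^bsup>X\<^sub>k\<^esup>\<close>.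
  Taking \<open>s = 1\<close>, the bound \<open>F\<^sub>k(1) \<ge> a\<^sup>k\<close> for all \<open>k\<close> forces \<open>U\<close> to vanish on the square of a set
  \<open>A\<close> of measure \<open>a\<close>.  Let \<open>B\<close> be its complement.  Expanding \<open>F\<^sub>k(1/2)\<close> by the number \<open>j\<close> of points
  in \<open>B\<close> and letting \<open>k\<close> grow, the terms \<open>j = 1\<close> show that almost every point of \<open>B\<close> has degree at
  least \<open>a p\<close> into \<open>A\<close>.  The hypothesis says that the degrees in \<open>W\<close> are at least as large on \<open>A\<close> as
  on the complement of \<open>A\<close>; as \<open>F\<^sub>2\<close> and \<open>F\<^sub>3\<close> fix the first two moments of the degree, the degrees
  of \<open>U\<close> must be those of \<open>W\<close>.  The terms \<open>j = 2\<close> then bound the codegrees of pairs in \<open>B\<close> by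
  \<open>a p\<^sup>2\<close>, which is their average, so \<open>U = p\<close> on \<open>A \<times> B\<close>.  Now the expansion shows that \<open>F\<^sub>4\<close> of the
  restriction of \<open>U\<close> to \<open>B\<close> is that of the constant \<open>q\<close>, and since this restriction is regular,
  the four-cycle density of \<open>q - U\<close> vanishes.\<close>

section \<open>Analytic preliminaries\<close>

text \<open>The growth in k yields only one-sided bounds: degrees into A are bounded below,
  codegrees above. Each becomes an equality because its average is known, the first through the
  degree moments, the second by double counting. The comparison is made at s = 1/2 and not at s = 1,
  because 1 - s p must stay positive when p = 1, and because a pair in B with U = 1 would have
  weight 1 - s U = 0 and escape the bound on codegrees. The terms with at least J points in B grow
  with base a (1 - s p)^J, so the bound for J = 2 is visible only after the terms j < 2 have been
  found exactly and cancelled. Clique integrals carry a weight f on the vertices: fixing a vertex y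
  replaces f by f V(-, y), so recursions on the number of points become inductions over all f, and
  weights, unlike sets, are closed under this operation. The expansion by points in B needs U = 0 at
  every point of A x A; what is known almost everywhere is therefore made exact by changing U on
  null sets.\<close>

lemma sum_binomial_Suc:
  fixes G :: "nat \<Rightarrow> nat \<Rightarrow> 'c::comm_semiring_1"
  shows "(\<Sum>j\<le>k. of_nat (k choose j) * G (Suc (k - j)) j) + (\<Sum>j\<le>k. of_nat (k choose j) * G (k - j) (Suc j))
    = (\<Sum>j\<le>Suc k. of_nat (Suc k choose j) * G (Suc k - j) j)"
proof -
  have "(\<Sum>j\<le>Suc k. of_nat (Suc k choose j) * G (Suc k - j) j) =
     G (Suc k) 0 + (\<Sum>j\<le>k. of_nat (k choose j) * G (k - j) (Suc j) + of_nat (k choose Suc j) * G (k - j) (Suc j))"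
    by (subst sum.atMost_Suc_shift) (simp add: algebra_simps)
  also have "\<dots> = (G (Suc k) 0 + (\<Sum>j\<le>k. of_nat (k choose Suc j) * G (k - j) (Suc j))) +
      (\<Sum>j\<le>k. of_nat (k choose j) * G (k - j) (Suc j))"
    by (simp add: sum.distrib ac_simps)
  also have "G (Suc k) 0 + (\<Sum>j\<le>k. of_nat (k choose Suc j) * G (k - j) (Suc j)) =
      (\<Sum>j\<le>Suc k. of_nat (k choose j) * G (Suc k - j) j)"
    by (subst sum.atMost_Suc_shift) simp
  also have "\<dots> = (\<Sum>j\<le>k. of_nat (k choose j) * G (Suc (k - j)) j)"
    by (auto simp: Suc_diff_le binomial_eq_0 intro!: sum.cong)
  finally show ?thesis by simp
qed

lemma abs_mult_le_one: "\<bar>a\<bar> \<le> 1 \<Longrightarrow> \<bar>b\<bar> \<le> 1 \<Longrightarrow> \<bar>a * b\<bar> \<le> (1::real)"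
  using mult_mono[of "\<bar>a\<bar>" 1 "\<bar>b\<bar>" 1] by (simp add: abs_mult)

text \<open>Strips the terms already known from both sides of an expansion; cancellation in
  \<open>ennreal\<close> requires the stripped sum to be finite.\<close>

lemma ennreal_sum_tail_le:
  fixes f g :: "nat \<Rightarrow> ennreal"
  assumes "(\<Sum>j\<le>k. f j) = (\<Sum>j\<le>k. g j)" "J \<le> k"
    and "\<And>j. j < J \<Longrightarrow> f j = g j" "\<And>j. j < J \<Longrightarrow> g j < \<top>"
  shows "(\<Sum>j=J..k. f j) = (\<Sum>j=J..k. g j)"
proof -
  have split: "(\<Sum>j\<le>k. h j) = (\<Sum>j<J. h j) + (\<Sum>j=J..k. h j)" for h :: "nat \<Rightarrow> ennreal"
  proof -
    have "{..k} = {..<J} \<union> {J..k}" using assms(2) by auto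
    then show ?thesis by (simp only:) (rule sum.union_disjoint, auto)
  qed
  have "(\<Sum>j<J. g j) + (\<Sum>j=J..k. f j) = (\<Sum>j<J. g j) + (\<Sum>j=J..k. g j)"
    using assms(1,3) unfolding split by simp
  moreover have "(\<Sum>j<J. g j) \<noteq> \<top>"
    unfolding less_top using assms(4) by simp
  ultimately show ?thesis by (simp add: ennreal_add_left_cancel)
qed

lemma tendsto_prod_ennreal:
  fixes F :: "nat \<Rightarrow> 'i \<Rightarrow> ennreal"
  assumes "finite I" "\<And>i. i \<in> I \<Longrightarrow> (\<lambda>n. F n i) \<longlonglongrightarrow> f i" "\<And>i. i \<in> I \<Longrightarrow> f i \<noteq> \<top>"
  shows "(\<lambda>n. \<Prod>i\<in>I. F n i) \<longlonglongrightarrow> (\<Prod>i\<in>I. f i)"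
  using assms
proof (induction I rule: finite_induct)
  case (insert i I)
  have "(\<Prod>i\<in>I. f i) \<noteq> \<top>"
    using insert.prems by (simp add: ennreal_prod_eq_top)
  then show ?case
    using insert by (simp, intro tendsto_mult_ennreal) auto
qed simp

lemma ennreal_le_oneI: "a \<le> 1 \<Longrightarrow> b \<le> 1 \<Longrightarrow> a * b \<le> (1::ennreal)"
  using mult_mono[of a 1 b 1] by simp

lemma indicator_Compl_measurable:
  "E \<in> sets M \<Longrightarrow> (indicator (- E) :: _ \<Rightarrow> ennreal) \<in> borel_measurable M"
  by (subst measurable_cong[where g="indicator (space M - E)"]) (auto simp: indicator_def)

lemma measurable_uncurried:
  assumes "case_prod K \<in> borel_measurable (M1 \<Otimes>\<^sub>M M2)" "f \<in> N \<rightarrow>\<^sub>M M1" "g \<in> N \<rightarrow>\<^sub>M M2"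
  shows "(\<lambda>x. K (f x) (g x)) \<in> borel_measurable N"
  using measurable_compose[OF measurable_Pair[OF assms(2,3)] assms(1)] by simp

lemma AE_eq_of_nn_integral_eq:
  assumes [measurable]: "f \<in> borel_measurable M" "g \<in> borel_measurable M"
    and le: "\<And>x. g x \<le> f x" and fin: "(\<integral>\<^sup>+x. f x \<partial>M) \<noteq> \<top>"
    and ge: "(\<integral>\<^sup>+x. f x \<partial>M) \<le> (\<integral>\<^sup>+x. g x \<partial>M)"
  shows "AE x in M. f x = g x"
proof (rule ccontr)
  assume "\<not> (AE x in M. f x = g x)"
  moreover have "(AE x in M. f x \<le> g x) \<longrightarrow> (AE x in M. f x = g x)"
    by (auto intro: antisym le)
  ultimately have "\<not> (AE x in M. f x \<le> g x)" by blast
  moreover have "(\<integral>\<^sup>+x. g x \<partial>M) \<noteq> \<top>"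
    using fin nn_integral_mono[of M g f] le by (auto simp: top_unique)
  ultimately have "(\<integral>\<^sup>+x. g x \<partial>M) < (\<integral>\<^sup>+x. f x \<partial>M)"
    by (intro nn_integral_less) (auto simp: le)
  then show False using ge by simp
qed

text \<open>With d = c / \<eta>, consecutive terms of d^j r^(j choose 2) have ratio d r^j, which
  tends to 0. Once it is below 1 the terms no longer grow, so the sum of the initial ones bounds
  them all.\<close>

lemma power_choose_two_le_power:
  fixes c r \<eta> :: real
  assumes "0 \<le> c" "0 \<le> r" "r < 1" "0 < \<eta>"
  obtains C where "0 \<le> C" "\<And>j. c ^ j * r ^ (j choose 2) \<le> C * \<eta> ^ j"
proof -
  define d where "d = c / \<eta>"
  define t where "t j = d ^ j * r ^ (j choose 2)" for j :: nat
  have d: "0 \<le> d" using assms by (simp add: d_def)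
  have t0: "0 \<le> t j" for j using d assms by (simp add: t_def)
  have step: "t (Suc j) = t j * (d * r ^ j)" for j
    by (simp add: t_def numeral_2_eq_2 power_add)
  have "(\<lambda>n. d * r ^ n) \<longlonglongrightarrow> d * 0"
    using assms by (intro tendsto_mult tendsto_const LIMSEQ_power_zero) auto
  then have "eventually (\<lambda>n. d * r ^ n < 1) sequentially"
    by (rule order_tendstoD) simp
  then obtain N where N: "\<And>n. n \<ge> N \<Longrightarrow> d * r ^ n < 1" by (auto simp: eventually_sequentially)
  define C where "C = (\<Sum>i\<le>N. t i)"
  have tC: "t j \<le> C" for j
  proof (induction j)
    case 0
    show ?case unfolding C_def by (rule member_le_sum) (auto simp: t0)
  next
    case (Suc j)
    show ?case
    proof (cases "Suc j \<le> N")
      case True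
      then show ?thesis unfolding C_def by (intro member_le_sum) (auto simp: t0)
    next
      case False
      then have "t (Suc j) \<le> t j * 1"
        unfolding step by (intro mult_left_mono less_imp_le[OF N] t0) auto
      then show ?thesis using Suc.IH by simp
    qed
  qed
  show thesis
  proof (rule that)
    show "0 \<le> C" unfolding C_def by (intro sum_nonneg t0)
    show "c ^ j * r ^ (j choose 2) \<le> C * \<eta> ^ j" for j
    proof -
      have "c ^ j * r ^ (j choose 2) = t j * \<eta> ^ j"
        using assms by (simp add: t_def d_def power_divide)
      also have "\<dots> \<le> C * \<eta> ^ j" using assms tC by (intro mult_right_mono) auto
      finally show ?thesis .
    qed
  qed
qed

text \<open>Since J j + j (k - j) >= J k, the term with index j is at most (a \<rho>^J)^k times c^j
  r^(j choose 2) with c = b / (a \<rho>^J), hence times C \<eta>^j; the binomial theorem then sums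
  the \<eta>^j to (1 + \<eta>)^k.\<close>

lemma binomial_tail_le:
  fixes a b r \<rho> \<eta> :: real
  assumes "0 < a" "0 \<le> b" "0 \<le> r" "r < 1" "0 < \<rho>" "\<rho> \<le> 1" "0 < \<eta>"
  obtains C where "0 \<le> C" "\<And>k. (\<Sum>j=J..k. real (k choose j) * (b ^ j * r ^ (j choose 2) * (a * \<rho> ^ j) ^ (k - j)))
     \<le> C * ((1 + \<eta>) * (a * \<rho> ^ J)) ^ k"
proof -
  define c where "c = b / (a * \<rho> ^ J)"
  obtain C where C: "0 \<le> C" "\<And>j. c ^ j * r ^ (j choose 2) \<le> C * \<eta> ^ j"
    using power_choose_two_le_power[of c r \<eta>] assms by (auto simp: c_def)
  have b: "b = c * (a * \<rho> ^ J)" using assms by (simp add: c_def)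
  have term_le: "b ^ j * r ^ (j choose 2) * (a * \<rho> ^ j) ^ (k - j) \<le> (a * \<rho> ^ J) ^ k * (C * \<eta> ^ j)"
    if "J \<le> j" "j \<le> k" for j k
  proof -
    have "J * j + J * (k - j) \<le> J * j + j * (k - j)" using that by (intro add_left_mono mult_right_mono) auto
    then have le: "J * k \<le> J * j + j * (k - j)" using that by (simp flip: add_mult_distrib2)
    have "b ^ j * r ^ (j choose 2) * (a * \<rho> ^ j) ^ (k - j) =
      c ^ j * r ^ (j choose 2) * (a ^ j * a ^ (k - j)) * \<rho> ^ (J * j + j * (k - j))"
      by (simp add: b power_mult_distrib power_add power_mult)
    also have "\<dots> = (c ^ j * r ^ (j choose 2)) * (a ^ k * \<rho> ^ (J * j + j * (k - j)))"
      using that by (simp flip: power_add)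
    also have "\<dots> \<le> (C * \<eta> ^ j) * (a ^ k * \<rho> ^ (J * k))"
      by (rule mult_mono[OF C(2) mult_left_mono[OF power_decreasing[OF le]]]) (use assms C(1) in auto)
    finally show ?thesis by (simp add: power_mult_distrib power_mult mult_ac)
  qed
  have "(\<Sum>j=J..k. real (k choose j) * (b ^ j * r ^ (j choose 2) * (a * \<rho> ^ j) ^ (k - j)))
     \<le> C * ((1 + \<eta>) * (a * \<rho> ^ J)) ^ k" for k
  proof -
    have "(\<Sum>j=J..k. real (k choose j) * (b ^ j * r ^ (j choose 2) * (a * \<rho> ^ j) ^ (k - j))) \<le>
      (\<Sum>j=J..k. real (k choose j) * ((a * \<rho> ^ J) ^ k * (C * \<eta> ^ j)))"
      by (intro sum_mono mult_left_mono term_le) auto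
    also have "\<dots> \<le> (\<Sum>j\<le>k. real (k choose j) * ((a * \<rho> ^ J) ^ k * (C * \<eta> ^ j)))"
      using assms C by (intro sum_mono2) auto
    also have "\<dots> = C * (a * \<rho> ^ J) ^ k * (\<Sum>j\<le>k. real (k choose j) * \<eta> ^ j)"
      by (simp add: sum_distrib_left mult_ac)
    also have "(\<Sum>j\<le>k. real (k choose j) * \<eta> ^ j) = (1 + \<eta>) ^ k"
      using binomial_ring[of \<eta> 1 k] by (simp add: add.commute)
    finally show ?thesis by (simp add: power_mult_distrib mult_ac)
  qed
  then show thesis using that C(1) by blast
qed

text \<open>A Markov bound for the m-th moments: if \<open>h\<close> exceeded (1 + \<eta>)^2 \<beta>
  on a set of positive mass with respect to \<open>w\<close>, the moments would grow at least at
  that rate, faster than the allowed (1 + \<eta>) \<beta>. Then \<eta> runs through 1 / Suc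
  n.\<close>

lemma AE_le_of_power_growth:
  fixes w h :: "'a \<Rightarrow> ennreal" and \<beta> :: real
  assumes [measurable]: "w \<in> borel_measurable N" "h \<in> borel_measurable N" and "0 < \<beta>"
    and growth: "\<And>\<eta>. 0 < \<eta> \<Longrightarrow> \<exists>C. \<forall>m. (\<integral>\<^sup>+x. w x * h x ^ m \<partial>N) \<le> ennreal (C * ((1 + \<eta>) * \<beta>) ^ m)"
  shows "AE x in N. w x \<noteq> 0 \<longrightarrow> h x \<le> ennreal \<beta>"
proof -
  have inv: "ennreal g * ennreal (1 / g) = 1" if "0 < g" for g
    using that by (simp flip: ennreal_mult)
  have *: "AE x in N. w x \<noteq> 0 \<longrightarrow> h x \<le> ennreal ((1 + \<eta>)\<^sup>2 * \<beta>)" if \<eta>: "0 < \<eta>" for \<eta> :: real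
  proof -
    let ?S = "{x\<in>space N. h x > ennreal ((1 + \<eta>)\<^sup>2 * \<beta>)}"
    obtain C where C: "\<And>m. (\<integral>\<^sup>+x. w x * h x ^ m \<partial>N) \<le> ennreal (C * ((1 + \<eta>) * \<beta>) ^ m)"
      using growth[OF \<eta>] by blast
    have le: "(\<integral>\<^sup>+x. w x * indicator ?S x \<partial>N) \<le> ennreal (C * (1 / (1 + \<eta>)) ^ m)" for m
    proof -
      let ?g = "((1 + \<eta>)\<^sup>2 * \<beta>) ^ m"
      have g0: "0 < ?g" using \<eta> \<open>0 < \<beta>\<close> by simp
      have "(\<integral>\<^sup>+x. w x * indicator ?S x \<partial>N) * ennreal ?g = (\<integral>\<^sup>+x. w x * indicator ?S x * ennreal ?g \<partial>N)"
        by (rule nn_integral_multc[symmetric]) measurable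
      also have "\<dots> \<le> (\<integral>\<^sup>+x. w x * h x ^ m \<partial>N)"
      proof (rule nn_integral_mono)
        fix x
        have "ennreal ?g = ennreal ((1 + \<eta>)\<^sup>2 * \<beta>) ^ m" using \<eta> \<open>0 < \<beta>\<close> by (simp add: ennreal_power)
        then have "ennreal ?g \<le> h x ^ m" if "x \<in> ?S" using that by (auto intro: power_mono)
        then show "w x * indicator ?S x * ennreal ?g \<le> w x * h x ^ m"
          by (cases "x \<in> ?S") (auto intro: mult_left_mono)
      qed
      also have "\<dots> \<le> ennreal (C * ((1 + \<eta>) * \<beta>) ^ m)" by (rule C)
      finally have "(\<integral>\<^sup>+x. w x * indicator ?S x \<partial>N) * ennreal ?g * ennreal (1 / ?g) \<le>
         ennreal (C * ((1 + \<eta>) * \<beta>) ^ m) * ennreal (1 / ?g)"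
        by (rule mult_right_mono) simp
      also have "\<dots> = ennreal (C * ((1 + \<eta>) * \<beta>) ^ m * (1 / ?g))"
        using g0 by (intro ennreal_mult''[symmetric]) simp
      also have "C * ((1 + \<eta>) * \<beta>) ^ m * (1 / ?g) = C * (1 / (1 + \<eta>)) ^ m"
        using \<eta> \<open>0 < \<beta>\<close> by (simp add: power_mult_distrib power2_eq_square power_divide divide_simps)
      also have "(\<integral>\<^sup>+x. w x * indicator ?S x \<partial>N) * ennreal ?g * ennreal (1 / ?g) = (\<integral>\<^sup>+x. w x * indicator ?S x \<partial>N)"
        by (simp only: mult.assoc inv[OF g0] mult_1_right)
      finally show ?thesis .
    qed
    have "(\<lambda>m. C * (1 / (1 + \<eta>)) ^ m) \<longlonglongrightarrow> C * 0"
      using \<eta> by (intro tendsto_mult tendsto_const LIMSEQ_power_zero) auto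
    then have "(\<lambda>m. ennreal (C * (1 / (1 + \<eta>)) ^ m)) \<longlonglongrightarrow> ennreal (C * 0)"
      by (rule tendsto_ennrealI)
    then have "(\<integral>\<^sup>+x. w x * indicator ?S x \<partial>N) \<le> ennreal (C * 0)"
      by (rule LIMSEQ_le_const) (use le in auto)
    then have "AE x in N. w x * indicator ?S x = 0"
      by (subst (asm) mult_zero_right) (simp add: nn_integral_0_iff_AE)
    then show ?thesis
      by (rule AE_mp) (auto intro!: AE_I2 simp: indicator_def not_less split: if_splits)
  qed
  have "AE x in N. \<forall>n. w x \<noteq> 0 \<longrightarrow> h x \<le> ennreal ((1 + 1 / real (Suc n))\<^sup>2 * \<beta>)"
    unfolding AE_all_countable by (intro allI *) simp
  then show ?thesis
  proof (rule AE_mp, intro AE_I2 impI)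
    fix x assume x: "\<forall>n. w x \<noteq> 0 \<longrightarrow> h x \<le> ennreal ((1 + 1 / real (Suc n))\<^sup>2 * \<beta>)" "w x \<noteq> 0"
    have "(\<lambda>n. (1 + 1 / real (Suc n))\<^sup>2 * \<beta>) \<longlonglongrightarrow> (1 + 0)\<^sup>2 * \<beta>"
      by (intro tendsto_intros LIMSEQ_Suc[OF lim_1_over_n])
    then have "(\<lambda>n. ennreal ((1 + 1 / real (Suc n))\<^sup>2 * \<beta>)) \<longlonglongrightarrow> ennreal ((1 + 0)\<^sup>2 * \<beta>)"
      by (rule tendsto_ennrealI)
    then have "h x \<le> ennreal ((1 + 0)\<^sup>2 * \<beta>)"
      by (rule LIMSEQ_le_const) (use x in auto)
    then show "h x \<le> ennreal \<beta>" by simp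
  qed
qed

text \<open>Rectangles are a generator stable under intersection, so the integral of K vanishes over
  every measurable set, and densities are unique almost everywhere.\<close>

lemma AE_zero_of_rectangle_integrals_zero:
  fixes K :: "'a \<times> 'b \<Rightarrow> real"
  assumes "finite_measure M1" "finite_measure M2"
    and int: "integrable (M1 \<Otimes>\<^sub>M M2) K"
    and rect: "\<And>S T. S \<in> sets M1 \<Longrightarrow> T \<in> sets M2 \<Longrightarrow>
      (\<integral>p. indicator (S \<times> T) p * K p \<partial>(M1 \<Otimes>\<^sub>M M2)) = 0"
  shows "AE p in M1 \<Otimes>\<^sub>M M2. K p = 0"
proof -
  interpret M1: finite_measure M1 by fact
  interpret M2: finite_measure M2 by fact
  interpret pair_sigma_finite M1 M2 ..
  let ?P = "M1 \<Otimes>\<^sub>M M2"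
  have zero: "(\<integral>p\<in>Q. K p \<partial>?P) = 0" if "Q \<in> sets ?P" for Q
    using Int_stable_pair_measure_generator[of M1 M2] pair_measure_closed[of M1 M2]
      that[unfolded sets_pair_measure]
  proof (induction rule: sigma_sets_induct_disjoint)
    case (basic Q)
    then show ?case by (auto simp: set_lebesgue_integral_def rect)
  next
    case empty
    show ?case by (simp add: set_lebesgue_integral_def)
  next
    case (compl Q)
    have [measurable]: "Q \<in> sets ?P" using compl(1) by (simp add: sets_pair_measure)
    have "(\<integral>p\<in>space M1 \<times> space M2 - Q. K p \<partial>?P) =
       (\<integral>p. indicator (space M1 \<times> space M2) p * K p - indicator Q p * K p \<partial>?P)"
      using sets.sets_into_space[OF \<open>Q \<in> sets ?P\<close>]
      by (auto simp: set_lebesgue_integral_def space_pair_measure indicator_def intro!: Bochner_Integration.integral_cong)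
    also have "\<dots> = (\<integral>p. indicator (space M1 \<times> space M2) p * K p \<partial>?P) - (\<integral>p. indicator Q p * K p \<partial>?P)"
      by (intro Bochner_Integration.integral_diff integrable_real_mult_indicator[OF _ int, unfolded mult.commute[of "K _"]])
         auto
    also have "\<dots> = 0" using compl(2) by (simp add: rect set_lebesgue_integral_def)
    finally show ?case .
  next
    case (union Q)
    have [measurable]: "Q i \<in> sets ?P" for i using union(2) by (auto simp: sets_pair_measure)
    have "set_integrable ?P (\<Union>i. Q i) K"
      unfolding set_integrable_def using int by (intro integrable_mult_indicator) auto
    then have "(\<integral>p\<in>(\<Union>i. Q i). K p \<partial>?P) = (\<Sum>i. \<integral>p\<in>Q i. K p \<partial>?P)"
      using union(1) by (intro lebesgue_integral_countable_add) (auto simp: disjoint_family_on_def)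
    then show ?case using union(3) by simp
  qed
  show ?thesis
    by (rule density_unique_real[OF int integrable_zero]) (simp add: zero)
qed

text \<open>For measurable T, the integral over x of the square of int_T K(x, y) dy is the integral
  of the Gram kernel over T x T. So these inner integrals vanish for almost every x, and with them
  the integrals of K over all rectangles.\<close>

lemma AE_zero_of_gram_zero:
  fixes K :: "'a \<Rightarrow> 'b \<Rightarrow> real"
  assumes "finite_measure M1" "finite_measure M2"
    and meas: "case_prod K \<in> borel_measurable (M1 \<Otimes>\<^sub>M M2)"
    and bound: "\<And>x y. \<bar>K x y\<bar> \<le> C"
    and gram: "AE (y, z) in M2 \<Otimes>\<^sub>M M2. (\<integral>x. K x y * K x z \<partial>M1) = 0"
  shows "AE (x, y) in M1 \<Otimes>\<^sub>M M2. K x y = 0"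
proof -
  interpret M1: finite_measure M1 by fact
  interpret M2: finite_measure M2 by fact
  interpret P12: pair_sigma_finite M1 M2 ..
  interpret P22: pair_sigma_finite M2 M2 ..
  interpret F22: finite_measure "M2 \<Otimes>\<^sub>M M2" by (rule finite_measure_pair_measure) fact+
  interpret F12: finite_measure "M1 \<Otimes>\<^sub>M M2" by (rule finite_measure_pair_measure) fact+
  interpret P122: pair_sigma_finite M1 "M2 \<Otimes>\<^sub>M M2" ..
  interpret F122: finite_measure "M1 \<Otimes>\<^sub>M (M2 \<Otimes>\<^sub>M M2)"
    by (rule finite_measure_pair_measure) (fact | rule F22.finite_measure_axioms)+
  note [measurable (raw)] = measurable_uncurried[OF meas]
  have C: "0 \<le> C" using bound[of undefined undefined] by linarith
  have KK: "\<bar>K x y * K x z\<bar> \<le> C * C" for x y z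
    unfolding abs_mult by (intro mult_mono bound) (auto simp: C)
  have int: "integrable (M1 \<Otimes>\<^sub>M M2) (case_prod K)"
    by (rule F12.integrable_const_bound[where B=C]) (auto simp: bound meas split: prod.splits)
  have inner: "AE x in M1. (\<integral>y. indicator T y * K x y \<partial>M2) = 0" if [measurable]: "T \<in> sets M2" for T
  proof -
    let ?g = "\<lambda>x. \<integral>y. indicator T y * K x y \<partial>M2"
    let ?F = "\<lambda>x (y, z). (indicator T y * K x y) * (indicator T z * K x z)"
    have F_meas [measurable]: "case_prod ?F \<in> borel_measurable (M1 \<Otimes>\<^sub>M (M2 \<Otimes>\<^sub>M M2))"
      by measurable
    have F_bd: "norm (?F x p) \<le> C * C" for x p
      using KK[of x "fst p" "snd p"] C by (auto simp: indicator_def split: prod.splits)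
    have F_int: "integrable (M1 \<Otimes>\<^sub>M (M2 \<Otimes>\<^sub>M M2)) (case_prod ?F)"
      by (rule F122.integrable_const_bound[where B="C*C"]) (use F_bd in auto)
    have sq: "(?g x)\<^sup>2 = (\<integral>p. ?F x p \<partial>(M2 \<Otimes>\<^sub>M M2))" if [measurable]: "x \<in> space M1" for x
    proof -
      have i: "integrable (M2 \<Otimes>\<^sub>M M2) (\<lambda>(y, z). (indicator T y * K x y) * (indicator T z * K x z))"
      proof (rule F22.integrable_const_bound[where B="C*C"])
        show "AE p in M2 \<Otimes>\<^sub>M M2. norm (case p of (y, z) \<Rightarrow> (indicator T y * K x y) * (indicator T z * K x z)) \<le> C * C"
          using F_bd[of x] by auto
        show "(\<lambda>(y, z). (indicator T y * K x y) * (indicator T z * K x z)) \<in> borel_measurable (M2 \<Otimes>\<^sub>M M2)"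
          using measurable_Pair2[OF F_meas that] by simp
      qed
      have "(\<integral>p. ?F x p \<partial>(M2 \<Otimes>\<^sub>M M2)) = (\<integral>y. \<integral>z. (indicator T y * K x y) * (indicator T z * K x z) \<partial>M2 \<partial>M2)"
        using P22.integral_fst[OF i] by simp
      then show ?thesis by (simp add: power2_eq_square)
    qed
    have "(\<integral>x. (?g x)\<^sup>2 \<partial>M1) = (\<integral>x. \<integral>p. ?F x p \<partial>(M2 \<Otimes>\<^sub>M M2) \<partial>M1)"
      by (intro Bochner_Integration.integral_cong refl sq)
    also have "\<dots> = (\<integral>p. \<integral>x. ?F x p \<partial>M1 \<partial>(M2 \<Otimes>\<^sub>M M2))"
      by (rule P122.Fubini_integral[symmetric, OF F_int])
    also have "\<dots> = (\<integral>p. 0 \<partial>(M2 \<Otimes>\<^sub>M M2))"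
    proof (rule integral_cong_AE)
      show "(\<lambda>p. \<integral>x. ?F x p \<partial>M1) \<in> borel_measurable (M2 \<Otimes>\<^sub>M M2)" by measurable
      show "AE p in M2 \<Otimes>\<^sub>M M2. (\<integral>x. ?F x p \<partial>M1) = 0"
        using gram
      proof (rule AE_mp, intro AE_I2 impI)
        fix p assume "case p of (y, z) \<Rightarrow> (\<integral>x. K x y * K x z \<partial>M1) = 0"
        moreover have "(\<integral>x. ?F x p \<partial>M1) = (\<integral>x. (indicator T (fst p) * indicator T (snd p)) * (K x (fst p) * K x (snd p)) \<partial>M1)"
          by (intro Bochner_Integration.integral_cong) (auto split: prod.splits simp: mult_ac)
        ultimately show "(\<integral>x. ?F x p \<partial>M1) = 0" by (auto split: prod.splits)
      qed
    qed simp
    finally have z: "(\<integral>x. (?g x)\<^sup>2 \<partial>M1) = 0" by simp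
    have gm [measurable]: "?g \<in> borel_measurable M1" by measurable
    have "norm ((?g x)\<^sup>2) \<le> (C * measure M2 (space M2))\<^sup>2" for x
    proof -
      have "norm (?g x) \<le> (\<integral>y. C \<partial>M2)"
        by (rule order_trans[OF integral_norm_bound integral_mono'])
           (auto simp: indicator_def bound C)
      then show ?thesis using power_mono[of "\<bar>?g x\<bar>" _ 2] by (simp add: mult.commute power_abs)
    qed
    then have "integrable M1 (\<lambda>x. (?g x)\<^sup>2)"
      by (intro M1.integrable_const_bound[where B="(C * measure M2 (space M2))\<^sup>2"]) auto
    then have "AE x in M1. (?g x)\<^sup>2 = 0"
      using z by (subst (asm) integral_nonneg_eq_0_iff_AE) auto
    then show ?thesis by auto
  qed
  have "AE p in M1 \<Otimes>\<^sub>M M2. case_prod K p = 0"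
  proof (rule AE_zero_of_rectangle_integrals_zero[OF assms(1,2) int])
    fix S T assume [measurable]: "S \<in> sets M1" "T \<in> sets M2"
    have i: "integrable (M1 \<Otimes>\<^sub>M M2) (\<lambda>(x, y). indicator S x * (indicator T y * K x y))"
      by (rule F12.integrable_const_bound[where B=C]) (auto simp: bound C indicator_def split: prod.splits)
    have "(\<integral>p. indicator (S \<times> T) p * case_prod K p \<partial>(M1 \<Otimes>\<^sub>M M2)) =
      (\<integral>p. (case p of (x, y) \<Rightarrow> indicator S x * (indicator T y * K x y)) \<partial>(M1 \<Otimes>\<^sub>M M2))"
      by (intro Bochner_Integration.integral_cong) (auto simp: indicator_def)
    also have "\<dots> = (\<integral>x. \<integral>y. indicator S x * (indicator T y * K x y) \<partial>M2 \<partial>M1)"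
      using P12.integral_fst[OF i] by simp
    also have "\<dots> = (\<integral>x. 0 \<partial>M1)"
      by (rule integral_cong_AE) (use inner[of T] in auto)
    finally show "(\<integral>p. indicator (S \<times> T) p * case_prod K p \<partial>(M1 \<Otimes>\<^sub>M M2)) = 0" by simp
  qed
  then show ?thesis by (simp add: case_prod_beta)
qed

lemma (in pair_sigma_finite) AE_pair_swap:
  assumes "AE (x, y) in M1 \<Otimes>\<^sub>M M2. P x y"
  shows "AE (y, x) in M2 \<Otimes>\<^sub>M M1. P x y"
proof -
  have "AE (x, y) in distr (M2 \<Otimes>\<^sub>M M1) (M1 \<Otimes>\<^sub>M M2) (\<lambda>(x, y). (y, x)). P x y"
    using assms by (subst distr_pair_swap[symmetric])
  then have "AE r in M2 \<Otimes>\<^sub>M M1. case (case r of (x, y) \<Rightarrow> (y, x)) of (x, y) \<Rightarrow> P x y"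
    by (rule AE_distrD[rotated]) measurable
  then show ?thesis by (simp add: case_prod_beta)
qed

text \<open>Once coordinate i is integrated out, avoiding the null set becomes a condition on
  coordinate j alone, which \<open>AE_PiM_component\<close> transports to the product.\<close>

lemma (in prob_space) AE_PiM_pair:
  assumes "AE (x, y) in M \<Otimes>\<^sub>M M. P x y" and I: "finite I" "i \<in> I" "j \<in> I" "i \<noteq> j"
  shows "AE x in (\<Pi>\<^sub>M i\<in>I. M). P (x i) (x j)"
proof -
  interpret pair: pair_sigma_finite M M ..
  interpret product_sigma_finite "\<lambda>_. M" ..
  obtain N where N: "\<And>p. p \<in> space (M \<Otimes>\<^sub>M M) - N \<Longrightarrow> (case p of (x, y) \<Rightarrow> P x y)" "N \<in> null_sets (M \<Otimes>\<^sub>M M)"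
    using AE_E3[OF assms(1)] by metis
  then have [measurable]: "N \<in> sets (M \<Otimes>\<^sub>M M)" by auto
  define J where "J = I - {i}"
  have J: "I = insert i J" "i \<notin> J" "finite J" "j \<in> J" using I by (auto simp: J_def)
  have "AE p in M \<Otimes>\<^sub>M M. p \<notin> N" using N(2) by (rule AE_not_in)
  then have "AE y in M. AE z in M. (y, z) \<notin> N" by (rule pair.AE_pair)
  then have "AE z in M. AE y in M. (y, z) \<notin> N"
    by (subst (asm) pair.AE_commute) measurable
  then have "AE z in M. (\<integral>\<^sup>+y. indicator N (y, z) \<partial>M) = 0"
  proof (rule AE_mp, intro AE_I2 impI)
    fix z assume [measurable]: "z \<in> space M" and z: "AE y in M. (y, z) \<notin> N"
    have "(\<lambda>y. indicator N (y, z) :: ennreal) \<in> borel_measurable M" by measurable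
    then show "(\<integral>\<^sup>+y. indicator N (y, z) \<partial>M) = 0"
      by (subst nn_integral_0_iff_AE) (use z in \<open>auto simp: indicator_def\<close>)
  qed
  then have "AE x in (\<Pi>\<^sub>M i\<in>J. M). (\<integral>\<^sup>+y. indicator N (y, x j) \<partial>M) = 0"
    by (rule AE_PiM_component[OF prob_space_axioms \<open>j \<in> J\<close>])
  then have "(\<integral>\<^sup>+x. \<integral>\<^sup>+y. indicator N (y, x j) \<partial>M \<partial>(\<Pi>\<^sub>M i\<in>J. M)) = 0"
    using J by (subst nn_integral_0_iff_AE) (auto intro!: borel_measurable_nn_integral)
  moreover have m: "(\<lambda>x. indicator N (x i, x j) :: ennreal) \<in> borel_measurable (\<Pi>\<^sub>M i\<in>I. M)"
    using I by measurable
  then have "(\<integral>\<^sup>+x. indicator N (x i, x j) \<partial>(\<Pi>\<^sub>M i\<in>I. M)) =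
     (\<integral>\<^sup>+x. \<integral>\<^sup>+y. indicator N ((x(i := y)) i, (x(i := y)) j) \<partial>M \<partial>(\<Pi>\<^sub>M i\<in>J. M))"
    using J unfolding J(1) by (intro product_nn_integral_insert) auto
  ultimately have "(\<integral>\<^sup>+x. indicator N (x i, x j) \<partial>(\<Pi>\<^sub>M i\<in>I. M)) = 0"
    using I by simp
  then have "AE x in (\<Pi>\<^sub>M i\<in>I. M). (indicator N (x i, x j) :: ennreal) = 0"
    using m by (subst (asm) nn_integral_0_iff_AE) auto
  then show ?thesis
    by (rule AE_mp) (use N(1) I in \<open>auto intro!: AE_I2 simp: space_PiM space_pair_measure PiE_iff indicator_def split: if_splits\<close>)
qed

text \<open>The two functions differ only on a subset of a null set, and every such subset is
  measurable in the completion.\<close>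

lemma borel_measurable_completion_AE_cong:
  assumes g: "g \<in> M \<rightarrow>\<^sub>M N" and fg: "AE x in M. f x = g x" and f: "f \<in> space M \<rightarrow> space N"
  shows "f \<in> completion M \<rightarrow>\<^sub>M N"
proof (rule measurableI)
  fix S assume [measurable]: "S \<in> sets N"
  have [measurable]: "g \<in> completion M \<rightarrow>\<^sub>M N" using g by (rule measurable_completion)
  have [measurable]: "Measurable.pred (completion M) (\<lambda>x. f x \<noteq> g x)"
    by (rule sets_completion_AE) (use fg in auto)
  have [measurable]: "Measurable.pred (completion M) (\<lambda>x. f x \<in> S \<and> f x \<noteq> g x)"
    by (rule sets_completion_AE, rule AE_mp[OF fg]) (auto intro!: AE_I2)
  have "Measurable.pred (completion M) (\<lambda>x. (g x \<in> S \<and> \<not> f x \<noteq> g x) \<or> (f x \<in> S \<and> f x \<noteq> g x))"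
    by measurable
  also have "(\<lambda>x. (g x \<in> S \<and> \<not> f x \<noteq> g x) \<or> (f x \<in> S \<and> f x \<noteq> g x)) = (\<lambda>x. f x \<in> S)" by auto
  finally show "f -` S \<inter> space (completion M) \<in> sets (completion M)"
    by (simp add: pred_def vimage_def Int_def conj_commute)
qed (use f in auto)

text \<open>The membership bits of the coordinates are independent, and the law of each depends on
  the set only through its measure. As \<open>compose\<close> is undefined outside \<open>I\<close>,
  the function \<open>g\<close> must not look there.\<close>

lemma (in prob_space) distr_PiM_indicator_cong:
  assumes [measurable]: "A \<in> sets M" "A' \<in> sets M" and eq: "measure M A = measure M A'" and "finite I"
    and g: "\<And>x y. (\<And>i. i \<in> I \<Longrightarrow> x i = y i) \<Longrightarrow> g x = g y"
  shows "(\<integral>\<^sup>+x. g (\<lambda>i. x i \<in> A) \<partial>(\<Pi>\<^sub>M i\<in>I. M)) = (\<integral>\<^sup>+x. g (\<lambda>i. x i \<in> A') \<partial>(\<Pi>\<^sub>M i\<in>I. M))"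
proof -
  \<comment> \<open>Only the sigma-algebra of this target matters; \<open>distr_PiM_finite_prob_space'\<close> wants a probability space.\<close>
  let ?C = "return (count_space UNIV) True"
  have C: "prob_space ?C" by (rule prob_space_return) simp
  have distr: "(\<integral>\<^sup>+x. g (\<lambda>i. x i \<in> S) \<partial>(\<Pi>\<^sub>M i\<in>I. M)) = (\<integral>\<^sup>+y. g y \<partial>(\<Pi>\<^sub>M i\<in>I. distr M ?C (\<lambda>t. t \<in> S)))"
    if [measurable]: "S \<in> sets M" for S
  proof -
    have m: "compose I (\<lambda>t. t \<in> S) \<in> (\<Pi>\<^sub>M i\<in>I. M) \<rightarrow>\<^sub>M (\<Pi>\<^sub>M i\<in>I. ?C)"
      unfolding compose_def
      by (rule measurable_restrict, subst measurable_cong_sets[OF refl sets_return]) measurable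
    have "sets (\<Pi>\<^sub>M i\<in>I. ?C) = sets (\<Pi>\<^sub>M i\<in>I. count_space UNIV :: bool measure)"
      by (rule sets_PiM_cong) auto
    also have "\<dots> = Pow (I \<rightarrow>\<^sub>E UNIV)"
      using \<open>finite I\<close> by (subst count_space_PiM_finite) auto
    finally have "sets (\<Pi>\<^sub>M i\<in>I. ?C) = Pow (I \<rightarrow>\<^sub>E UNIV)" .
    then have gm: "g \<in> borel_measurable (\<Pi>\<^sub>M i\<in>I. ?C)"
      by (auto intro!: measurableI simp: space_PiM)
    have "(\<integral>\<^sup>+x. g (\<lambda>i. x i \<in> S) \<partial>(\<Pi>\<^sub>M i\<in>I. M)) = (\<integral>\<^sup>+x. g (compose I (\<lambda>t. t \<in> S) x) \<partial>(\<Pi>\<^sub>M i\<in>I. M))"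
      by (intro nn_integral_cong g) (auto simp: compose_def)
    also have "\<dots> = (\<integral>\<^sup>+y. g y \<partial>distr (\<Pi>\<^sub>M i\<in>I. M) (\<Pi>\<^sub>M i\<in>I. ?C) (compose I (\<lambda>t. t \<in> S)))"
      by (rule nn_integral_distr[OF m, symmetric]) (simp add: gm)
    also have "distr (\<Pi>\<^sub>M i\<in>I. M) (\<Pi>\<^sub>M i\<in>I. ?C) (compose I (\<lambda>t. t \<in> S)) = (\<Pi>\<^sub>M i\<in>I. distr M ?C (\<lambda>t. t \<in> S))"
      by (rule distr_PiM_finite_prob_space') (use \<open>finite I\<close> C prob_space_axioms in auto)
    finally show ?thesis .
  qed
  have "distr M ?C (\<lambda>t. t \<in> A) = distr M ?C (\<lambda>t. t \<in> A')"
  proof (rule measure_eqI_finite[where A=UNIV])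
    fix b :: bool
    have "emeasure M ((\<lambda>t. t \<in> S) -` {b} \<inter> space M) = (if b then emeasure M S else emeasure M (space M - S))" if "S \<in> sets M" for S
      using sets.sets_into_space[OF that] by (auto intro!: arg_cong[where f="emeasure M"])
    then show "emeasure (distr M ?C (\<lambda>t. t \<in> A)) {b} = emeasure (distr M ?C (\<lambda>t. t \<in> A')) {b}"
      by (simp add: emeasure_distr emeasure_eq_measure prob_compl eq)
  qed auto
  then show ?thesis by (simp add: distr)
qed

section \<open>Vertex pairs\<close>

lemma vertex_pairs_finite [simp]: "finite (vertex_pairs k)"
  unfolding vertex_pairs_def by (rule finite_subset[of _ "Pow {1..k}"]) auto

lemma vertex_pairs_0 [simp]: "vertex_pairs 0 = {}"
  unfolding vertex_pairs_def by auto

lemma card_vertex_pairs: "card (vertex_pairs k) = k choose 2"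
  unfolding vertex_pairs_def using n_subsets[of "{1..k}" 2] by simp

lemma vertex_pairs_cases:
  assumes "e \<in> vertex_pairs k"
  obtains i j where "i \<in> {1..k}" "j \<in> {1..k}" "i < j" "e = {i, j}" "Min e = i" "Max e = j"
proof -
  from assms have "card e = 2" and sub: "e \<subseteq> {1..k}" by (auto simp: vertex_pairs_def)
  then obtain x y where e: "e = {x, y}" "x \<noteq> y" by (auto simp: card_2_iff)
  show thesis
  proof (cases "x < y")
    case True
    then show thesis using that[of x y] e sub by auto
  next
    case False
    then show thesis using that[of y x] e sub by (auto simp: insert_commute)
  qed
qed

lemma vertex_pairs_Min_Max:
  assumes "e \<in> vertex_pairs k"
  shows "Min e \<in> {1..k}" "Max e \<in> {1..k}" "Min e < Max e"
  using assms by (auto elim!: vertex_pairs_cases)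

lemma vertex_pairs_Suc:
  "vertex_pairs (Suc k) = vertex_pairs k \<union> (\<lambda>i. {i, Suc k}) ` {1..k}"
proof
  show "vertex_pairs (Suc k) \<subseteq> vertex_pairs k \<union> (\<lambda>i. {i, Suc k}) ` {1..k}"
  proof
    fix e assume "e \<in> vertex_pairs (Suc k)"
    then obtain i j where "i \<in> {1..Suc k}" "j \<in> {1..Suc k}" "i < j" "e = {i, j}"
      by (rule vertex_pairs_cases)
    then show "e \<in> vertex_pairs k \<union> (\<lambda>i. {i, Suc k}) ` {1..k}"
      by (cases "j = Suc k") (auto simp: vertex_pairs_def)
  qed
next
  show "vertex_pairs k \<union> (\<lambda>i. {i, Suc k}) ` {1..k} \<subseteq> vertex_pairs (Suc k)"
    by (auto simp: vertex_pairs_def)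
qed

lemma prod_vertex_pairs_Suc:
  fixes g :: "nat \<Rightarrow> nat \<Rightarrow> 'c::comm_monoid_mult"
  shows "(\<Prod>e\<in>vertex_pairs (Suc k). g (Min e) (Max e)) =
    (\<Prod>e\<in>vertex_pairs k. g (Min e) (Max e)) * (\<Prod>i\<in>{1..k}. g i (Suc k))"
proof -
  have inj: "inj_on (\<lambda>i. {i, Suc k}) {1..k}" by (auto simp: inj_on_def doubleton_eq_iff)
  have disj: "vertex_pairs k \<inter> (\<lambda>i. {i, Suc k}) ` {1..k} = {}" by (auto simp: vertex_pairs_def)
  have "(\<Prod>e\<in>vertex_pairs (Suc k). g (Min e) (Max e)) =
      (\<Prod>e\<in>vertex_pairs k. g (Min e) (Max e)) *
      (\<Prod>e\<in>(\<lambda>i. {i, Suc k}) ` {1..k}. g (Min e) (Max e))"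
    unfolding vertex_pairs_Suc by (rule prod.union_disjoint) (use disj in simp_all)
  also have "(\<Prod>e\<in>(\<lambda>i. {i, Suc k}) ` {1..k}. g (Min e) (Max e)) = (\<Prod>i\<in>{1..k}. g i (Suc k))"
    unfolding prod.reindex[OF inj] by (rule prod.cong) auto
  finally show ?thesis .
qed

lemma prod_vertex_pairs_2:
  fixes g :: "nat \<Rightarrow> nat \<Rightarrow> 'c::comm_monoid_mult"
  shows "(\<Prod>e\<in>vertex_pairs 2. g (Min e) (Max e)) = g 1 2"
  using prod_vertex_pairs_Suc[of g 1] prod_vertex_pairs_Suc[of g 0]
  by (simp add: numeral_eq_Suc)

lemma prod_vertex_pairs_3:
  fixes g :: "nat \<Rightarrow> nat \<Rightarrow> 'c::comm_monoid_mult"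
  shows "(\<Prod>e\<in>vertex_pairs 3. g (Min e) (Max e)) = g 1 2 * g 1 3 * g 2 3"
  using prod_vertex_pairs_Suc[of g 2] prod_vertex_pairs_Suc[of g 1] prod_vertex_pairs_Suc[of g 0]
  by (simp add: numeral_eq_Suc atLeastAtMostSuc_conv mult_ac)

lemma prod_vertex_pairs_4:
  fixes g :: "nat \<Rightarrow> nat \<Rightarrow> 'c::comm_monoid_mult"
  shows "(\<Prod>e\<in>vertex_pairs 4. g (Min e) (Max e)) = g 1 2 * g 1 3 * g 1 4 * g 2 3 * g 2 4 * g 3 4"
  using prod_vertex_pairs_Suc[of g 3] prod_vertex_pairs_Suc[of g 2] prod_vertex_pairs_Suc[of g 1]
    prod_vertex_pairs_Suc[of g 0]
  by (simp add: numeral_eq_Suc atLeastAtMostSuc_conv mult_ac)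

lemma measurable_vertex_pair:
  assumes "e \<in> vertex_pairs k"
  shows "(\<lambda>x. x (Min e)) \<in> (\<Pi>\<^sub>M i\<in>{1..k}. M) \<rightarrow>\<^sub>M M" "(\<lambda>x. x (Max e)) \<in> (\<Pi>\<^sub>M i\<in>{1..k}. M) \<rightarrow>\<^sub>M M"
  using vertex_pairs_Min_Max[OF assms] by (auto intro!: measurable_component_singleton)

section \<open>Weighted clique densities\<close>

text \<open>V stands for 1 - s U. The locale has no upper bound on V because negative s occurs,
  where 1 - s U can exceed 1; the bound enters later as \<open>V_le_1\<close>.\<close>

locale sym_kernel = prob_space M for M :: "'a measure" +
  fixes V :: "'a \<Rightarrow> 'a \<Rightarrow> ennreal"
  assumes V_measurable: "case_prod V \<in> borel_measurable (M \<Otimes>\<^sub>M M)"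
    and V_sym: "V x y = V y x"
begin

lemmas V_measurable_uncurried [measurable (raw)] = measurable_uncurried[OF V_measurable]

text \<open>The two-set form contains \<open>cliques\<close> as the case m = 0, B = UNIV, so
  measurability and the recursion over points need only one proof.\<close>

definition mixed :: "'a set \<Rightarrow> 'a set \<Rightarrow> nat \<Rightarrow> nat \<Rightarrow> ('a \<Rightarrow> ennreal) \<Rightarrow> ennreal" where
  "mixed A B m j f =
     (\<integral>\<^sup>+x. (\<Prod>i\<in>{1..j}. f (x i) * indicator B (x i)) *
        (\<Prod>e\<in>vertex_pairs j. V (x (Min e)) (x (Max e))) *
        (\<integral>\<^sup>+z. f z * indicator A z * (\<Prod>i\<in>{1..j}. V (x i) z) \<partial>M) ^ m
      \<partial>(\<Pi>\<^sub>M i\<in>{1..j}. M))"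

definition cliques :: "nat \<Rightarrow> ('a \<Rightarrow> ennreal) \<Rightarrow> ennreal" where
  "cliques k f =
     (\<integral>\<^sup>+x. (\<Prod>i\<in>{1..k}. f (x i)) * (\<Prod>e\<in>vertex_pairs k. V (x (Min e)) (x (Max e)))
      \<partial>(\<Pi>\<^sub>M i\<in>{1..k}. M))"

lemma cliques_eq_mixed: "cliques k f = mixed {} UNIV 0 k f"
  by (simp add: cliques_def mixed_def)

lemma mixed_0: "mixed A B m 0 f = (\<integral>\<^sup>+z. f z * indicator A z \<partial>M) ^ m"
  by (simp add: mixed_def PiM_empty nn_integral_count_space_finite)

lemma mixed_integrand_measurable [measurable]:
  assumes [measurable]: "(\<lambda>(w, y). f w y) \<in> borel_measurable (N \<Otimes>\<^sub>M M)" "A \<in> sets M" "B \<in> sets M"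
  shows "(\<lambda>(w, x). (\<Prod>i\<in>{1..j}. f w (x i) * indicator B (x i)) *
        (\<Prod>e\<in>vertex_pairs j. V (x (Min e)) (x (Max e))) *
        (\<integral>\<^sup>+z. f w z * indicator A z * (\<Prod>i\<in>{1..j}. V (x i) z) \<partial>M) ^ m)
      \<in> borel_measurable (N \<Otimes>\<^sub>M (\<Pi>\<^sub>M i\<in>{1..j}. M))"
proof -
  note [measurable] = measurable_vertex_pair[where k="j" and M=M]
  show ?thesis
    by measurable
qed

lemma mixed_measurable:
  assumes [measurable]: "(\<lambda>(w, y). f w y) \<in> borel_measurable (N \<Otimes>\<^sub>M M)" "A \<in> sets M" "B \<in> sets M"
  shows "(\<lambda>w. mixed A B m j (f w)) \<in> borel_measurable N"
proof -
  interpret sigma_finite_measure "\<Pi>\<^sub>M i\<in>{1..j}. M"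
    by (intro prob_space_imp_sigma_finite prob_space_PiM prob_space_axioms)
  show ?thesis
    unfolding mixed_def by (rule borel_measurable_nn_integral) (rule mixed_integrand_measurable[OF assms])
qed

text \<open>When the last point y of B is integrated outermost, the factors of its pairs merge into
  the weight, both at the other points of B and inside the integral over A.\<close>

lemma mixed_Suc:
  assumes [measurable]: "f \<in> borel_measurable M" "A \<in> sets M" "B \<in> sets M"
  shows "mixed A B m (Suc j) f =
    (\<integral>\<^sup>+y. f y * indicator B y * mixed A B m j (\<lambda>x. f x * V x y) \<partial>M)"
proof -
  interpret product_sigma_finite "\<lambda>_. M" ..
  let ?g = "\<lambda>x. (\<Prod>i\<in>{1..Suc j}. f (x i) * indicator B (x i)) *
        (\<Prod>e\<in>vertex_pairs (Suc j). V (x (Min e)) (x (Max e))) *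
        (\<integral>\<^sup>+z. f z * indicator A z * (\<Prod>i\<in>{1..Suc j}. V (x i) z) \<partial>M) ^ m"
  let ?h = "\<lambda>y x. (\<Prod>i\<in>{1..j}. f (x i) * V (x i) y * indicator B (x i)) *
        (\<Prod>e\<in>vertex_pairs j. V (x (Min e)) (x (Max e))) *
        (\<integral>\<^sup>+z. f z * V z y * indicator A z * (\<Prod>i\<in>{1..j}. V (x i) z) \<partial>M) ^ m"
  have *: "?g \<in> borel_measurable (\<Pi>\<^sub>M i\<in>{1..Suc j}. M)"
  proof -
    note [measurable] = measurable_vertex_pair[where k="Suc j" and M=M]
    show ?thesis by measurable
  qed
  have ins: "{1..Suc j} = insert (Suc j) {1..j}" by auto
  have "mixed A B m (Suc j) f = (\<integral>\<^sup>+y. \<integral>\<^sup>+x. ?g (x(Suc j := y)) \<partial>(\<Pi>\<^sub>M i\<in>{1..j}. M) \<partial>M)"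
    unfolding mixed_def using * unfolding ins
    by (subst product_nn_integral_insert_rev) auto
  also have "\<dots> = (\<integral>\<^sup>+y. \<integral>\<^sup>+x. f y * indicator B y * ?h y x \<partial>(\<Pi>\<^sub>M i\<in>{1..j}. M) \<partial>M)"
  proof (intro nn_integral_cong)
    fix y x
    have 1: "(\<Prod>i\<in>{1..Suc j}. f ((x(Suc j := y)) i) * indicator B ((x(Suc j := y)) i)) =
       f y * indicator B y * (\<Prod>i\<in>{1..j}. f (x i) * indicator B (x i))"
      unfolding ins by simp
    have 2: "(\<Prod>e\<in>vertex_pairs (Suc j). V ((x(Suc j := y)) (Min e)) ((x(Suc j := y)) (Max e))) =
       (\<Prod>e\<in>vertex_pairs j. V (x (Min e)) (x (Max e))) * (\<Prod>i\<in>{1..j}. V (x i) y)"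
    proof -
      have "(\<Prod>e\<in>vertex_pairs j. V ((x(Suc j := y)) (Min e)) ((x(Suc j := y)) (Max e))) =
         (\<Prod>e\<in>vertex_pairs j. V (x (Min e)) (x (Max e)))"
        by (rule prod.cong) (auto dest: vertex_pairs_Min_Max)
      then show ?thesis
        unfolding prod_vertex_pairs_Suc[of "\<lambda>i l. V ((x(Suc j := y)) i) ((x(Suc j := y)) l)"] by simp
    qed
    have 3: "(\<Prod>i\<in>{1..Suc j}. V ((x(Suc j := y)) i) z) = V z y * (\<Prod>i\<in>{1..j}. V (x i) z)" for z
      unfolding ins by (simp add: V_sym[of y])
    show "?g (x(Suc j := y)) = f y * indicator B y * ?h y x"
      unfolding 1 2 3 by (simp add: prod.distrib mult_ac)
  qed
  also have "\<dots> = (\<integral>\<^sup>+y. f y * indicator B y * mixed A B m j (\<lambda>x. f x * V x y) \<partial>M)"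
  proof (rule nn_integral_cong)
    fix y assume [simp]: "y \<in> space M"
    have m: "(\<lambda>(w, y). f y * V y w) \<in> borel_measurable (M \<Otimes>\<^sub>M M)" by measurable
    have [measurable]: "?h y \<in> borel_measurable (\<Pi>\<^sub>M i\<in>{1..j}. M)"
      using measurable_Pair_compose_split[OF mixed_integrand_measurable[OF m assms(2,3)],
          of "\<lambda>_. y" "\<Pi>\<^sub>M i\<in>{1..j}. M" "\<lambda>x. x"] by simp
    show "(\<integral>\<^sup>+x. f y * indicator B y * ?h y x \<partial>(\<Pi>\<^sub>M i\<in>{1..j}. M)) =
      f y * indicator B y * mixed A B m j (\<lambda>x. f x * V x y)"
      unfolding mixed_def by (rule nn_integral_cmult) measurable
  qed
  finally show ?thesis .
qed

lemma cliques_0 [simp]: "cliques 0 f = 1"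
  by (simp add: cliques_eq_mixed mixed_0)

text \<open>The recursion for \<open>mixed\<close> asks for measurable sets, which
  \<open>UNIV\<close> need not be in M.\<close>

lemma mixed_UNIV_space: "mixed A UNIV m j f = mixed A (space M) m j f"
  unfolding mixed_def
  by (intro nn_integral_cong arg_cong2[where f="(*)"] prod.cong refl)
     (auto simp: space_PiM PiE_iff)

lemma cliques_eq_mixed': "cliques k f = mixed {} (space M) 0 k f"
  by (simp add: cliques_eq_mixed mixed_UNIV_space)

lemma cliques_measurable:
  assumes "(\<lambda>(w, y). f w y) \<in> borel_measurable (N \<Otimes>\<^sub>M M)"
  shows "(\<lambda>w. cliques k (f w)) \<in> borel_measurable N"
  unfolding cliques_eq_mixed' by (rule mixed_measurable[OF assms]) auto

lemma cliques_Suc: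
  assumes [measurable]: "f \<in> borel_measurable M"
  shows "cliques (Suc k) f = (\<integral>\<^sup>+y. f y * cliques k (\<lambda>x. f x * V x y) \<partial>M)"
  unfolding cliques_eq_mixed' by (subst mixed_Suc) (auto intro!: nn_integral_cong)

lemma cliques_1:
  assumes [measurable]: "f \<in> borel_measurable M"
  shows "cliques (Suc 0) f = (\<integral>\<^sup>+y. f y \<partial>M)"
  by (subst cliques_Suc) auto

lemma cliques_mono:
  assumes "\<And>x. x \<in> space M \<Longrightarrow> f x \<le> g x"
  shows "cliques k f \<le> cliques k g"
  unfolding cliques_def
  by (intro nn_integral_mono mult_right_mono prod_mono_ennreal)
     (auto intro!: assms simp: space_PiM PiE_iff)

sublocale pair: pair_sigma_finite M M ..

lemma mixed_step_measurable:
  assumes [measurable]: "f \<in> borel_measurable M" "A \<in> sets M" "B \<in> sets M"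
  shows "(\<lambda>y. mixed A B m j (\<lambda>x. f x * V x y)) \<in> borel_measurable M"
  by (rule mixed_measurable) measurable

lemma cliques_step_measurable:
  assumes [measurable]: "f \<in> borel_measurable M"
  shows "(\<lambda>y. cliques k (\<lambda>x. f x * V x y)) \<in> borel_measurable M"
  by (rule cliques_measurable) measurable

lemma cliques_step2_measurable:
  assumes [measurable]: "f \<in> borel_measurable M"
  shows "(\<lambda>(x, y). cliques k (\<lambda>z. f z * V z x * V z y)) \<in> borel_measurable (M \<Otimes>\<^sub>M M)"
proof -
  have "(\<lambda>w. cliques k (\<lambda>z. f z * V z (fst w) * V z (snd w))) \<in> borel_measurable (M \<Otimes>\<^sub>M M)"
    by (rule cliques_measurable) measurable
  then show ?thesis by (simp add: case_prod_beta)
qed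

text \<open>In \<open>mixed A B m j f\<close>, the \<open>m\<close> points in \<open>A\<close> have been integrated out: they do not interact
  with each other when \<open>V = 1\<close> on \<open>A \<times> A\<close>, so only the \<open>j\<close> points in \<open>B\<close> remain.\<close>

lemma mixed_absorb:
  assumes f: "f \<in> borel_measurable M" and [measurable]: "A \<in> sets M" "B \<in> sets M"
    and one: "\<And>x y. x \<in> A \<Longrightarrow> y \<in> A \<Longrightarrow> V x y = 1"
  shows "(\<integral>\<^sup>+x. f x * indicator A x * mixed A B m j (\<lambda>z. f z * V z x) \<partial>M) = mixed A B (Suc m) j f"
  using f
proof (induction j arbitrary: f)
  case 0
  note [measurable] = 0
  have "(\<integral>\<^sup>+x. f x * indicator A x * mixed A B m 0 (\<lambda>z. f z * V z x) \<partial>M) =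
    (\<integral>\<^sup>+x. f x * indicator A x * (\<integral>\<^sup>+z. f z * indicator A z \<partial>M) ^ m \<partial>M)"
  proof (intro nn_integral_cong)
    fix x
    have "(\<integral>\<^sup>+z. f z * V z x * indicator A z \<partial>M) = (\<integral>\<^sup>+z. f z * indicator A z \<partial>M)" if "x \<in> A"
      using that by (intro nn_integral_cong) (auto simp: indicator_def one)
    then show "f x * indicator A x * mixed A B m 0 (\<lambda>z. f z * V z x) =
      f x * indicator A x * (\<integral>\<^sup>+z. f z * indicator A z \<partial>M) ^ m"
      unfolding mixed_0 by (cases "x \<in> A") auto
  qed
  also have "\<dots> = (\<integral>\<^sup>+z. f z * indicator A z \<partial>M) * (\<integral>\<^sup>+z. f z * indicator A z \<partial>M) ^ m"
    by (rule nn_integral_multc) measurable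
  finally show ?case by (simp add: mixed_0)
next
  case (Suc j)
  note [measurable] = Suc.prems
  let ?g = "\<lambda>x y. f x * indicator A x * (f y * V y x * indicator B y *
      mixed A B m j (\<lambda>z. f z * V z x * V z y))"
  have mm: "(\<lambda>w. mixed A B m j (\<lambda>z. f z * V z (fst w) * V z (snd w))) \<in> borel_measurable (M \<Otimes>\<^sub>M M)"
    by (rule mixed_measurable) measurable
  have [measurable]: "(\<lambda>(x, y). mixed A B m j (\<lambda>z. f z * V z x * V z y)) \<in> borel_measurable (M \<Otimes>\<^sub>M M)"
    using mm by (simp add: case_prod_beta)
  have "(\<integral>\<^sup>+x. f x * indicator A x * mixed A B m (Suc j) (\<lambda>z. f z * V z x) \<partial>M) =
     (\<integral>\<^sup>+x. \<integral>\<^sup>+y. ?g x y \<partial>M \<partial>M)"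
    by (intro nn_integral_cong) (simp add: mixed_Suc nn_integral_cmult)
  also have "\<dots> = (\<integral>\<^sup>+y. \<integral>\<^sup>+x. ?g x y \<partial>M \<partial>M)"
    by (rule pair.Fubini'[symmetric]) measurable
  also have "\<dots> = (\<integral>\<^sup>+y. \<integral>\<^sup>+x. (f y * indicator B y) * ((f x * V x y) * indicator A x *
      mixed A B m j (\<lambda>z. f z * V z y * V z x)) \<partial>M \<partial>M)"
    by (intro nn_integral_cong) (simp add: mult_ac V_sym)
  also have "\<dots> = (\<integral>\<^sup>+y. (f y * indicator B y) * mixed A B (Suc m) j (\<lambda>x. f x * V x y) \<partial>M)"
    by (intro nn_integral_cong, subst nn_integral_cmult) (auto simp: Suc.IH)
  also have "\<dots> = mixed A B (Suc m) (Suc j) f"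
    by (simp add: mixed_Suc)
  finally show ?case .
qed

text \<open>Induction on k: the new point lies in A and is absorbed by \<open>mixed_absorb\<close>,
  or lies in B and is added by \<open>mixed_Suc\<close>; Pascal's rule collects the terms.\<close>

lemma cliques_split:
  assumes f: "f \<in> borel_measurable M" and [measurable]: "A \<in> sets M" "B \<in> sets M"
    and AB: "A \<inter> B = {}" "A \<union> B = space M"
    and one: "\<And>x y. x \<in> A \<Longrightarrow> y \<in> A \<Longrightarrow> V x y = 1"
  shows "cliques k f = (\<Sum>j\<le>k. of_nat (k choose j) * mixed A B (k - j) j f)"
  using f
proof (induction k arbitrary: f)
  case 0
  then show ?case by (simp add: mixed_0)
next
  case (Suc k)
  note [measurable] = Suc.prems mixed_step_measurable[OF Suc.prems]
  have "cliques (Suc k) f =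
     (\<integral>\<^sup>+y. (\<Sum>j\<le>k. of_nat (k choose j) * (f y * indicator A y * mixed A B (k - j) j (\<lambda>x. f x * V x y))) +
           (\<Sum>j\<le>k. of_nat (k choose j) * (f y * indicator B y * mixed A B (k - j) j (\<lambda>x. f x * V x y))) \<partial>M)"
    unfolding cliques_Suc[OF Suc.prems]
  proof (rule nn_integral_cong)
    fix y assume "y \<in> space M"
    then have y: "y \<in> A \<and> y \<notin> B \<or> y \<notin> A \<and> y \<in> B" using AB by auto
    have "cliques k (\<lambda>x. f x * V x y) = (\<Sum>j\<le>k. of_nat (k choose j) * mixed A B (k - j) j (\<lambda>x. f x * V x y))"
      by (rule Suc.IH) (use \<open>y \<in> space M\<close> in measurable)
    then show "f y * cliques k (\<lambda>x. f x * V x y) =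
      (\<Sum>j\<le>k. of_nat (k choose j) * (f y * indicator A y * mixed A B (k - j) j (\<lambda>x. f x * V x y))) +
      (\<Sum>j\<le>k. of_nat (k choose j) * (f y * indicator B y * mixed A B (k - j) j (\<lambda>x. f x * V x y)))"
      using y by (auto simp: sum_distrib_left mult_ac)
  qed
  also have "\<dots> = (\<Sum>j\<le>k. of_nat (k choose j) * mixed A B (Suc (k - j)) j f) +
      (\<Sum>j\<le>k. of_nat (k choose j) * mixed A B (k - j) (Suc j) f)"
    by (simp add: nn_integral_add nn_integral_sum nn_integral_cmult mixed_absorb one mixed_Suc Suc.prems)
  also have "\<dots> = (\<Sum>j\<le>Suc k. of_nat (Suc k choose j) * mixed A B (Suc k - j) j f)"
    by (rule sum_binomial_Suc)
  finally show ?case .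
qed

lemma mixed_const_between:
  assumes [measurable]: "f \<in> borel_measurable M" "A \<in> sets M" "B \<in> sets M"
    and f: "\<And>x. x \<in> A \<Longrightarrow> f x = c"
    and V: "\<And>x y. x \<in> B \<Longrightarrow> y \<in> A \<Longrightarrow> V x y = \<rho>"
  shows "mixed A B m j f = (c * emeasure M A * \<rho> ^ j) ^ m * mixed A B 0 j f"
proof -
  let ?K = "\<lambda>x. (\<Prod>i\<in>{1..j}. f (x i) * indicator B (x i)) *
        (\<Prod>e\<in>vertex_pairs j. V (x (Min e)) (x (Max e)))"
  note [measurable] = measurable_vertex_pair[where k="j" and M=M]
  have eq: "?K x * (\<integral>\<^sup>+z. f z * indicator A z * (\<Prod>i\<in>{1..j}. V (x i) z) \<partial>M) ^ m =
      ?K x * (c * emeasure M A * \<rho> ^ j) ^ m" for x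
  proof (cases "\<forall>i\<in>{1..j}. x i \<in> B")
    case True
    have "(\<integral>\<^sup>+z. f z * indicator A z * (\<Prod>i\<in>{1..j}. V (x i) z) \<partial>M) =
      (\<integral>\<^sup>+z. c * \<rho> ^ j * indicator A z \<partial>M)"
      using True by (intro nn_integral_cong) (auto simp: indicator_def f V)
    also have "\<dots> = c * \<rho> ^ j * emeasure M A"
      by (rule nn_integral_cmult_indicator) simp
    also have "\<dots> = c * emeasure M A * \<rho> ^ j"
      by (simp add: mult_ac)
    finally show ?thesis by simp
  next
    case False
    then obtain i where "i \<in> {1..j}" "x i \<notin> B" by auto
    then have zero: "(\<Prod>i\<in>{1..j}. f (x i) * indicator B (x i)) = 0"
      by (intro prod_zero) (auto intro!: bexI[of _ i])
    show ?thesis unfolding zero by simp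
  qed
  have "mixed A B m j f = (\<integral>\<^sup>+x. ?K x * (c * emeasure M A * \<rho> ^ j) ^ m \<partial>(\<Pi>\<^sub>M i\<in>{1..j}. M))"
    unfolding mixed_def using eq by simp
  also have "\<dots> = (\<integral>\<^sup>+x. ?K x \<partial>(\<Pi>\<^sub>M i\<in>{1..j}. M)) * (c * emeasure M A * \<rho> ^ j) ^ m"
    by (rule nn_integral_multc) measurable
  finally show ?thesis by (simp add: mixed_def mult_ac)
qed

lemma mixed_const_inside:
  assumes [measurable]: "B \<in> sets M"
    and V: "\<And>x y. x \<in> B \<Longrightarrow> y \<in> B \<Longrightarrow> V x y = r"
  shows "mixed A B 0 j (\<lambda>_. 1) = emeasure M B ^ j * r ^ (j choose 2)"
proof -
  interpret product_sigma_finite "\<lambda>_. M" ..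
  have "(\<Prod>i\<in>{1..j}. 1 * indicator B (x i)) * (\<Prod>e\<in>vertex_pairs j. V (x (Min e)) (x (Max e))) =
     (\<Prod>i\<in>{1..j}. indicator B (x i)) * r ^ (j choose 2)" for x
  proof (cases "\<forall>i\<in>{1..j}. x i \<in> B")
    case True
    then have "(\<Prod>e\<in>vertex_pairs j. V (x (Min e)) (x (Max e))) = (\<Prod>e\<in>vertex_pairs j. r)"
      by (intro prod.cong refl V) (auto dest: vertex_pairs_Min_Max)
    then show ?thesis by (simp add: card_vertex_pairs)
  next
    case False
    then obtain i where "i \<in> {1..j}" "x i \<notin> B" by auto
    then have zero: "(\<Prod>i\<in>{1..j}. indicator B (x i) :: ennreal) = 0"
      by (intro prod_zero) (auto intro!: bexI[of _ i])
    show ?thesis unfolding mult_1 zero by simp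
  qed
  then have "mixed A B 0 j (\<lambda>_. 1) =
     (\<integral>\<^sup>+x. (\<Prod>i\<in>{1..j}. indicator B (x i)) * r ^ (j choose 2) \<partial>(\<Pi>\<^sub>M i\<in>{1..j}. M))"
    by (simp add: mixed_def)
  also have "\<dots> = (\<integral>\<^sup>+x. (\<Prod>i\<in>{1..j}. indicator B (x i)) \<partial>(\<Pi>\<^sub>M i\<in>{1..j}. M)) * r ^ (j choose 2)"
    by (rule nn_integral_multc) measurable
  also have "(\<integral>\<^sup>+x. (\<Prod>i\<in>{1..j}. indicator B (x i)) \<partial>(\<Pi>\<^sub>M i\<in>{1..j}. M)) = (\<Prod>i\<in>{1..j}. emeasure M B)"
    by (subst product_nn_integral_prod) auto
  finally show ?thesis by simp
qed

section \<open>Clique integrals of kernels with values at most 1\<close>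

context
  assumes V_le_1: "\<And>x y. V x y \<le> 1"
begin

lemma mult_V_le: "f x * V x y \<le> f x"
  using mult_left_mono[OF V_le_1[of x y], of "f x"] by simp

lemma cliques_le_1:
  assumes "\<And>x. x \<in> space M \<Longrightarrow> f x \<le> 1"
  shows "cliques k f \<le> 1"
proof -
  interpret P: prob_space "\<Pi>\<^sub>M i\<in>{1..k}. M"
    by (intro prob_space_PiM prob_space_axioms)
  have "cliques k f \<le> (\<integral>\<^sup>+x. 1 \<partial>(\<Pi>\<^sub>M i\<in>{1..k}. M))"
    unfolding cliques_def
    by (intro nn_integral_mono ennreal_le_oneI prod_le_1 conjI V_le_1)
       (auto intro!: assms simp: space_PiM PiE_iff)
  then show ?thesis using P.emeasure_space_1 by simp
qed

text \<open>Dropping the factors V <= 1 between the first k and the last l points decouples the two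
  groups.\<close>

lemma cliques_submult:
  assumes "f \<in> borel_measurable M"
  shows "cliques (k + l) f \<le> cliques k f * cliques l f"
  using assms
proof (induction k arbitrary: f)
  case (Suc k)
  note [measurable] = Suc.prems cliques_step_measurable[OF Suc.prems]
  have "cliques (Suc k + l) f = (\<integral>\<^sup>+y. f y * cliques (k + l) (\<lambda>x. f x * V x y) \<partial>M)"
    by (simp add: cliques_Suc Suc.prems)
  also have "\<dots> \<le> (\<integral>\<^sup>+y. f y * cliques k (\<lambda>x. f x * V x y) * cliques l f \<partial>M)"
  proof (rule nn_integral_mono)
    fix y assume [simp]: "y \<in> space M"
    have "cliques (k + l) (\<lambda>x. f x * V x y) \<le> cliques k (\<lambda>x. f x * V x y) * cliques l (\<lambda>x. f x * V x y)"
      by (rule Suc.IH) measurable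
    also have "\<dots> \<le> cliques k (\<lambda>x. f x * V x y) * cliques l f"
      by (intro mult_left_mono cliques_mono mult_V_le) auto
    finally show "f y * cliques (k + l) (\<lambda>x. f x * V x y) \<le> f y * cliques k (\<lambda>x. f x * V x y) * cliques l f"
      by (simp add: mult.assoc mult_left_mono)
  qed
  also have "\<dots> = cliques (Suc k) f * cliques l f"
    by (subst nn_integral_multc) (auto simp: cliques_Suc Suc.prems)
  finally show ?case .
qed simp

lemma cliques_power:
  assumes "f \<in> borel_measurable M"
  shows "cliques (m * k) f \<le> cliques k f ^ m"
proof (induction m)
  case (Suc m)
  have "cliques (Suc m * k) f \<le> cliques k f * cliques (m * k) f"
    using cliques_submult[OF assms, of k "m * k"] by simp
  also have "\<dots> \<le> cliques k f * cliques k f ^ m"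
    by (intro mult_left_mono Suc.IH) simp
  finally show ?case by simp
qed simp

lemma cliques_Suc_le:
  assumes "f \<in> borel_measurable M" "\<And>x. x \<in> space M \<Longrightarrow> f x \<le> 1"
  shows "cliques (Suc k) f \<le> cliques k f"
proof -
  have "cliques (Suc k) f \<le> cliques k f * cliques 1 f"
    using cliques_submult[OF assms(1), of k 1] by simp
  also have "\<dots> \<le> cliques k f * 1"
    by (intro mult_left_mono cliques_le_1 assms) simp_all
  finally show ?thesis by simp
qed

text \<open>A union bound: either all points avoid \<open>E\<close>, or one of the k + 1 points lies
  in \<open>E\<close>, and by symmetry it may be taken as the pinned point y.\<close>

lemma cliques_remove:
  assumes f: "f \<in> borel_measurable M" and [measurable]: "E \<in> sets M"
  shows "cliques (Suc k) f \<le> cliques (Suc k) (\<lambda>x. f x * indicator (- E) x) +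
     of_nat (Suc k) * (\<integral>\<^sup>+y. f y * indicator E y * cliques k (\<lambda>x. f x * V x y) \<partial>M)"
  using f
proof (induction k arbitrary: f)
  note [measurable] = indicator_Compl_measurable[OF \<open>E \<in> sets M\<close>]
  have split: "h = h * indicator (-E) x + h * indicator E x" for h :: ennreal and x
    by (auto simp: indicator_def)
  {
    case 0
    note [measurable] = 0
    have "(\<integral>\<^sup>+y. f y \<partial>M) = (\<integral>\<^sup>+y. f y * indicator (-E) y + f y * indicator E y \<partial>M)"
      by (intro nn_integral_cong split)
    then show ?case by (simp add: cliques_1 nn_integral_add)
  next
    case (Suc k)
    note [measurable] = Suc.prems cliques_step_measurable[OF Suc.prems] cliques_step2_measurable[OF Suc.prems]
    let ?g = "\<lambda>x. f x * indicator (- E) x"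
    let ?I = "\<integral>\<^sup>+y. f y * indicator E y * cliques (Suc k) (\<lambda>x. f x * V x y) \<partial>M"
    have g [measurable]: "?g \<in> borel_measurable M" by measurable
    note [measurable] = cliques_step_measurable[OF g]
    let ?h = "\<lambda>y z. ?g y * (f z * V z y * indicator E z * cliques k (\<lambda>x. f x * V x y * V x z))"
    have "cliques (Suc (Suc k)) f =
       (\<integral>\<^sup>+y. ?g y * cliques (Suc k) (\<lambda>x. f x * V x y) + f y * indicator E y * cliques (Suc k) (\<lambda>x. f x * V x y) \<partial>M)"
      by (subst cliques_Suc[OF Suc.prems], intro nn_integral_cong, subst split) (simp add: mult_ac)
    also have "\<dots> = (\<integral>\<^sup>+y. ?g y * cliques (Suc k) (\<lambda>x. f x * V x y) \<partial>M) + ?I"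
      by (rule nn_integral_add) measurable
    finally have 1: "cliques (Suc (Suc k)) f = (\<integral>\<^sup>+y. ?g y * cliques (Suc k) (\<lambda>x. f x * V x y) \<partial>M) + ?I" .
    have "(\<integral>\<^sup>+y. ?g y * cliques (Suc k) (\<lambda>x. f x * V x y) \<partial>M) \<le>
       (\<integral>\<^sup>+y. ?g y * cliques (Suc k) (\<lambda>x. ?g x * V x y) + of_nat (Suc k) * (\<integral>\<^sup>+z. ?h y z \<partial>M) \<partial>M)"
    proof (rule nn_integral_mono)
      fix y assume [simp]: "y \<in> space M"
      have "cliques (Suc k) (\<lambda>x. f x * V x y) \<le> cliques (Suc k) (\<lambda>x. f x * V x y * indicator (- E) x) +
        of_nat (Suc k) * (\<integral>\<^sup>+z. f z * V z y * indicator E z * cliques k (\<lambda>x. f x * V x y * V x z) \<partial>M)"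
        by (rule Suc.IH) measurable
      also have "(\<lambda>x. f x * V x y * indicator (- E) x) = (\<lambda>x. ?g x * V x y)"
        by (auto simp: mult_ac)
      finally have "?g y * cliques (Suc k) (\<lambda>x. f x * V x y) \<le> ?g y * (cliques (Suc k) (\<lambda>x. ?g x * V x y) +
        of_nat (Suc k) * (\<integral>\<^sup>+z. f z * V z y * indicator E z * cliques k (\<lambda>x. f x * V x y * V x z) \<partial>M))"
        by (rule mult_left_mono) simp
      also have "\<dots> = ?g y * cliques (Suc k) (\<lambda>x. ?g x * V x y) +
        of_nat (Suc k) * (?g y * (\<integral>\<^sup>+z. f z * V z y * indicator E z * cliques k (\<lambda>x. f x * V x y * V x z) \<partial>M))"
        by (simp only: distrib_left mult_ac)
      also have "?g y * (\<integral>\<^sup>+z. f z * V z y * indicator E z * cliques k (\<lambda>x. f x * V x y * V x z) \<partial>M) =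
          (\<integral>\<^sup>+z. ?h y z \<partial>M)"
        by (rule nn_integral_cmult[symmetric]) measurable
      finally show "?g y * cliques (Suc k) (\<lambda>x. f x * V x y) \<le> ?g y * cliques (Suc k) (\<lambda>x. ?g x * V x y) +
         of_nat (Suc k) * (\<integral>\<^sup>+z. ?h y z \<partial>M)" .
    qed
    also have "\<dots> = cliques (Suc (Suc k)) ?g + of_nat (Suc k) * (\<integral>\<^sup>+y. \<integral>\<^sup>+z. ?h y z \<partial>M \<partial>M)"
    proof -
      have "(\<lambda>y. \<integral>\<^sup>+z. ?h y z \<partial>M) \<in> borel_measurable M" by measurable
      then show ?thesis
        by (simp only: cliques_Suc[OF g]) (subst nn_integral_add, measurable, simp add: nn_integral_cmult)
    qed
    finally have 2: "(\<integral>\<^sup>+y. ?g y * cliques (Suc k) (\<lambda>x. f x * V x y) \<partial>M) \<le>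
       cliques (Suc (Suc k)) ?g + of_nat (Suc k) * (\<integral>\<^sup>+y. \<integral>\<^sup>+z. ?h y z \<partial>M \<partial>M)" .
    \<comment> \<open>With the order exchanged, z in \<open>E\<close> is fixed first and y becomes
      an ordinary vertex of the clique at z; letting y range over \<open>E\<close> as well only
      enlarges the integral.\<close>
    have "(\<integral>\<^sup>+y. \<integral>\<^sup>+z. ?h y z \<partial>M \<partial>M) = (\<integral>\<^sup>+z. \<integral>\<^sup>+y. ?h y z \<partial>M \<partial>M)"
      by (rule pair.Fubini'[symmetric]) measurable
    also have "\<dots> \<le> ?I"
    proof (rule nn_integral_mono)
      fix z assume [simp]: "z \<in> space M"
      have "(\<integral>\<^sup>+y. ?h y z \<partial>M) \<le> (\<integral>\<^sup>+y. (f z * indicator E z) * (f y * V y z * cliques k (\<lambda>x. f x * V x z * V x y)) \<partial>M)"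
        by (intro nn_integral_mono) (auto simp: indicator_def mult_ac V_sym)
      also have "\<dots> = (f z * indicator E z) * cliques (Suc k) (\<lambda>x. f x * V x z)"
        by (subst nn_integral_cmult) (auto simp: cliques_Suc)
      finally show "(\<integral>\<^sup>+y. ?h y z \<partial>M) \<le> f z * indicator E z * cliques (Suc k) (\<lambda>x. f x * V x z)" .
    qed
    finally have 3: "(\<integral>\<^sup>+y. \<integral>\<^sup>+z. ?h y z \<partial>M \<partial>M) \<le> ?I" .
    have "cliques (Suc (Suc k)) f \<le> (cliques (Suc (Suc k)) ?g + of_nat (Suc k) * ?I) + ?I"
      unfolding 1 by (intro add_right_mono order_trans[OF 2] add_left_mono mult_left_mono 3) simp
    then show ?case by (simp add: distrib_right add_ac)
  }
qed

lemma cliques_tendsto: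
  assumes [measurable]: "\<And>n. F n \<in> borel_measurable M" "f \<in> borel_measurable M"
    and le: "\<And>n x. x \<in> space M \<Longrightarrow> F n x \<le> 1" "\<And>x. x \<in> space M \<Longrightarrow> f x \<le> 1"
    and lim: "\<And>x. x \<in> space M \<Longrightarrow> (\<lambda>n. F n x) \<longlonglongrightarrow> f x"
  shows "(\<lambda>n. cliques k (F n)) \<longlonglongrightarrow> cliques k f"
proof -
  interpret P: prob_space "\<Pi>\<^sub>M i\<in>{1..k}. M"
    by (intro prob_space_PiM prob_space_axioms)
  note [measurable] = measurable_vertex_pair[where k="k" and M=M]
  have V1: "(\<Prod>e\<in>vertex_pairs k. V (x (Min e)) (x (Max e))) \<le> 1" for x
    by (intro prod_le_1) (auto simp: V_le_1)
  show ?thesis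
    unfolding cliques_def
  proof (rule nn_integral_dominated_convergence[where w="\<lambda>_. 1"])
    show "(\<integral>\<^sup>+ x. 1 \<partial>(\<Pi>\<^sub>M i\<in>{1..k}. M)) < \<infinity>"
      using P.emeasure_space_1 by simp
    show "AE x in (\<Pi>\<^sub>M i\<in>{1..k}. M). (\<Prod>i\<in>{1..k}. F j (x i)) * (\<Prod>e\<in>vertex_pairs k. V (x (Min e)) (x (Max e))) \<le> 1" for j
      by (intro AE_I2 ennreal_le_oneI V1 prod_le_1) (auto simp: space_PiM PiE_iff le)
    show "AE x in (\<Pi>\<^sub>M i\<in>{1..k}. M). (\<lambda>i. (\<Prod>ia\<in>{1..k}. F i (x ia)) * (\<Prod>e\<in>vertex_pairs k. V (x (Min e)) (x (Max e))))
       \<longlonglongrightarrow> (\<Prod>i\<in>{1..k}. f (x i)) * (\<Prod>e\<in>vertex_pairs k. V (x (Min e)) (x (Max e)))"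
    proof (rule AE_I2)
      fix x assume x: "x \<in> space (\<Pi>\<^sub>M i\<in>{1..k}. M)"
      have f1: "f (x i) \<noteq> \<top>" if "i \<in> {1..k}" for i
        using le(2)[of "x i"] x that by (auto simp: space_PiM PiE_iff top_unique)
      then have "(\<Prod>i\<in>{1..k}. f (x i)) \<noteq> \<top>"
        by (auto simp: ennreal_prod_eq_top)
      moreover have "(\<Prod>e\<in>vertex_pairs k. V (x (Min e)) (x (Max e))) \<noteq> \<top>"
        using V1[of x] by (auto simp: top_unique)
      ultimately show "(\<lambda>i. (\<Prod>ia\<in>{1..k}. F i (x ia)) * (\<Prod>e\<in>vertex_pairs k. V (x (Min e)) (x (Max e))))
       \<longlonglongrightarrow> (\<Prod>i\<in>{1..k}. f (x i)) * (\<Prod>e\<in>vertex_pairs k. V (x (Min e)) (x (Max e)))"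
        using x f1 by (intro tendsto_mult_ennreal tendsto_prod_ennreal lim tendsto_const) (auto simp: space_PiM PiE_iff)
    qed
  qed measurable
qed

subsection \<open>Independent sets of positive measure\<close>

text \<open>If \<open>f\<close> is minimal among the weights with \<open>cliques k f \<ge> \<alpha>\<^sup>k\<close> for all \<open>k\<close>, then
  \<open>f \<cdot> V(-, y) = f\<close> for almost every \<open>y\<close> in the support of \<open>f\<close>, hence \<open>V = 1\<close> on the square of the
  support.  Otherwise some set \<open>E\<close> of positive measure meets only exponentially few cliques, and removing
  \<open>E\<close> contradicts minimality.\<close>

definition clique_rich :: "real \<Rightarrow> ('a \<Rightarrow> ennreal) \<Rightarrow> bool" where
  "clique_rich \<alpha> f \<longleftrightarrow> f \<in> borel_measurable M \<and> (\<forall>x. f x \<le> 1) \<and> (\<forall>k. ennreal (\<alpha> ^ k) \<le> cliques k f)"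

lemma nn_integral_le_one: "(\<And>x. f x \<le> 1) \<Longrightarrow> (\<integral>\<^sup>+x. f x \<partial>M) \<le> 1"
  using nn_integral_mono[of M f "\<lambda>_. 1"] emeasure_space_1 by simp

text \<open>The sequence \<open>F\<close> decreases, and each member comes within 1 / Suc n of the
  least integral available below its predecessor. Its pointwise limit is again rich by dominated
  convergence, and a rich weight below the limit competes at every stage, so its integral cannot be
  smaller.\<close>

lemma exists_minimal_clique_rich:
  assumes "clique_rich \<alpha> f0"
  obtains f where "clique_rich \<alpha> f"
    "\<And>g. clique_rich \<alpha> g \<Longrightarrow> (\<And>x. g x \<le> f x) \<Longrightarrow> (\<integral>\<^sup>+x. f x \<partial>M) \<le> (\<integral>\<^sup>+x. g x \<partial>M)"
proof -
  define I where "I f = enn2real (\<integral>\<^sup>+x. f x \<partial>M)" for f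
  define below where "below f = {g. clique_rich \<alpha> g \<and> (\<forall>x. g x \<le> f x)}" for f
  define J where "J f = Inf (I ` below f)" for f
  have bdd: "bdd_below (I ` below f)" for f
    by (auto simp: I_def intro!: bdd_belowI[of _ 0])
  have "\<exists>F. \<forall>n. clique_rich \<alpha> (F n) \<and> (F (Suc n) \<in> below (F n) \<and> I (F (Suc n)) < J (F n) + 1 / Suc n)"
  proof (rule dependent_nat_choice)
    show "\<exists>f. clique_rich \<alpha> f" using assms by auto
    fix f n assume f: "clique_rich \<alpha> f"
    then have ne: "I ` below f \<noteq> {}" by (auto simp: below_def)
    have "Inf (I ` below f) < J f + 1 / Suc n" by (simp add: J_def)
    then obtain g where "g \<in> below f" "I g < J f + 1 / Suc n"
      using cInf_lessD[OF ne] by blast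
    then show "\<exists>g. clique_rich \<alpha> g \<and> (g \<in> below f \<and> I g < J f + 1 / Suc n)"
      by (auto simp: below_def)
  qed
  then obtain F where F: "\<And>n. clique_rich \<alpha> (F n)" "\<And>n x. F (Suc n) x \<le> F n x"
    "\<And>n. I (F (Suc n)) < J (F n) + 1 / Suc n"
    by (auto simp: below_def)
  have dec: "decseq (\<lambda>n. F n x)" for x using F(2) by (auto intro: decseq_SucI)
  have meas [measurable]: "F n \<in> borel_measurable M" and le1: "F n x \<le> 1" for n x
    using F(1)[of n] by (auto simp: clique_rich_def)
  define f where "f x = (INF n. F n x)" for x
  have f_le: "f x \<le> F n x" for n x unfolding f_def by (rule INF_lower) simp
  have f_meas [measurable]: "f \<in> borel_measurable M" unfolding f_def by measurable
  have lim: "(\<lambda>n. F n x) \<longlonglongrightarrow> f x" for x unfolding f_def by (rule LIMSEQ_INF[OF dec])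
  have f1: "f x \<le> 1" for x using f_le[of x 0] le1[of 0 x] by (rule order_trans)
  have "ennreal (\<alpha> ^ k) \<le> cliques k f" for k
  proof (rule LIMSEQ_le_const)
    show "(\<lambda>n. cliques k (F n)) \<longlonglongrightarrow> cliques k f"
      by (rule cliques_tendsto) (auto intro: le1 f1 lim)
    show "\<exists>N. \<forall>n\<ge>N. ennreal (\<alpha> ^ k) \<le> cliques k (F n)"
      using F(1) by (auto simp: clique_rich_def)
  qed
  then have f: "clique_rich \<alpha> f" using f1 by (auto simp: clique_rich_def)
  show thesis
  proof (rule that[OF f])
    fix g assume g: "clique_rich \<alpha> g" and gf: "\<And>x. g x \<le> f x"
    have fin: "(\<integral>\<^sup>+x. h x \<partial>M) < \<top>" if "\<And>x. h x \<le> 1" for h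
      using nn_integral_le_one[of h] that by (simp add: order_le_less_trans)
    have "I f \<le> I g + 1 / Suc n" for n
    proof -
      have "I f \<le> I (F (Suc n))"
        unfolding I_def by (intro enn2real_mono nn_integral_mono f_le fin le1)
      also have "\<dots> \<le> J (F n) + 1 / Suc n" using F(3)[of n] by simp
      also have "J (F n) \<le> I g"
        unfolding J_def using g order_trans[OF gf f_le] by (intro cInf_lower bdd) (auto simp: below_def)
      finally show ?thesis by simp
    qed
    moreover have "(\<lambda>n. I g + 1 / Suc n) \<longlonglongrightarrow> I g + 0"
      by (intro tendsto_add tendsto_const LIMSEQ_Suc[OF lim_1_over_n])
    ultimately have "I f \<le> I g" by (intro LIMSEQ_le_const[of _ "I g"]) auto
    then show "(\<integral>\<^sup>+x. f x \<partial>M) \<le> (\<integral>\<^sup>+x. g x \<partial>M)"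
      using fin[of f] fin[of g] f1 g unfolding I_def clique_rich_def
      by (metis enn2real_nonneg ennreal_enn2real ennreal_leI)
  qed
qed

text \<open>Take N = m l k, a common multiple of k and l. By submultiplicativity the cliques on N +
  1 points that avoid \<open>E\<close> weigh at most c^(m k) \<alpha>^N, and the cliques on N points
  pinned at a point of \<open>E\<close> at most c^(m l) \<alpha>^N. The union bound and richness
  give \<alpha>^(N+1) <= (c^(m k) + (N + 1) c^(m l)) \<alpha>^N; dividing by \<alpha>^N and letting
  m grow yields \<alpha> <= 0.\<close>

lemma pinned_decay_contradiction:
  fixes c \<alpha> :: real
  assumes "0 < c" "c < 1" "0 < \<alpha>" "0 < k" "0 < l"
    and [measurable]: "f \<in> borel_measurable M" "E \<in> sets M" and f1: "\<And>x. f x \<le> 1"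
    and rich: "\<And>n. ennreal (\<alpha> ^ n) \<le> cliques n f"
    and E: "\<And>y. y \<in> E \<Longrightarrow> cliques k (\<lambda>x. f x * V x y) \<le> ennreal (c * \<alpha> ^ k)"
    and l: "cliques l (\<lambda>x. f x * indicator (- E) x) \<le> ennreal (c * \<alpha> ^ l)"
  shows False
proof -
  let ?g = "\<lambda>x. f x * indicator (- E) x"
  note [measurable] = indicator_Compl_measurable[OF \<open>E \<in> sets M\<close>]
  have g: "?g \<in> borel_measurable M" by measurable
  have g1: "?g x \<le> 1" for x using f1[of x] by (auto simp: indicator_def)
  have main: "\<alpha> \<le> c ^ m + (m * l * k + 1) * c ^ m" for m :: nat
  proof -
    let ?N = "m * l * k"
    have N1: "?N = (m * k) * l" by simp
    have 1: "cliques (Suc ?N) ?g \<le> ennreal ((c * \<alpha> ^ l) ^ (m * k))"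
    proof -
      have "cliques (Suc ?N) ?g \<le> cliques ?N ?g"
        by (rule cliques_Suc_le[OF g g1])
      also have "\<dots> \<le> cliques l ?g ^ (m * k)"
        unfolding N1 by (rule cliques_power[OF g])
      also have "\<dots> \<le> ennreal (c * \<alpha> ^ l) ^ (m * k)"
        by (intro power_mono l) simp
      finally show ?thesis using assms by (simp add: ennreal_power)
    qed
    have "(\<integral>\<^sup>+y. f y * indicator E y * cliques ?N (\<lambda>x. f x * V x y) \<partial>M) \<le>
      (\<integral>\<^sup>+y. ennreal ((c * \<alpha> ^ k) ^ (m * l)) \<partial>M)"
    proof (rule nn_integral_mono)
      fix y assume [simp]: "y \<in> space M"
      show "f y * indicator E y * cliques ?N (\<lambda>x. f x * V x y) \<le> ennreal ((c * \<alpha> ^ k) ^ (m * l))"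
      proof (cases "y \<in> E")
        case True
        have "cliques ?N (\<lambda>x. f x * V x y) \<le> cliques k (\<lambda>x. f x * V x y) ^ (m * l)"
          by (rule cliques_power) measurable
        also have "\<dots> \<le> ennreal (c * \<alpha> ^ k) ^ (m * l)"
          by (intro power_mono E True) simp
        finally have "1 * cliques ?N (\<lambda>x. f x * V x y) \<le> ennreal ((c * \<alpha> ^ k) ^ (m * l))"
          using assms by (simp add: ennreal_power)
        then show ?thesis
          using mult_right_mono[OF f1[of y], of "cliques ?N (\<lambda>x. f x * V x y)"] True by simp
      qed simp
    qed
    also have "\<dots> = ennreal ((c * \<alpha> ^ k) ^ (m * l))"
      using emeasure_space_1 by simp
    finally have 2: "(\<integral>\<^sup>+y. f y * indicator E y * cliques ?N (\<lambda>x. f x * V x y) \<partial>M) \<le> \<dots>" .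
    have "ennreal (\<alpha> ^ Suc ?N) \<le> ennreal ((c * \<alpha> ^ l) ^ (m * k)) + of_nat (Suc ?N) * ennreal ((c * \<alpha> ^ k) ^ (m * l))"
      by (rule order_trans[OF order_trans[OF rich cliques_remove[of f E]]])
         (auto intro!: add_mono mult_left_mono 1 2)
    also have "\<dots> = ennreal ((c * \<alpha> ^ l) ^ (m * k) + real (Suc ?N) * ((c * \<alpha> ^ k) ^ (m * l)))"
      using assms by (simp add: ennreal_plus ennreal_mult flip: ennreal_of_nat_eq_real_of_nat)
    finally have "\<alpha> ^ Suc ?N \<le> (c * \<alpha> ^ l) ^ (m * k) + real (Suc ?N) * ((c * \<alpha> ^ k) ^ (m * l))"
      using assms by (subst (asm) ennreal_le_iff) auto
    also have "\<dots> = (c ^ (m * k) + real (Suc ?N) * c ^ (m * l)) * \<alpha> ^ ?N"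
      by (simp add: power_mult_distrib algebra_simps flip: power_mult)
    finally have "\<alpha> \<le> c ^ (m * k) + real (Suc ?N) * c ^ (m * l)"
      using assms by simp
    also have "\<dots> \<le> c ^ m + real (Suc ?N) * c ^ m"
      using assms by (intro add_mono mult_left_mono power_decreasing) auto
    finally show ?thesis by simp
  qed
  have "(\<lambda>m. c ^ m + (real (l * k) * (real m * c ^ m) + c ^ m)) \<longlonglongrightarrow> 0 + (real (l * k) * 0 + 0)"
    using assms by (intro tendsto_add tendsto_mult tendsto_const powser_times_n_limit_0 LIMSEQ_power_zero) auto
  then have "\<alpha> \<le> 0 + (real (l * k) * 0 + 0)"
    using main by (intro LIMSEQ_le_const) (auto simp: algebra_simps)
  then show False using assms by simp
qed

lemma AE_clique_rich_neighbourhood: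
  assumes "0 < \<alpha>" and rich: "clique_rich \<alpha> f"
    and min: "\<And>g. clique_rich \<alpha> g \<Longrightarrow> (\<And>x. g x \<le> f x) \<Longrightarrow> (\<integral>\<^sup>+x. f x \<partial>M) \<le> (\<integral>\<^sup>+x. g x \<partial>M)"
  shows "AE y in M. f y \<noteq> 0 \<longrightarrow> clique_rich \<alpha> (\<lambda>x. f x * V x y)"
proof -
  have f [measurable]: "f \<in> borel_measurable M" and f1: "\<And>x. f x \<le> 1"
    and r: "\<And>k. ennreal (\<alpha> ^ k) \<le> cliques k f"
    using rich by (auto simp: clique_rich_def)
  note [measurable] = cliques_step_measurable[OF f]
  \<comment> \<open>A strict deficit at y is witnessed by some k and n, so countably many null sets
    suffice. The shift by 2 keeps the factor positive at n = 0.\<close>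
  have null: "AE y in M. \<not> (f y \<noteq> 0 \<and> cliques k (\<lambda>x. f x * V x y) \<le> ennreal ((1 - 1 / (real n + 2)) * \<alpha> ^ k))" for k n
  proof (rule ccontr)
    assume nn: "\<not> ?thesis"
    let ?c = "1 - 1 / (real n + 2)"
    define E where "E = {y\<in>space M. f y \<noteq> 0 \<and> cliques k (\<lambda>x. f x * V x y) \<le> ennreal (?c * \<alpha> ^ k)}"
    let ?g = "\<lambda>x. f x * indicator (- E) x"
    have [measurable]: "E \<in> sets M" unfolding E_def by measurable
    note [measurable] = indicator_Compl_measurable[OF \<open>E \<in> sets M\<close>]
    have g [measurable]: "?g \<in> borel_measurable M" by measurable
    have gf: "?g x \<le> f x" for x by (auto simp: indicator_def)
    have "\<not> clique_rich \<alpha> ?g"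
    proof
      assume "clique_rich \<alpha> ?g"
      then have "(\<integral>\<^sup>+x. f x \<partial>M) \<le> (\<integral>\<^sup>+x. ?g x \<partial>M)" by (rule min) (rule gf)
      moreover have "(\<integral>\<^sup>+x. f x \<partial>M) \<noteq> \<top>"
        using nn_integral_le_one[of f, OF f1] by (auto simp: top_unique)
      ultimately have "AE x in M. f x = ?g x"
        using gf by (intro AE_eq_of_nn_integral_eq) auto
      then have "AE y in M. \<not> (f y \<noteq> 0 \<and> cliques k (\<lambda>x. f x * V x y) \<le> ennreal (?c * \<alpha> ^ k))"
        by (rule AE_mp) (auto intro!: AE_I2 simp: E_def indicator_def split: if_splits)
      then show False using nn by simp
    qed
    then obtain l where "\<not> ennreal (\<alpha> ^ l) \<le> cliques l ?g"
      using g order_trans[OF gf f1] unfolding clique_rich_def by blast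
    then have l: "cliques l ?g < ennreal (\<alpha> ^ l)" by simp
    have "0 < l" using l by (cases l) auto
    \<comment> \<open>For k = 0 the clique integral is 1, above the threshold, which would leave
      \<open>E\<close> empty.\<close>
    have "0 < k"
    proof (rule ccontr)
      assume "\<not> 0 < k"
      then have "E = {}" by (auto simp: E_def divide_simps)
      then show False using nn unfolding E_def[symmetric] by (auto simp: E_def)
    qed
    obtain c' where c': "0 < c'" "c' < 1" "cliques l ?g \<le> ennreal (c' * \<alpha> ^ l)"
    proof -
      define t where "t = enn2real (cliques l ?g)"
      have "cliques l ?g < \<top>" using l by (rule order.strict_trans) simp
      then have t: "cliques l ?g = ennreal t" "t \<ge> 0" by (auto simp: t_def)
      then have "t < \<alpha> ^ l" using l by (simp add: ennreal_less_iff)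
      then obtain u where "t < u" "u < \<alpha> ^ l" using dense by blast
      then show thesis
        using that[of "u / \<alpha> ^ l"] t \<open>0 < \<alpha>\<close> by (auto simp: ennreal_leI)
    qed
    define c where "c = max ?c c'"
    have "0 < ?c" "?c < 1" by (auto simp: divide_simps)
    then have c: "0 < c" "c < 1" "?c \<le> c" "c' \<le> c" using c' by (auto simp: c_def)
    show False
    proof (rule pinned_decay_contradiction[OF c(1,2) \<open>0 < \<alpha>\<close> \<open>0 < k\<close> \<open>0 < l\<close> f _ f1 r])
      fix y assume "y \<in> E"
      then have "cliques k (\<lambda>x. f x * V x y) \<le> ennreal (?c * \<alpha> ^ k)" by (simp add: E_def)
      also have "\<dots> \<le> ennreal (c * \<alpha> ^ k)"
        using c \<open>0 < \<alpha>\<close> by (intro ennreal_leI mult_right_mono) auto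
      finally show "cliques k (\<lambda>x. f x * V x y) \<le> ennreal (c * \<alpha> ^ k)" .
    next
      have "ennreal (c' * \<alpha> ^ l) \<le> ennreal (c * \<alpha> ^ l)"
        using c \<open>0 < \<alpha>\<close> by (intro ennreal_leI mult_right_mono) auto
      then show "cliques l ?g \<le> ennreal (c * \<alpha> ^ l)" using c'(3) by (rule order_trans[rotated])
    qed measurable
  qed
  have "AE y in M. \<forall>k n. \<not> (f y \<noteq> 0 \<and> cliques k (\<lambda>x. f x * V x y) \<le> ennreal ((1 - 1 / (real n + 2)) * \<alpha> ^ k))"
    unfolding AE_all_countable using null by blast
  then show ?thesis
  proof (rule AE_mp, intro AE_I2 impI)
    fix y assume y: "y \<in> space M" "f y \<noteq> 0" and
      *: "\<forall>k n. \<not> (f y \<noteq> 0 \<and> cliques k (\<lambda>x. f x * V x y) \<le> ennreal ((1 - 1 / (real n + 2)) * \<alpha> ^ k))"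
    have "ennreal (\<alpha> ^ k) \<le> cliques k (\<lambda>x. f x * V x y)" for k
    proof (rule LIMSEQ_le_const2)
      have "(\<lambda>n. 1 / (real n + 2)) \<longlonglongrightarrow> 0" by real_asymp
      then have "(\<lambda>n. (1 - 1 / (real n + 2)) * \<alpha> ^ k) \<longlonglongrightarrow> (1 - 0) * \<alpha> ^ k"
        by (intro tendsto_intros)
      then show "(\<lambda>n. ennreal ((1 - 1 / (real n + 2)) * \<alpha> ^ k)) \<longlonglongrightarrow> ennreal (\<alpha> ^ k)"
        by (intro tendsto_ennrealI) simp
      show "\<exists>N. \<forall>n\<ge>N. ennreal ((1 - 1 / (real n + 2)) * \<alpha> ^ k) \<le> cliques k (\<lambda>x. f x * V x y)"
        using * y by (auto simp: not_le intro: less_imp_le)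
    qed
    moreover have "f x * V x y \<le> 1" for x by (rule ennreal_le_oneI[OF f1 V_le_1])
    ultimately show "clique_rich \<alpha> (\<lambda>x. f x * V x y)"
      using y by (auto simp: clique_rich_def)
  qed
qed

lemma independent_set_exists:
  assumes "0 < \<alpha>" and rich: "\<And>k. ennreal (\<alpha> ^ k) \<le> cliques k (\<lambda>_. 1)"
  obtains A where "A \<in> sets M" "ennreal \<alpha> \<le> emeasure M A"
    "AE x in M. AE y in M. x \<in> A \<longrightarrow> y \<in> A \<longrightarrow> V x y = 1"
proof -
  have "clique_rich \<alpha> (\<lambda>_. 1)" using rich by (auto simp: clique_rich_def)
  then obtain f where f: "clique_rich \<alpha> f" and
    min: "\<And>g. clique_rich \<alpha> g \<Longrightarrow> (\<And>x. g x \<le> f x) \<Longrightarrow> (\<integral>\<^sup>+x. f x \<partial>M) \<le> (\<integral>\<^sup>+x. g x \<partial>M)"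
    by (rule exists_minimal_clique_rich) blast
  have [measurable]: "f \<in> borel_measurable M" and f1: "\<And>x. f x \<le> 1"
    using f by (auto simp: clique_rich_def)
  define A where "A = {x\<in>space M. f x \<noteq> 0}"
  have [measurable]: "A \<in> sets M" unfolding A_def by measurable
  have nb: "AE y in M. f y \<noteq> 0 \<longrightarrow> clique_rich \<alpha> (\<lambda>x. f x * V x y)"
    by (rule AE_clique_rich_neighbourhood[OF \<open>0 < \<alpha>\<close> f]) (rule min)
  \<comment> \<open>Richness for k = 1 bounds the integral of f from below, and f <= 1 passes the
    bound on to the measure of the support.\<close>
  have "ennreal \<alpha> \<le> cliques (Suc 0) f" using f by (auto simp: clique_rich_def dest: spec[of _ 1])
  also have "\<dots> = (\<integral>\<^sup>+x. f x \<partial>M)" by (rule cliques_1) measurable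
  also have "\<dots> \<le> (\<integral>\<^sup>+x. indicator A x \<partial>M)"
    by (intro nn_integral_mono) (auto simp: A_def indicator_def f1)
  finally have "ennreal \<alpha> \<le> emeasure M A" by simp
  moreover have "AE y in M. AE x in M. y \<in> A \<longrightarrow> x \<in> A \<longrightarrow> V y x = 1"
  proof (rule AE_mp[OF nb], rule AE_I2, rule impI)
    fix y assume y: "y \<in> space M" and rich_y: "f y \<noteq> 0 \<longrightarrow> clique_rich \<alpha> (\<lambda>x. f x * V x y)"
    show "AE x in M. y \<in> A \<longrightarrow> x \<in> A \<longrightarrow> V y x = 1"
    proof (cases "y \<in> A")
      case True
      then have "clique_rich \<alpha> (\<lambda>x. f x * V x y)" using rich_y by (auto simp: A_def)
      then have "(\<integral>\<^sup>+x. f x \<partial>M) \<le> (\<integral>\<^sup>+x. f x * V x y \<partial>M)" by (rule min) (rule mult_V_le)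
      moreover have "(\<integral>\<^sup>+x. f x \<partial>M) \<noteq> \<top>"
        using nn_integral_le_one[of f, OF f1] by (auto simp: top_unique)
      ultimately have "AE x in M. f x = f x * V x y"
        using mult_V_le y by (intro AE_eq_of_nn_integral_eq) auto
      then show ?thesis
      proof (rule AE_mp, intro AE_I2 impI)
        fix x assume "f x = f x * V x y" "x \<in> A"
        moreover have "f x \<noteq> \<top>" using f1[of x] by (auto simp: top_unique)
        ultimately have "f x * 1 = f x * V x y" "f x \<noteq> 0" "f x \<noteq> \<top>" by (auto simp: A_def)
        then show "V y x = 1" by (subst (asm) ennreal_mult_cancel_left) (auto simp: V_sym)
      qed
    qed simp
  qed
  ultimately show thesis by (intro that[of A]) auto
qed

end
end

section \<open>Kernels with zero row integrals\<close>

text \<open>Abstract coefficients keep the linearity of the integral apart from the 64 products into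
  which six linear factors expand.\<close>

lemma (in prob_space) integral_sextic:
  fixes t :: real
  assumes "integrable M e1" "integrable M e2" "integrable M e3"
    "integrable M e4" "integrable M e5" "integrable M e6"
  shows "(\<integral>x. 1 + (t * e1 x + t ^ 2 * e2 x + t ^ 3 * e3 x + t ^ 4 * e4 x + t ^ 5 * e5 x + t ^ 6 * e6 x) \<partial>M) =
    1 + (t * (\<integral>x. e1 x \<partial>M) + t ^ 2 * (\<integral>x. e2 x \<partial>M) + t ^ 3 * (\<integral>x. e3 x \<partial>M) + t ^ 4 * (\<integral>x. e4 x \<partial>M) +
     t ^ 5 * (\<integral>x. e5 x \<partial>M) + t ^ 6 * (\<integral>x. e6 x \<partial>M))"
  using assms by (simp add: prob_space)

locale bounded_kernel = prob_space M for M :: "'a measure" +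
  fixes K :: "'a \<Rightarrow> 'a \<Rightarrow> real"
  assumes K_measurable: "case_prod K \<in> borel_measurable (M \<Otimes>\<^sub>M M)"
    and K_sym: "K x y = K y x"
    and K_bound: "\<bar>K x y\<bar> \<le> 1"
begin

lemmas K_measurable_uncurried [measurable (raw)] = measurable_uncurried[OF K_measurable]

sublocale prod: product_sigma_finite "\<lambda>_::nat. M" ..
sublocale pair: pair_sigma_finite M M ..

lemma prob_space_power: "prob_space (\<Pi>\<^sub>M i\<in>I. M)"
  by (intro prob_space_PiM prob_space_axioms)

lemma integrable_power:
  assumes "F \<in> borel_measurable (\<Pi>\<^sub>M i\<in>I. M)" "\<And>x. \<bar>F x\<bar> \<le> B"
  shows "integrable (\<Pi>\<^sub>M i\<in>I. M) (F :: _ \<Rightarrow> real)"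
proof -
  interpret P: prob_space "\<Pi>\<^sub>M i\<in>I. M" by (rule prob_space_power)
  show ?thesis by (rule P.integrable_const_bound[where B=B]) (use assms in auto)
qed

text \<open>The vertex v is a leaf attached to u and does not occur in \<open>G\<close>, so
  integrating over it first produces the row integral at \<open>x u\<close>, which is almost surely
  0.\<close>

lemma integral_pendant:
  fixes u v :: nat
  assumes rows: "AE x in M. (\<integral>y. K x y \<partial>M) = 0"
    and I: "finite I" "v \<in> I" "u \<in> I" "u \<noteq> v"
    and G: "\<And>x y. G (x(v := y)) = G x" "G \<in> borel_measurable (\<Pi>\<^sub>M i\<in>I. M)" "\<And>x. \<bar>G x\<bar> \<le> 1"
  shows "(\<integral>x. G x * K (x u) (x v) \<partial>(\<Pi>\<^sub>M i\<in>I. M)) = 0"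
proof -
  note [measurable] = G(2)
  define J where "J = I - {v}"
  have J: "I = insert v J" "v \<notin> J" "finite J" "u \<in> J" using I by (auto simp: J_def)
  interpret P: prob_space "\<Pi>\<^sub>M i\<in>J. M" by (rule prob_space_power)
  have int: "integrable (\<Pi>\<^sub>M i\<in>I. M) (\<lambda>x. G x * K (x u) (x v))"
    using I by (intro integrable_power[where B=1] abs_mult_le_one G K_bound) measurable
  have rows': "AE x in (\<Pi>\<^sub>M i\<in>J. M). (\<integral>y. K (x u) y \<partial>M) = 0"
    by (rule AE_PiM_component[OF prob_space_axioms \<open>u \<in> J\<close> rows])
  have "(\<integral>x. G x * K (x u) (x v) \<partial>(\<Pi>\<^sub>M i\<in>I. M)) =
     (\<integral>x. \<integral>y. G (x(v := y)) * K ((x(v := y)) u) ((x(v := y)) v) \<partial>M \<partial>(\<Pi>\<^sub>M i\<in>J. M))"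
    using int J unfolding J(1) by (intro prod.product_integral_insert) auto
  also have "\<dots> = (\<integral>x. G x * (\<integral>y. K (x u) y \<partial>M) \<partial>(\<Pi>\<^sub>M i\<in>J. M))"
    using I by (simp add: G(1))
  also have "\<dots> = 0"
    by (rule integral_eq_zero_AE) (use rows' in auto)
  finally show ?thesis .
qed

definition codegree :: "'a \<Rightarrow> 'a \<Rightarrow> real" where
  "codegree x y = (\<integral>z. K x z * K y z \<partial>M)"

lemma codegree_measurable [measurable (raw)]:
  assumes [measurable]: "f \<in> N \<rightarrow>\<^sub>M M" "g \<in> N \<rightarrow>\<^sub>M M"
  shows "(\<lambda>x. codegree (f x) (g x)) \<in> borel_measurable N"
  unfolding codegree_def by measurable

lemma codegree_bound: "\<bar>codegree x y\<bar> \<le> 1"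
proof -
  have "\<bar>codegree x y\<bar> \<le> (\<integral>z. 1 \<partial>M)"
    unfolding codegree_def
    by (rule order_trans[OF integral_abs_bound integral_mono']) (auto intro: abs_mult_le_one K_bound)
  then show ?thesis by (simp add: prob_space)
qed

text \<open>Here i and j are opposite corners of the cycle; integrating out l and then k contributes
  one factor \<open>codegree\<close> of i and j each.\<close>

lemma integral_four_cycle:
  fixes i j k l :: nat
  assumes I: "I = {i, j, k, l}" "distinct [i, j, k, l]"
  shows "(\<integral>x. K (x i) (x k) * K (x j) (x k) * (K (x i) (x l) * K (x j) (x l)) \<partial>(\<Pi>\<^sub>M i\<in>I. M)) =
     (\<integral>y. \<integral>x. (codegree x y)\<^sup>2 \<partial>M \<partial>M)"
proof -
  let ?F = "\<lambda>x. K (x i) (x k) * K (x j) (x k) * (K (x i) (x l) * K (x j) (x l))"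
  let ?G = "\<lambda>x. K (x i) (x k) * K (x j) (x k) * codegree (x i) (x j)"
  let ?H = "\<lambda>x. (codegree (x i) (x j))\<^sup>2"
  have "?F \<in> borel_measurable (\<Pi>\<^sub>M i\<in>insert l {i, j, k}. M)" by measurable
  then have F: "integrable (\<Pi>\<^sub>M i\<in>insert l {i, j, k}. M) ?F"
    by (intro integrable_power[where B=1] abs_mult_le_one K_bound)
  have "?G \<in> borel_measurable (\<Pi>\<^sub>M i\<in>insert k {i, j}. M)" by measurable
  then have G: "integrable (\<Pi>\<^sub>M i\<in>insert k {i, j}. M) ?G"
    by (intro integrable_power[where B=1] abs_mult_le_one K_bound codegree_bound)
  have "?H \<in> borel_measurable (\<Pi>\<^sub>M i\<in>insert i {j}. M)" by measurable
  then have H: "integrable (\<Pi>\<^sub>M i\<in>insert i {j}. M) ?H"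
    unfolding power2_eq_square by (intro integrable_power[where B=1] abs_mult_le_one codegree_bound)
  have "(\<integral>x. ?F x \<partial>(\<Pi>\<^sub>M i\<in>insert l {i, j, k}. M)) = (\<integral>x. \<integral>y. ?F (x(l := y)) \<partial>M \<partial>(\<Pi>\<^sub>M i\<in>{i, j, k}. M))"
    using I F by (intro prod.product_integral_insert) auto
  also have "\<dots> = (\<integral>x. ?G x \<partial>(\<Pi>\<^sub>M i\<in>insert k {i, j}. M))"
    using I by (simp add: codegree_def insert_commute)
  also have "\<dots> = (\<integral>x. \<integral>y. ?G (x(k := y)) \<partial>M \<partial>(\<Pi>\<^sub>M i\<in>{i, j}. M))"
    using I G by (intro prod.product_integral_insert) auto
  also have "\<dots> = (\<integral>x. ?H x \<partial>(\<Pi>\<^sub>M i\<in>insert i {j}. M))"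
    using I by (simp add: codegree_def power2_eq_square)
  also have "\<dots> = (\<integral>x. \<integral>y. ?H (x(i := y)) \<partial>M \<partial>(\<Pi>\<^sub>M i\<in>{j}. M))"
    using I H by (intro prod.product_integral_insert) auto
  also have "\<dots> = (\<integral>x. \<integral>y. (codegree y (x j))\<^sup>2 \<partial>M \<partial>(\<Pi>\<^sub>M i\<in>{j}. M))"
    using I by simp
  also have "\<dots> = (\<integral>y. \<integral>x. (codegree x y)\<^sup>2 \<partial>M \<partial>M)"
    by (rule prod.product_integral_singleton) measurable
  finally show ?thesis using I by (simp add: insert_commute)
qed

lemma AE_zero_of_codegree:
  assumes "(\<integral>y. \<integral>x. (codegree x y)\<^sup>2 \<partial>M \<partial>M) = 0"
  shows "AE (x, y) in M \<Otimes>\<^sub>M M. K x y = 0"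
proof (rule AE_zero_of_gram_zero[where C=1])
  show "finite_measure M" by (rule finite_measure_axioms)
  interpret F: prob_space "M \<Otimes>\<^sub>M M" by (intro prob_space_pair prob_space_axioms)
  have i: "integrable (M \<Otimes>\<^sub>M M) (\<lambda>(x, y). (codegree x y)\<^sup>2)"
  proof (rule F.integrable_const_bound[where B=1])
    show "AE p in M \<Otimes>\<^sub>M M. norm (case p of (x, y) \<Rightarrow> (codegree x y)\<^sup>2) \<le> 1"
      using codegree_bound by (auto simp: power2_eq_square intro!: AE_I2 abs_mult_le_one)
  qed measurable
  have "(\<integral>p. (case p of (x, y) \<Rightarrow> (codegree x y)\<^sup>2) \<partial>(M \<Otimes>\<^sub>M M)) = 0"
    using pair.integral_snd[OF i] assms by simp
  then have "AE p in M \<Otimes>\<^sub>M M. (case p of (x, y) \<Rightarrow> (codegree x y)\<^sup>2) = 0"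
    by (subst (asm) integral_nonneg_eq_0_iff_AE[OF i]) auto
  moreover have "codegree y z = (\<integral>x. K x y * K x z \<partial>M)" for y z
    unfolding codegree_def by (simp add: K_sym)
  ultimately show "AE (y, z) in M \<Otimes>\<^sub>M M. (\<integral>x. K x y * K x z \<partial>M) = 0"
    by (auto simp: case_prod_beta)
qed (auto simp: K_bound K_measurable)

text \<open>The coefficient of \<open>t\<^sup>4\<close> collects the 15 four-edge subgraphs of \<open>K\<^sub>4\<close>: 12 of them
  are triangles with a pendant edge, which vanish since \<open>K\<close> has zero row integrals, and the
  other 3 are four-cycles.\<close>

lemma AE_zero_of_tetrahedron:
  assumes rows: "AE x in M. (\<integral>y. K x y \<partial>M) = 0"
    and tet: "\<And>t. 0 \<le> t \<Longrightarrow> t \<le> 1 \<Longrightarrow> (\<integral>x. (1 + t * K (x 1) (x 2)) * (1 + t * K (x 1) (x 3)) * (1 + t * K (x 1) (x 4)) *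
      (1 + t * K (x 2) (x 3)) * (1 + t * K (x 2) (x 4)) * (1 + t * K (x 3) (x 4)) \<partial>(\<Pi>\<^sub>M i\<in>{1..4::nat}. M)) = 1"
  shows "AE (x, y) in M \<Otimes>\<^sub>M M. K x y = 0"
proof -
  let ?P = "\<Pi>\<^sub>M i\<in>{1..4::nat}. M"
  interpret P: prob_space ?P by (rule prob_space_power)
  \<comment> \<open>The letters a to f are the edges 12, 13, 14, 23, 24, 34 of the complete graph on
    four vertices.\<close>
  define a where "a x = K (x 1) (x 2)" for x :: "nat \<Rightarrow> 'a"
  define b where "b x = K (x 1) (x 3)" for x :: "nat \<Rightarrow> 'a"
  define c where "c x = K (x 1) (x 4)" for x :: "nat \<Rightarrow> 'a"
  define d where "d x = K (x 2) (x 3)" for x :: "nat \<Rightarrow> 'a"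
  define e where "e x = K (x 2) (x 4)" for x :: "nat \<Rightarrow> 'a"
  define f where "f x = K (x 3) (x 4)" for x :: "nat \<Rightarrow> 'a"
  note defs = a_def b_def c_def d_def e_def f_def
  have m [measurable]: "a \<in> borel_measurable ?P" "b \<in> borel_measurable ?P" "c \<in> borel_measurable ?P" "d \<in> borel_measurable ?P" "e \<in> borel_measurable ?P" "f \<in> borel_measurable ?P"
    unfolding defs by measurable
  have bd: "\<bar>a x\<bar> \<le> 1" "\<bar>b x\<bar> \<le> 1" "\<bar>c x\<bar> \<le> 1" "\<bar>d x\<bar> \<le> 1" "\<bar>e x\<bar> \<le> 1" "\<bar>f x\<bar> \<le> 1" for x
    unfolding defs by (rule K_bound)+
  have ip: "integrable ?P F" if "F \<in> borel_measurable ?P" "\<And>x. \<bar>F x\<bar> \<le> 1" for F :: "_ \<Rightarrow> real"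
    using that by (rule integrable_power)
  define e1 where "e1 x = a x +
     b x +
     c x +
     d x +
     e x +
     f x" for x
  have i1: "integrable ?P e1"
    unfolding e1_def by (intro Bochner_Integration.integrable_add ip abs_mult_le_one bd) measurable
  define e2 where "e2 x = a x * b x +
     a x * c x +
     a x * d x +
     a x * e x +
     a x * f x +
     b x * c x +
     b x * d x +
     b x * e x +
     b x * f x +
     c x * d x +
     c x * e x +
     c x * f x +
     d x * e x +
     d x * f x +
     e x * f x" for x
  have i2: "integrable ?P e2"
    unfolding e2_def by (intro Bochner_Integration.integrable_add ip abs_mult_le_one bd) measurable
  define e3 where "e3 x = a x * b x * c x +
     a x * b x * d x +
     a x * b x * e x +
     a x * b x * f x +
     a x * c x * d x +
     a x * c x * e x +
     a x * c x * f x +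
     a x * d x * e x +
     a x * d x * f x +
     a x * e x * f x +
     b x * c x * d x +
     b x * c x * e x +
     b x * c x * f x +
     b x * d x * e x +
     b x * d x * f x +
     b x * e x * f x +
     c x * d x * e x +
     c x * d x * f x +
     c x * e x * f x +
     d x * e x * f x" for x
  have i3: "integrable ?P e3"
    unfolding e3_def by (intro Bochner_Integration.integrable_add ip abs_mult_le_one bd) measurable
  \<comment> \<open>Each of the first twelve products lists a triangle and then its pendant edge,
    grouped by the vertex 1, 2, 3, 4 outside the triangle. The last three are the four-cycles,
    bracketed as in \<open>integral_four_cycle\<close>.\<close>
  define e4 where "e4 x = d x * e x * f x * a x +
     d x * e x * f x * b x +
     d x * e x * f x * c x +
     b x * c x * f x * a x +
     b x * c x * f x * d x +
     b x * c x * f x * e x +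
     a x * c x * e x * b x +
     a x * c x * e x * d x +
     a x * c x * e x * f x +
     a x * b x * d x * c x +
     a x * b x * d x * e x +
     a x * b x * d x * f x +
     b x * d x * (c x * e x) +
     a x * d x * (c x * f x) +
     a x * e x * (b x * f x)" for x
  have i4: "integrable ?P e4"
    unfolding e4_def by (intro Bochner_Integration.integrable_add ip abs_mult_le_one bd) measurable
  define e5 where "e5 x = a x * b x * c x * d x * e x +
     a x * b x * c x * d x * f x +
     a x * b x * c x * e x * f x +
     a x * b x * d x * e x * f x +
     a x * c x * d x * e x * f x +
     b x * c x * d x * e x * f x" for x
  have i5: "integrable ?P e5"
    unfolding e5_def by (intro Bochner_Integration.integrable_add ip abs_mult_le_one bd) measurable
  define e6 where "e6 x = a x * b x * c x * d x * e x * f x" for x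
  have i6: "integrable ?P e6"
    unfolding e6_def by (intro Bochner_Integration.integrable_add ip abs_mult_le_one bd) measurable
  have expand: "(1 + t * a x) * (1 + t * b x) * (1 + t * c x) * (1 + t * d x) * (1 + t * e x) * (1 + t * f x) =
     1 + (t * e1 x + t ^ 2 * e2 x + t ^ 3 * e3 x + t ^ 4 * e4 x + t ^ 5 * e5 x + t ^ 6 * e6 x)" for t x
    unfolding e1_def e2_def e3_def e4_def e5_def e6_def by algebra
  have poly: "t * (\<integral>x. e1 x \<partial>?P) + t ^ 2 * (\<integral>x. e2 x \<partial>?P) + t ^ 3 * (\<integral>x. e3 x \<partial>?P) + t ^ 4 * (\<integral>x. e4 x \<partial>?P) +
     t ^ 5 * (\<integral>x. e5 x \<partial>?P) + t ^ 6 * (\<integral>x. e6 x \<partial>?P) = 0" if "0 \<le> t" "t \<le> 1" for t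
  proof -
    have "(\<integral>x. 1 + (t * e1 x + t ^ 2 * e2 x + t ^ 3 * e3 x + t ^ 4 * e4 x + t ^ 5 * e5 x + t ^ 6 * e6 x) \<partial>?P) = 1"
      using tet[OF that] unfolding expand[symmetric] defs .
    then show ?thesis
      unfolding P.integral_sextic[OF i1 i2 i3 i4 i5 i6] by simp
  qed
  \<comment> \<open>The polynomial has degree at most 6 and no constant term, so six distinct
    nonzero values of t give an invertible linear system for its coefficients.\<close>
  have "(\<integral>x. e4 x \<partial>?P) = 0"
    using poly[of "1/6"] poly[of "2/6"] poly[of "3/6"] poly[of "4/6"] poly[of "5/6"] poly[of 1]
    by (simp add: power_divide)
  have pend: "(\<integral>x. g x * h x * l x * K (x u) (x v) \<partial>?P) = 0"
    if "v \<in> {1..4}" "u \<in> {1..4}" "u \<noteq> v" "{g, h, l} \<subseteq> {a, b, c, d, e, f}"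
      "\<And>x y. g (x(v := y)) = g x \<and> h (x(v := y)) = h x \<and> l (x(v := y)) = l x" for v u g h l
  proof (rule integral_pendant[OF rows])
    have edge: "g \<in> borel_measurable ?P \<and> (\<forall>x. \<bar>g x\<bar> \<le> 1)" if "g \<in> {a, b, c, d, e, f}" for g
      using that m bd by (auto simp del: One_nat_def)
    show "(\<lambda>x. g x * h x * l x) \<in> borel_measurable ?P" using that(4) edge by (intro borel_measurable_times) auto
    show "\<bar>g x * h x * l x\<bar> \<le> 1" for x using that(4) edge by (intro abs_mult_le_one) auto
  qed (use that in auto)
  have z12: "(\<integral>x. d x * e x * f x * a x \<partial>?P) = 0"
    using pend[of 1 2 d e f]
    by (simp add: defs K_sym[of "_ 2" "_ (Suc 0)"])
  have z13: "(\<integral>x. d x * e x * f x * b x \<partial>?P) = 0"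
    using pend[of 1 3 d e f]
    by (simp add: defs K_sym[of "_ 3" "_ (Suc 0)"])
  have z14: "(\<integral>x. d x * e x * f x * c x \<partial>?P) = 0"
    using pend[of 1 4 d e f]
    by (simp add: defs K_sym[of "_ 4" "_ (Suc 0)"])
  have z21: "(\<integral>x. b x * c x * f x * a x \<partial>?P) = 0"
    using pend[of 2 1 b c f]
    by (simp add: defs K_sym[of "_ 2" "_ (Suc 0)"])
  have z23: "(\<integral>x. b x * c x * f x * d x \<partial>?P) = 0"
    using pend[of 2 3 b c f]
    by (simp add: defs K_sym[of "_ 3" "_ 2"])
  have z24: "(\<integral>x. b x * c x * f x * e x \<partial>?P) = 0"
    using pend[of 2 4 b c f]
    by (simp add: defs K_sym[of "_ 4" "_ 2"])
  have z31: "(\<integral>x. a x * c x * e x * b x \<partial>?P) = 0"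
    using pend[of 3 1 a c e]
    by (simp add: defs K_sym[of "_ 3" "_ (Suc 0)"])
  have z32: "(\<integral>x. a x * c x * e x * d x \<partial>?P) = 0"
    using pend[of 3 2 a c e]
    by (simp add: defs K_sym[of "_ 3" "_ 2"])
  have z34: "(\<integral>x. a x * c x * e x * f x \<partial>?P) = 0"
    using pend[of 3 4 a c e]
    by (simp add: defs K_sym[of "_ 4" "_ 3"])
  have z41: "(\<integral>x. a x * b x * d x * c x \<partial>?P) = 0"
    using pend[of 4 1 a b d]
    by (simp add: defs K_sym[of "_ 4" "_ (Suc 0)"])
  have z42: "(\<integral>x. a x * b x * d x * e x \<partial>?P) = 0"
    using pend[of 4 2 a b d]
    by (simp add: defs K_sym[of "_ 4" "_ 2"])
  have z43: "(\<integral>x. a x * b x * d x * f x \<partial>?P) = 0"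
    using pend[of 4 3 a b d]
    by (simp add: defs K_sym[of "_ 4" "_ 3"])
  have s12: "{1..4::nat} = {1, 2, 3, 4}" by auto
  have c12: "(\<integral>x. b x * d x * (c x * e x) \<partial>?P) = (\<integral>y. \<integral>x. (codegree x y)\<^sup>2 \<partial>M \<partial>M)"
    using integral_four_cycle[of "{1..4}" 1 2 3 4, OF s12] by (simp add: defs K_sym[of "_ 3" "_ 2"])
  have s13: "{1..4::nat} = {1, 3, 2, 4}" by auto
  have c13: "(\<integral>x. a x * d x * (c x * f x) \<partial>?P) = (\<integral>y. \<integral>x. (codegree x y)\<^sup>2 \<partial>M \<partial>M)"
    using integral_four_cycle[of "{1..4}" 1 3 2 4, OF s13] by (simp add: defs K_sym[of "_ 3" "_ 2"])
  have s14: "{1..4::nat} = {1, 4, 2, 3}" by auto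
  have c14: "(\<integral>x. a x * e x * (b x * f x) \<partial>?P) = (\<integral>y. \<integral>x. (codegree x y)\<^sup>2 \<partial>M \<partial>M)"
    using integral_four_cycle[of "{1..4}" 1 4 2 3, OF s14] by (simp add: defs K_sym[of "_ 4" "_ 2"] K_sym[of "_ 4" "_ 3"])
  have summands: "integrable ?P (\<lambda>x. d x * e x * f x * a x)"
    "integrable ?P (\<lambda>x. d x * e x * f x * b x)"
    "integrable ?P (\<lambda>x. d x * e x * f x * c x)"
    "integrable ?P (\<lambda>x. b x * c x * f x * a x)"
    "integrable ?P (\<lambda>x. b x * c x * f x * d x)"
    "integrable ?P (\<lambda>x. b x * c x * f x * e x)"
    "integrable ?P (\<lambda>x. a x * c x * e x * b x)"
    "integrable ?P (\<lambda>x. a x * c x * e x * d x)"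
    "integrable ?P (\<lambda>x. a x * c x * e x * f x)"
    "integrable ?P (\<lambda>x. a x * b x * d x * c x)"
    "integrable ?P (\<lambda>x. a x * b x * d x * e x)"
    "integrable ?P (\<lambda>x. a x * b x * d x * f x)"
    "integrable ?P (\<lambda>x. b x * d x * (c x * e x))"
    "integrable ?P (\<lambda>x. a x * d x * (c x * f x))"
    "integrable ?P (\<lambda>x. a x * e x * (b x * f x))"
    by (intro ip abs_mult_le_one bd; measurable)+
  have "(\<integral>x. e4 x \<partial>?P) = 3 * (\<integral>y. \<integral>x. (codegree x y)\<^sup>2 \<partial>M \<partial>M)"
    unfolding e4_def
    by (simp only: Bochner_Integration.integral_add Bochner_Integration.integrable_add summands
      z12 z13 z14 z21 z23 z24 z31 z32 z34 z41 z42 z43 c12 c13 c14)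
  with \<open>(\<integral>x. e4 x \<partial>?P) = 0\<close> show ?thesis by (intro AE_zero_of_codegree) simp
qed

end

section \<open>The edge-count generating function of a graphon\<close>

locale graphon_kernel = prob_space M for M :: "'a measure" +
  fixes U :: "'a \<Rightarrow> 'a \<Rightarrow> real"
  assumes U_measurable: "case_prod U \<in> borel_measurable (M \<Otimes>\<^sub>M M)"
    and U_sym: "U x y = U y x"
    and U_ge_0: "0 \<le> U x y"
    and U_le_1: "U x y \<le> 1"
begin

lemmas U_measurable_uncurried [measurable (raw)] = measurable_uncurried[OF U_measurable]

lemma sym_kernel_thinned: "sym_kernel M (\<lambda>x y. ennreal (1 - s * U x y))"
  by unfold_locales (measurable, simp add: U_sym)

text \<open>The conversion to \<open>ennreal\<close> cuts negative factors off at 0, so this is the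
  generating function of the edge count at 1 - s for s <= 1.\<close>

definition edge_gf :: "real \<Rightarrow> nat \<Rightarrow> ennreal" where
  "edge_gf s k = sym_kernel.cliques M (\<lambda>x y. ennreal (1 - s * U x y)) k (\<lambda>_. 1)"

end

lemma (in prob_space) AE_PiM_vertex_pairs:
  assumes "AE (x, y) in M \<Otimes>\<^sub>M M. P x y"
  shows "AE x in (\<Pi>\<^sub>M i\<in>{1..k}. M). \<forall>e\<in>vertex_pairs k. P (x (Min e)) (x (Max e))"
proof (rule AE_finite_allI)
  fix e assume "e \<in> vertex_pairs k"
  from vertex_pairs_Min_Max[OF this] show "AE x in (\<Pi>\<^sub>M i\<in>{1..k}. M). P (x (Min e)) (x (Max e))"
    by (intro AE_PiM_pair[OF assms]) auto
qed simp

lemma edge_gf_cong_AE: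
  assumes "graphon_kernel M U" "graphon_kernel M U'" "AE (x, y) in M \<Otimes>\<^sub>M M. U x y = U' x y"
  shows "graphon_kernel.edge_gf M U s k = graphon_kernel.edge_gf M U' s k"
proof -
  interpret U: graphon_kernel M U by fact
  interpret U': graphon_kernel M U' by fact
  have "AE x in (\<Pi>\<^sub>M i\<in>{1..k}. M). \<forall>e\<in>vertex_pairs k. U (x (Min e)) (x (Max e)) = U' (x (Min e)) (x (Max e))"
    by (rule U.AE_PiM_vertex_pairs[OF assms(3)])
  then show ?thesis
    unfolding U.edge_gf_def U'.edge_gf_def
      sym_kernel.cliques_def[OF U.sym_kernel_thinned] sym_kernel.cliques_def[OF U'.sym_kernel_thinned]
    by (intro nn_integral_cong_AE) (elim AE_mp, auto intro!: AE_I2 prod.cong)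
qed

sublocale graphon_kernel \<subseteq> bounded_kernel M U
  by unfold_locales (auto simp: U_measurable U_sym U_ge_0 U_le_1)

context graphon_kernel
begin

text \<open>Expanding the product produces signed terms, which call for the real integral; |s| <= 1
  keeps every factor between 0 and 2.\<close>

lemma edge_gf_eq_integral:
  assumes "-1 \<le> s" "s \<le> 1"
  shows "edge_gf s k = ennreal (\<integral>x. (\<Prod>e\<in>vertex_pairs k. 1 - s * U (x (Min e)) (x (Max e))) \<partial>(\<Pi>\<^sub>M i\<in>{1..k}. M))"
    and "0 \<le> (\<integral>x. (\<Prod>e\<in>vertex_pairs k. 1 - s * U (x (Min e)) (x (Max e))) \<partial>(\<Pi>\<^sub>M i\<in>{1..k}. M))"
    and "integrable (\<Pi>\<^sub>M i\<in>{1..k}. M) (\<lambda>x. \<Prod>e\<in>vertex_pairs k. 1 - s * U (x (Min e)) (x (Max e)))"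
proof -
  let ?F = "\<lambda>x. \<Prod>e\<in>vertex_pairs k. 1 - s * U (x (Min e)) (x (Max e))"
  have sU: "\<bar>s * U x y\<bar> \<le> 1" for x y using assms by (intro abs_mult_le_one K_bound) auto
  have nonneg: "0 \<le> 1 - s * U x y" and le2: "1 - s * U x y \<le> 2" for x y
    using sU[of x y] by auto
  note [measurable] = measurable_vertex_pair[where k="k" and M=M]
  have "?F \<in> borel_measurable (\<Pi>\<^sub>M i\<in>{1..k}. M)" by measurable
  moreover have "\<bar>?F x\<bar> \<le> (\<Prod>e\<in>vertex_pairs k. 2)" for x
    unfolding abs_prod by (intro prod_mono) (use nonneg le2 in auto)
  ultimately show int: "integrable (\<Pi>\<^sub>M i\<in>{1..k}. M) ?F" by (rule integrable_power)
  show "0 \<le> (\<integral>x. ?F x \<partial>(\<Pi>\<^sub>M i\<in>{1..k}. M))"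
    by (intro integral_nonneg_AE AE_I2 prod_nonneg) (use nonneg in auto)
  have "(\<Prod>e\<in>vertex_pairs k. ennreal (1 - s * U (x (Min e)) (x (Max e)))) = ennreal (?F x)" for x
    by (rule prod_ennreal) (rule nonneg)
  then have "edge_gf s k = (\<integral>\<^sup>+x. ennreal (?F x) \<partial>(\<Pi>\<^sub>M i\<in>{1..k}. M))"
    unfolding edge_gf_def sym_kernel.cliques_def[OF sym_kernel_thinned]
    by (simp only: prod.neutral_const mult_1)
  also have "\<dots> = ennreal (\<integral>x. ?F x \<partial>(\<Pi>\<^sub>M i\<in>{1..k}. M))"
    by (rule nn_integral_eq_integral[OF int]) (use nonneg in \<open>auto intro!: AE_I2 prod_nonneg\<close>)
  finally show "edge_gf s k = ennreal (\<integral>x. ?F x \<partial>(\<Pi>\<^sub>M i\<in>{1..k}. M))" .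
qed

text \<open>The kernel K = q - U has zero row integrals. Four points span six pairs, so dividing by
  (1 - s q)^6 turns the hypothesis into the statement that the six factors 1 + t K integrate to 1,
  as \<open>AE_zero_of_tetrahedron\<close> requires.\<close>

lemma AE_const_of_edge_gf_4:
  assumes q: "0 \<le> q" "q \<le> 1" and rows: "AE x in M. (\<integral>y. U x y \<partial>M) = q"
    and gf: "\<And>s. 0 \<le> s \<Longrightarrow> s \<le> 1 \<Longrightarrow> edge_gf s 4 = ennreal ((1 - s * q) ^ 6)"
  shows "AE (x, y) in M \<Otimes>\<^sub>M M. U x y = q"
proof -
  define K where "K x y = q - U x y" for x y
  interpret K: bounded_kernel M K
  proof
    show "case_prod K \<in> borel_measurable (M \<Otimes>\<^sub>M M)" unfolding K_def by measurable
    show "K x y = K y x" for x y by (simp add: K_def U_sym)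
    show "\<bar>K x y\<bar> \<le> 1" for x y
      using q U_ge_0[of x y] U_le_1[of x y] by (auto simp: K_def)
  qed
  have "integrable M (U x)" if [measurable]: "x \<in> space M" for x
    by (rule integrable_const_bound[where B=1]) (auto simp: U_ge_0 U_le_1)
  then have rowsK: "AE x in M. (\<integral>y. K x y \<partial>M) = 0"
    using rows by (elim AE_mp, intro AE_I2 impI) (simp add: K_def prob_space)
  have "AE (x, y) in M \<Otimes>\<^sub>M M. K x y = 0"
  proof (rule K.AE_zero_of_tetrahedron[OF rowsK])
    fix t :: real assume t: "0 \<le> t" "t \<le> 1"
    let ?P = "\<Pi>\<^sub>M i\<in>{1..4::nat}. M"
    let ?F = "\<lambda>x :: nat \<Rightarrow> 'a. (1 + t * K (x 1) (x 2)) * (1 + t * K (x 1) (x 3)) * (1 + t * K (x 1) (x 4)) *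
      (1 + t * K (x 2) (x 3)) * (1 + t * K (x 2) (x 4)) * (1 + t * K (x 3) (x 4))"
    \<comment> \<open>This substitution makes \<open>1 - s U\<close> proportional to \<open>1 + t K\<close>.\<close>
    define u where "u = 1 + t * q"
    define s where "s = t / u"
    have u: "1 \<le> u" using t q by (simp add: u_def)
    have s: "0 \<le> s" "s \<le> 1" using t u by (auto simp: s_def)
    have sq: "1 - s * q = 1 / u" using u by (simp add: s_def u_def field_simps)
    have sU: "1 - s * U x y = (1 + t * K x y) / u" for x y
      using u by (simp add: s_def K_def field_simps) (simp add: u_def)
    have prods: "(\<Prod>e\<in>vertex_pairs 4. 1 - s * U (x (Min e)) (x (Max e))) = ?F x / u ^ 6" for x
      by (simp add: sU prod_vertex_pairs_4[of "\<lambda>i j. (1 + t * K (x i) (x j)) / u"] power_def)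
    have "(\<integral>x. ?F x / u ^ 6 \<partial>?P) = (1 / u) ^ 6"
      using edge_gf_eq_integral(1,2)[of s 4] gf[OF s] s u unfolding prods sq by simp
    moreover have "(\<integral>x. ?F x / u ^ 6 \<partial>?P) = (\<integral>x. ?F x \<partial>?P) / u ^ 6" by (rule integral_divide_zero)
    ultimately show "(\<integral>x. ?F x \<partial>?P) = 1" using u by (simp add: power_divide)
  qed
  then show ?thesis by (rule AE_mp) (auto intro!: AE_I2 simp: K_def)
qed

definition degree_on :: "'a set \<Rightarrow> 'a \<Rightarrow> real" where
  "degree_on A x = (\<integral>y. indicator A y * U x y \<partial>M)"

abbreviation degree :: "'a \<Rightarrow> real" where "degree x \<equiv> degree_on UNIV x"

lemma degree_measurable [measurable (raw)]:
  assumes [measurable]: "f \<in> N \<rightarrow>\<^sub>M M"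
  shows "(\<lambda>x. degree (f x)) \<in> borel_measurable N"
  unfolding degree_on_def by simp

lemma degree_on_measurable [measurable (raw)]:
  assumes [measurable]: "A \<in> sets M" "f \<in> N \<rightarrow>\<^sub>M M"
  shows "(\<lambda>x. degree_on A (f x)) \<in> borel_measurable N"
  unfolding degree_on_def by measurable

lemma degree_on_bounds: "0 \<le> degree_on A x" "degree_on A x \<le> 1"
proof -
  show "0 \<le> degree_on A x"
    unfolding degree_on_def by (intro integral_nonneg_AE AE_I2) (simp add: U_ge_0)
  have "degree_on A x \<le> (\<integral>y. 1 \<partial>M)"
    unfolding degree_on_def by (rule integral_mono') (auto simp: U_le_1 indicator_def)
  then show "degree_on A x \<le> 1" by (simp add: prob_space)
qed

lemma integral_edge:
  fixes i j :: nat
  assumes "I = {i, j}" "i \<noteq> j"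
  shows "(\<integral>x. U (x i) (x j) \<partial>(\<Pi>\<^sub>M i\<in>I. M)) = (\<integral>x. degree x \<partial>M)"
proof -
  have "(\<lambda>x. U (x i) (x j)) \<in> borel_measurable (\<Pi>\<^sub>M i\<in>insert j {i}. M)" by measurable
  then have i: "integrable (\<Pi>\<^sub>M i\<in>insert j {i}. M) (\<lambda>x. U (x i) (x j))"
    by (rule integrable_power) (rule K_bound)
  have "(\<integral>x. U (x i) (x j) \<partial>(\<Pi>\<^sub>M i\<in>insert j {i}. M)) = (\<integral>x. \<integral>y. U ((x(j := y)) i) ((x(j := y)) j) \<partial>M \<partial>(\<Pi>\<^sub>M i\<in>{i}. M))"
    using assms i by (intro prod.product_integral_insert) auto
  also have "\<dots> = (\<integral>x. degree (x i) \<partial>(\<Pi>\<^sub>M i\<in>{i}. M))"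
    using assms by (simp add: degree_on_def)
  also have "\<dots> = (\<integral>x. degree x \<partial>M)"
    by (rule prod.product_integral_singleton) measurable
  finally show ?thesis using assms by (simp add: insert_commute)
qed

text \<open>Integrating out the leaves k and j in turn produces the degree of the centre i
  twice.\<close>

lemma integral_cherry:
  fixes i j k :: nat
  assumes I: "I = {i, j, k}" "distinct [i, j, k]"
  shows "(\<integral>x. U (x i) (x j) * U (x i) (x k) \<partial>(\<Pi>\<^sub>M i\<in>I. M)) = (\<integral>x. (degree x)\<^sup>2 \<partial>M)"
proof -
  let ?F = "\<lambda>x. U (x i) (x j) * U (x i) (x k)"
  let ?G = "\<lambda>x. U (x i) (x j) * degree (x i)"
  have "?F \<in> borel_measurable (\<Pi>\<^sub>M i\<in>insert k {i, j}. M)" by measurable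
  then have F: "integrable (\<Pi>\<^sub>M i\<in>insert k {i, j}. M) ?F"
    by (intro integrable_power[where B=1] abs_mult_le_one K_bound)
  have "?G \<in> borel_measurable (\<Pi>\<^sub>M i\<in>insert j {i}. M)" by measurable
  then have G: "integrable (\<Pi>\<^sub>M i\<in>insert j {i}. M) ?G"
    using degree_on_bounds by (intro integrable_power[where B=1] abs_mult_le_one K_bound) auto
  have "(\<integral>x. ?F x \<partial>(\<Pi>\<^sub>M i\<in>insert k {i, j}. M)) = (\<integral>x. \<integral>y. ?F (x(k := y)) \<partial>M \<partial>(\<Pi>\<^sub>M i\<in>{i, j}. M))"
    using I F by (intro prod.product_integral_insert) auto
  also have "\<dots> = (\<integral>x. ?G x \<partial>(\<Pi>\<^sub>M i\<in>insert j {i}. M))"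
    using I by (simp add: degree_on_def insert_commute)
  also have "\<dots> = (\<integral>x. \<integral>y. ?G (x(j := y)) \<partial>M \<partial>(\<Pi>\<^sub>M i\<in>{i}. M))"
    using I G by (intro prod.product_integral_insert) auto
  also have "\<dots> = (\<integral>x. (degree (x i))\<^sup>2 \<partial>(\<Pi>\<^sub>M i\<in>{i}. M))"
    using I by (simp add: degree_on_def power2_eq_square)
  also have "\<dots> = (\<integral>x. (degree x)\<^sup>2 \<partial>M)"
    by (rule prod.product_integral_singleton) measurable
  finally show ?thesis using I by (simp add: insert_commute)
qed

lemma integral_degree_of_edge_gf:
  assumes "edge_gf 1 2 = ennreal c" "0 \<le> c"
  shows "(\<integral>x. degree x \<partial>M) = 1 - c"
proof -
  let ?P = "\<Pi>\<^sub>M i\<in>{1..2::nat}. M"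
  interpret P: prob_space ?P by (rule prob_space_power)
  have "c = (\<integral>x. (\<Prod>e\<in>vertex_pairs 2. 1 - 1 * U (x (Min e)) (x (Max e))) \<partial>?P)"
    using assms edge_gf_eq_integral(1,2)[of 1 2] by simp
  also have "\<dots> = (\<integral>x. 1 - U (x 1) (x 2) \<partial>?P)"
    unfolding prod_vertex_pairs_2[of "\<lambda>i j. 1 - 1 * U (_ i) (_ j)"] by simp
  also have "\<dots> = 1 - (\<integral>x. U (x 1) (x 2) \<partial>?P)"
  proof -
    have "integrable ?P (\<lambda>x. U (x 1) (x 2))"
      by (rule integrable_power[where B=1]) (measurable, rule K_bound)
    then show ?thesis
      by (subst Bochner_Integration.integral_diff[OF P.integrable_const]) (use P.prob_space in auto)
  qed
  also have "(\<integral>x. U (x 1) (x 2) \<partial>?P) = (\<integral>x. degree x \<partial>M)"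
    by (rule integral_edge) auto
  finally show ?thesis by simp
qed

text \<open>Adding the values at \<open>s = 1\<close> and \<open>s = -1\<close> cancels the contributions of edges and triangles.\<close>

lemma integral_degree_squared_of_edge_gf:
  assumes "edge_gf 1 3 = ennreal c" "0 \<le> c" "edge_gf (-1) 3 = ennreal d" "0 \<le> d"
  shows "(\<integral>x. (degree x)\<^sup>2 \<partial>M) = (c + d - 2) / 6"
proof -
  let ?P = "\<Pi>\<^sub>M i\<in>{1..3::nat}. M"
  interpret P: prob_space ?P by (rule prob_space_power)
  let ?F = "\<lambda>s x. \<Prod>e\<in>vertex_pairs 3. 1 - s * U (x (Min e)) (x (Max e))"
  have "c = (\<integral>x. ?F 1 x \<partial>?P)" "d = (\<integral>x. ?F (-1) x \<partial>?P)"
    using assms edge_gf_eq_integral(1,2)[of 1 3] edge_gf_eq_integral(1,2)[of "-1" 3] by simp_all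
  then have "c + d = (\<integral>x. ?F 1 x + ?F (-1) x \<partial>?P)"
    using edge_gf_eq_integral(3)[of 1 3] edge_gf_eq_integral(3)[of "-1" 3]
    by (subst Bochner_Integration.integral_add) auto
  \<comment> \<open>What is even in s is the constant and the three cherries, each written with its
    centre first to match \<open>integral_cherry\<close>.\<close>
  also have "\<dots> = (\<integral>x. 2 * (1 + (U (x 1) (x 2) * U (x 1) (x 3) + (U (x 2) (x 1) * U (x 2) (x 3) + U (x 3) (x 1) * U (x 3) (x 2)))) \<partial>?P)"
    unfolding prod_vertex_pairs_3[of "\<lambda>i j. 1 - _ * U (_ i) (_ j)"]
    by (intro Bochner_Integration.integral_cong)
       (auto simp: algebra_simps U_sym[of "_ 2" "_ 1"] U_sym[of "_ 2" "_ (Suc 0)"] U_sym[of "_ 3" "_ 1"] U_sym[of "_ 3" "_ (Suc 0)"] U_sym[of "_ 3" "_ 2"])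
  also have "\<dots> = 2 * (1 + ((\<integral>x. (degree x)\<^sup>2 \<partial>M) + ((\<integral>x. (degree x)\<^sup>2 \<partial>M) + (\<integral>x. (degree x)\<^sup>2 \<partial>M))))"
  proof -
    have i: "integrable ?P (\<lambda>x. U (x 1) (x 2) * U (x 1) (x 3))" "integrable ?P (\<lambda>x. U (x 2) (x 1) * U (x 2) (x 3))"
       "integrable ?P (\<lambda>x. U (x 3) (x 1) * U (x 3) (x 2))"
      by (intro integrable_power[where B=1] abs_mult_le_one K_bound; measurable)+
    have c: "(\<integral>x. U (x 1) (x 2) * U (x 1) (x 3) \<partial>?P) = (\<integral>x. (degree x)\<^sup>2 \<partial>M)"
      "(\<integral>x. U (x 2) (x 1) * U (x 2) (x 3) \<partial>?P) = (\<integral>x. (degree x)\<^sup>2 \<partial>M)"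
      "(\<integral>x. U (x 3) (x 1) * U (x 3) (x 2) \<partial>?P) = (\<integral>x. (degree x)\<^sup>2 \<partial>M)"
      by (rule integral_cherry; auto)+
    have one: "(\<integral>x. 1 \<partial>?P) = (1::real)" "integrable ?P (\<lambda>x. 1 :: real)"
      using P.prob_space by (simp, intro P.integrable_const)
    show ?thesis
      by (simp only: Bochner_Integration.integral_mult_right_zero Bochner_Integration.integral_add
          Bochner_Integration.integrable_add one i c)
  qed
  finally show ?thesis by simp
qed

end

section \<open>Kernels with the generating function of a step kernel\<close>

definition step_kernel :: "'a set \<Rightarrow> real \<Rightarrow> real \<Rightarrow> 'a \<Rightarrow> 'a \<Rightarrow> real" where
  "step_kernel A p q x y = (if x \<in> A \<and> y \<in> A then 0 else if x \<in> A \<or> y \<in> A then p else q)"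

text \<open>Used to make a statement known almost everywhere exact: U is reset on the region
  concerned and stays symmetric and bounded at every point.\<close>

lemma (in prob_space) graphon_kernel_override:
  assumes "graphon_kernel M U" and [measurable]: "Measurable.pred (M \<Otimes>\<^sub>M M) (case_prod P)"
    and "\<And>x y. P x y = P y x" "0 \<le> c" "c \<le> 1"
  shows "graphon_kernel M (\<lambda>x y. if P x y then c else U x y)"
proof -
  interpret U: graphon_kernel M U by fact
  show ?thesis
  proof
    have "(\<lambda>r. if case_prod P r then c else case_prod U r) \<in> borel_measurable (M \<Otimes>\<^sub>M M)"
      using U.U_measurable by measurable
    also have "(\<lambda>r. if case_prod P r then c else case_prod U r) = (\<lambda>(x, y). if P x y then c else U x y)" by auto
    finally show "(\<lambda>(x, y). if P x y then c else U x y) \<in> borel_measurable (M \<Otimes>\<^sub>M M)" .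
  qed (use assms U.U_sym U.U_ge_0 U.U_le_1 in auto)
qed

text \<open>The value of \<open>mixed\<close> on the step kernel, with m points in A and j in B:
  there are j choose 2 pairs inside B and m j pairs across, and a pair inside A contributes the
  factor 1.\<close>

definition step_weight :: "real \<Rightarrow> real \<Rightarrow> real \<Rightarrow> real \<Rightarrow> nat \<Rightarrow> nat \<Rightarrow> real" where
  "step_weight a p q s m j = (1 - a) ^ j * (1 - s * q) ^ (j choose 2) * (a * (1 - s * p) ^ j) ^ m"

definition step_gf :: "real \<Rightarrow> real \<Rightarrow> real \<Rightarrow> real \<Rightarrow> nat \<Rightarrow> real" where
  "step_gf a p q s k = (\<Sum>j\<le>k. real (k choose j) * step_weight a p q s (k - j) j)"

lemma step_weight_nonneg:
  assumes "0 \<le> a" "a \<le> 1" "0 \<le> p" "p \<le> 1" "0 \<le> q" "q \<le> 1" "s \<le> 1"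
  shows "0 \<le> step_weight a p q s m j"
proof -
  have "0 \<le> 1 - s * q" "0 \<le> 1 - s * p"
    using assms mult_right_mono[of s 1 p] mult_right_mono[of s 1 q] by auto
  then show ?thesis using assms by (simp add: step_weight_def)
qed

lemma step_gf_nonneg:
  assumes "0 \<le> a" "a \<le> 1" "0 \<le> p" "p \<le> 1" "0 \<le> q" "q \<le> 1" "s \<le> 1"
  shows "0 \<le> step_gf a p q s k"
  unfolding step_gf_def by (intro sum_nonneg mult_nonneg_nonneg step_weight_nonneg assms) simp

lemma (in graphon_kernel) cliques_split_thinned:
  assumes [measurable]: "A \<in> sets M" and A0: "\<And>x y. x \<in> A \<Longrightarrow> y \<in> A \<Longrightarrow> U x y = 0"
  shows "edge_gf s k = (\<Sum>j\<le>k. of_nat (k choose j) *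
    sym_kernel.mixed M (\<lambda>x y. ennreal (1 - s * U x y)) A (space M - A) (k - j) j (\<lambda>_. 1))"
proof -
  interpret V: sym_kernel M "\<lambda>x y. ennreal (1 - s * U x y)" by (rule sym_kernel_thinned)
  show ?thesis
    unfolding edge_gf_def by (rule V.cliques_split) (use A0 sets.sets_into_space[OF assms(1)] in auto)
qed

lemma (in graphon_kernel) edge_gf_step:
  assumes [measurable]: "A \<in> sets M" and a: "measure M A = a"
    and U: "\<And>x y. x \<in> A \<Longrightarrow> y \<in> A \<Longrightarrow> U x y = 0"
      "\<And>x y. x \<in> space M - A \<Longrightarrow> y \<in> A \<Longrightarrow> U x y = p"
      "\<And>x y. x \<in> space M - A \<Longrightarrow> y \<in> space M - A \<Longrightarrow> U x y = q"
    and pq: "0 \<le> p" "p \<le> 1" "0 \<le> q" "q \<le> 1" and s: "s \<le> 1"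
  shows "edge_gf s k = ennreal (step_gf a p q s k)"
proof -
  interpret V: sym_kernel M "\<lambda>x y. ennreal (1 - s * U x y)" by (rule sym_kernel_thinned)
  let ?B = "space M - A"
  have rho: "0 \<le> 1 - s * q" "0 \<le> 1 - s * p"
    using pq s mult_right_mono[of s 1 p] mult_right_mono[of s 1 q] by auto
  have a01: "0 \<le> a" "a \<le> 1" using a prob_le_1[of A] by auto
  have eA: "emeasure M A = ennreal a" using a by (simp add: emeasure_eq_measure)
  have eB: "emeasure M ?B = ennreal (1 - a)" using a prob_compl[of A] by (simp add: emeasure_eq_measure)
  have mixed: "V.mixed A ?B m j (\<lambda>_. 1) = ennreal (step_weight a p q s m j)" for m j
  proof -
    have "V.mixed A ?B m j (\<lambda>_. 1) = (1 * emeasure M A * ennreal (1 - s * p) ^ j) ^ m * V.mixed A ?B 0 j (\<lambda>_. 1)"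
      by (rule V.mixed_const_between) (auto simp: U)
    also have "V.mixed A ?B 0 j (\<lambda>_. 1) = emeasure M ?B ^ j * ennreal (1 - s * q) ^ (j choose 2)"
      by (rule V.mixed_const_inside) (auto simp: U)
    finally show ?thesis
      using rho a01 by (simp add: eA eB step_weight_def ennreal_power mult_ac flip: ennreal_mult)
  qed
  have "edge_gf s k = (\<Sum>j\<le>k. of_nat (k choose j) * V.mixed A ?B (k - j) j (\<lambda>_. 1))"
    by (rule cliques_split_thinned) (auto simp: U)
  also have "\<dots> = (\<Sum>j\<le>k. ennreal (real (k choose j) * step_weight a p q s (k - j) j))"
    using step_weight_nonneg[OF a01 pq s] by (simp add: mixed ennreal_mult flip: ennreal_of_nat_eq_real_of_nat)
  also have "\<dots> = ennreal (step_gf a p q s k)"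
    unfolding step_gf_def using step_weight_nonneg[OF a01 pq s] by (intro sum_ennreal) auto
  finally show ?thesis .
qed

text \<open>The generating functions serve at s = 1 for the independent set and the degree moments,
  at s = -1 for the second moment, at s = 1/2 for the growth comparison, and on all of [0, 1] for
  the part inside B.\<close>

locale forced_kernel = graphon_kernel +
  fixes a p q :: real
  assumes a_ge_0: "0 \<le> a" and a_less_1: "a < 1" and p_pos: "0 < p" and p_le_1: "p \<le> 1" and q_pos: "0 < q" and q_le_1: "q \<le> 1"
    and degree_gap: "(1 - a) * q \<le> (1 - 2 * a) * p"
    and gf: "\<And>s k. -1 \<le> s \<Longrightarrow> s \<le> 1 \<Longrightarrow> edge_gf s k = ennreal (step_gf a p q s k)"
begin

lemma step_gf_ge_0: "s \<le> 1 \<Longrightarrow> 0 \<le> step_gf a p q s k"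
  using a_ge_0 a_less_1 p_pos p_le_1 q_pos q_le_1 by (intro step_gf_nonneg) auto

lemma step_weight_ge_0: "s \<le> 1 \<Longrightarrow> 0 \<le> step_weight a p q s m j"
  using a_ge_0 a_less_1 p_pos p_le_1 q_pos q_le_1 by (intro step_weight_nonneg) auto

text \<open>The right-hand side is arranged as the average of the two degrees of the step kernel, (1
  - a) p on its independent class and a p + (1 - a) q on the other, the form that
  \<open>AE_degree\<close> needs.\<close>

lemma integral_degree: "(\<integral>x. degree x \<partial>M) = a * ((1 - a) * p) + (1 - a) * (a * p + (1 - a) * q)"
proof -
  have "(\<integral>x. degree x \<partial>M) = 1 - step_gf a p q 1 2"
    by (rule integral_degree_of_edge_gf) (auto simp: gf step_gf_ge_0)
  also have "\<dots> = a * ((1 - a) * p) + (1 - a) * (a * p + (1 - a) * q)"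
    by (simp add: step_gf_def step_weight_def numeral_2_eq_2) (simp add: algebra_simps)
  finally show ?thesis .
qed

lemma integral_degree_squared:
  "(\<integral>x. (degree x)\<^sup>2 \<partial>M) = a * ((1 - a) * p)\<^sup>2 + (1 - a) * (a * p + (1 - a) * q)\<^sup>2"
proof -
  have "(\<integral>x. (degree x)\<^sup>2 \<partial>M) = (step_gf a p q 1 3 + step_gf a p q (-1) 3 - 2) / 6"
    by (rule integral_degree_squared_of_edge_gf) (auto simp: gf step_gf_ge_0)
  also have "\<dots> = a * ((1 - a) * p)\<^sup>2 + (1 - a) * (a * p + (1 - a) * q)\<^sup>2"
    by (simp add: step_gf_def step_weight_def numeral_3_eq_3 numeral_2_eq_2) (simp add: field_simps)
  finally show ?thesis .
qed

lemma independent_set: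
  obtains A where "A \<in> sets M" "a \<le> measure M A" "AE (x, y) in M \<Otimes>\<^sub>M M. x \<in> A \<longrightarrow> y \<in> A \<longrightarrow> U x y = 0"
proof (cases "a = 0")
  case True
  then show ?thesis by (intro that[of "{}"]) auto
next
  case False
  interpret V: sym_kernel M "\<lambda>x y. ennreal (1 - 1 * U x y)" by (rule sym_kernel_thinned)
  have "0 < a" using False a_ge_0 by simp
  have "ennreal (a ^ k) \<le> V.cliques k (\<lambda>_. 1)" for k
  proof -
    \<comment> \<open>The term j = 0 of the model, with every point in its independent class,
      already gives a^k.\<close>
    have "a ^ k = real (k choose 0) * step_weight a p q 1 (k - 0) 0" by (simp add: step_weight_def binomial_eq_0)
    also have "\<dots> \<le> step_gf a p q 1 k"
      unfolding step_gf_def by (rule member_le_sum) (auto intro!: mult_nonneg_nonneg step_weight_ge_0)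
    finally have "ennreal (a ^ k) \<le> edge_gf 1 k" by (simp add: gf ennreal_leI)
    then show ?thesis by (simp add: edge_gf_def)
  qed
  then obtain A where [measurable]: "A \<in> sets M" and A: "ennreal a \<le> emeasure M A"
    "AE x in M. AE y in M. x \<in> A \<longrightarrow> y \<in> A \<longrightarrow> ennreal (1 - 1 * U x y) = 1"
    using V.independent_set_exists[OF _ \<open>0 < a\<close>] by (auto simp: U_ge_0)
  have "AE x in M. AE y in M. x \<in> A \<longrightarrow> y \<in> A \<longrightarrow> U x y = 0"
    using A(2) by (simp add: ennreal_eq_1)
  then have "AE (x, y) in M \<Otimes>\<^sub>M M. x \<in> A \<longrightarrow> y \<in> A \<longrightarrow> U x y = 0"
    by (intro pair.AE_pair_measure) auto
  then show ?thesis using A(1) a_ge_0 by (intro that[of A]) (auto simp: emeasure_eq_measure)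
qed

end

section \<open>Degrees and codegrees relative to the independent set A\<close>

locale forced_kernel_A = forced_kernel +
  fixes A :: "'a set"
  assumes A_sets [measurable]: "A \<in> sets M" and A_measure: "measure M A = a"
    and U_A: "\<And>x y. x \<in> A \<Longrightarrow> y \<in> A \<Longrightarrow> U x y = 0"
begin

abbreviation B :: "'a set" where "B \<equiv> space M - A"

lemma B_sets [measurable]: "B \<in> sets M" by simp

lemma B_measure: "measure M B = 1 - a" using A_measure prob_compl[of A] by simp

abbreviation mix :: "real \<Rightarrow> nat \<Rightarrow> nat \<Rightarrow> ennreal" where
  "mix s m j \<equiv> sym_kernel.mixed M (\<lambda>x y. ennreal (1 - s * U x y)) A B m j (\<lambda>_. 1)"

lemma mix_sum:
  assumes "-1 \<le> s" "s \<le> 1"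
  shows "(\<Sum>j\<le>k. of_nat (k choose j) * mix s (k - j) j) =
    (\<Sum>j\<le>k. of_nat (k choose j) * ennreal (step_weight a p q s (k - j) j))"
proof -
  have "(\<Sum>j\<le>k. of_nat (k choose j) * mix s (k - j) j) = ennreal (step_gf a p q s k)"
    using cliques_split_thinned[OF A_sets U_A] gf[OF assms] by simp
  also have "\<dots> = (\<Sum>j\<le>k. ennreal (real (k choose j) * step_weight a p q s (k - j) j))"
    unfolding step_gf_def by (rule sum_ennreal[symmetric]) (use assms step_weight_ge_0 in auto)
  finally show ?thesis using step_weight_ge_0 assms by (simp add: ennreal_mult flip: ennreal_of_nat_eq_real_of_nat)
qed

lemma mix_tail:
  assumes "-1 \<le> s" "s \<le> 1" "J \<le> k" "\<And>m j. j < J \<Longrightarrow> mix s m j = ennreal (step_weight a p q s m j)"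
  shows "(\<Sum>j=J..k. of_nat (k choose j) * mix s (k - j) j) =
    (\<Sum>j=J..k. of_nat (k choose j) * ennreal (step_weight a p q s (k - j) j))"
  by (rule ennreal_sum_tail_le[OF mix_sum])
     (use assms in \<open>auto simp: ennreal_mult_less_top of_nat_less_top\<close>)

text \<open>For \<open>j \<ge> J\<close> the \<open>j\<close>-th term of the model is at most exponential in \<open>k\<close> with base \<open>a (1 - s p)\<^sup>J\<close>,
  since \<open>j (k - j) \<ge> J k - J j\<close> and \<open>(1 - s q)\<^bsup>j choose 2\<^esup>\<close> decays faster than any exponential in \<open>j\<close>.\<close>

lemma mix_growth:
  assumes s: "0 < s" "s < 1" and "0 < a" and lower: "\<And>m j. j < J \<Longrightarrow> mix s m j = ennreal (step_weight a p q s m j)"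
    and \<eta>: "0 < \<eta>"
  shows "\<exists>C. \<forall>m. mix s m J \<le> ennreal (C * ((1 + \<eta>) * (a * (1 - s * p) ^ J)) ^ m)"
proof -
  have sp: "0 < s * p" "s * p < 1" "0 < s * q" "s * q < 1"
    using s p_pos p_le_1 q_pos q_le_1 mult_strict_mono'[of s 1 p 1] mult_strict_mono[of s 1 q 1]
      mult_le_less_imp_less[of s 1 p 1]
    by (auto simp: mult_less_cancel_left1 intro: order_le_less_trans[OF mult_left_mono[of _ 1]])
  let ?g = "(1 + \<eta>) * (a * (1 - s * p) ^ J)"
  obtain C where C: "0 \<le> C" "\<And>k. (\<Sum>j=J..k. real (k choose j) * ((1 - a) ^ j * (1 - s * q) ^ (j choose 2) * (a * (1 - s * p) ^ j) ^ (k - j)))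
     \<le> C * ?g ^ k"
    using binomial_tail_le[of a "1 - a" "1 - s * q" "1 - s * p" \<eta> J] sp \<open>0 < a\<close> a_less_1 \<eta> by auto
  have "mix s m J \<le> ennreal (C * ?g ^ J * ?g ^ m)" for m
  proof -
    \<comment> \<open>With this k, \<open>mix s m J\<close> is the first term of the tail from J on;
      its binomial coefficient is at least 1 and may be dropped.\<close>
    let ?k = "m + J"
    have "1 \<le> ?k choose J" by (simp add: Suc_le_eq)
    then have "(1::ennreal) \<le> of_nat (?k choose J)" using of_nat_mono[of 1 "?k choose J"] by simp
    then have "mix s m J \<le> of_nat (?k choose J) * mix s (?k - J) J"
      using mult_right_mono[of 1 "of_nat (?k choose J)" "mix s m J"] by simp
    also have "\<dots> \<le> (\<Sum>j=J..?k. of_nat (?k choose j) * mix s (?k - j) j)"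
      by (rule member_le_sum) auto
    also have "\<dots> = (\<Sum>j=J..?k. of_nat (?k choose j) * ennreal (step_weight a p q s (?k - j) j))"
      using s by (intro mix_tail lower) auto
    also have "\<dots> = (\<Sum>j=J..?k. ennreal (real (?k choose j) * step_weight a p q s (?k - j) j))"
      using s step_weight_ge_0 by (simp add: ennreal_mult flip: ennreal_of_nat_eq_real_of_nat)
    also have "\<dots> = ennreal (\<Sum>j=J..?k. real (?k choose j) * step_weight a p q s (?k - j) j)"
      using s step_weight_ge_0 by (intro sum_ennreal) auto
    also have "\<dots> \<le> ennreal (C * ?g ^ ?k)"
      using C(2)[of ?k] unfolding step_weight_def by (rule ennreal_leI)
    finally show ?thesis by (simp add: power_add mult_ac)
  qed
  then show ?thesis by blast
qed

lemma mix_0: "mix s m 0 = ennreal (step_weight a p q s m 0)"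
proof -
  interpret V: sym_kernel M "\<lambda>x y. ennreal (1 - s * U x y)" by (rule sym_kernel_thinned)
  show ?thesis
    using a_ge_0 by (simp add: V.mixed_0 step_weight_def binomial_eq_0 emeasure_eq_measure A_measure ennreal_power)
qed

abbreviation link1 :: "real \<Rightarrow> 'a \<Rightarrow> ennreal" where
  "link1 s y \<equiv> \<integral>\<^sup>+z. ennreal (1 - s * U z y) * indicator A z \<partial>M"

abbreviation link2 :: "real \<Rightarrow> 'a \<Rightarrow> 'a \<Rightarrow> ennreal" where
  "link2 s y x \<equiv> \<integral>\<^sup>+z. ennreal (1 - s * U z y) * ennreal (1 - s * U z x) * indicator A z \<partial>M"

lemma mix_1: "mix s m (Suc 0) = (\<integral>\<^sup>+y. indicator B y * link1 s y ^ m \<partial>M)"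
proof -
  interpret V: sym_kernel M "\<lambda>x y. ennreal (1 - s * U x y)" by (rule sym_kernel_thinned)
  show ?thesis by (simp add: V.mixed_Suc V.mixed_0)
qed

lemma mix_2: "mix s m 2 =
  (\<integral>\<^sup>+y. \<integral>\<^sup>+x. indicator B y * indicator B x * ennreal (1 - s * U x y) *
    link2 s y x ^ m \<partial>M \<partial>M)"
proof -
  interpret V: sym_kernel M "\<lambda>x y. ennreal (1 - s * U x y)" by (rule sym_kernel_thinned)
  have "mix s m 2 = (\<integral>\<^sup>+y. indicator B y * (\<integral>\<^sup>+x. ennreal (1 - s * U x y) * indicator B x *
    link2 s y x ^ m \<partial>M) \<partial>M)"
    unfolding numeral_2_eq_2 by (subst V.mixed_Suc) (auto simp: V.mixed_Suc V.mixed_0 intro!: nn_integral_cong)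
  also have "\<dots> = (\<integral>\<^sup>+y. \<integral>\<^sup>+x. indicator B y * indicator B x * ennreal (1 - s * U x y) *
    link2 s y x ^ m \<partial>M \<partial>M)"
  proof (intro nn_integral_cong)
    fix y assume [measurable]: "y \<in> space M"
    show "indicator B y * (\<integral>\<^sup>+x. ennreal (1 - s * U x y) * indicator B x *
      link2 s y x ^ m \<partial>M) =
      (\<integral>\<^sup>+x. indicator B y * indicator B x * ennreal (1 - s * U x y) *
      link2 s y x ^ m \<partial>M)"
      by (subst nn_integral_cmult[symmetric]) (measurable, simp add: mult_ac)
  qed
  finally show ?thesis .
qed

lemma integrable_bounded:
  "f \<in> borel_measurable M \<Longrightarrow> (\<And>x. \<bar>f x\<bar> \<le> c) \<Longrightarrow> integrable M f" for f :: "'a \<Rightarrow> real"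
  by (rule integrable_const_bound[where B=c]) auto

lemma integrable_indicator_mult:
  assumes [measurable]: "S \<in> sets M" "f \<in> borel_measurable M" and "\<And>x. \<bar>f x\<bar> \<le> 1"
  shows "integrable M (\<lambda>z. indicator S z * f z :: real)"
  by (rule integrable_bounded[where c=1]) (use assms in \<open>auto simp: indicator_def\<close>)

lemma A_integral: "(\<integral>z. indicator A z \<partial>M) = a"
  by (simp add: A_measure)

lemma inner_1:
  assumes s: "0 \<le> s" "s \<le> 1" and [measurable]: "y \<in> space M"
  shows "link1 s y = ennreal (a - s * degree_on A y)"
proof -
  have sU: "s * U z y \<le> 1" for z using s U_le_1[of z y] U_ge_0[of z y] mult_mono[of s 1 "U z y" 1] by auto
  have i: "integrable M (\<lambda>z. indicator A z :: real)" "integrable M (\<lambda>z. indicator A z * U y z)"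
    using integrable_indicator_mult[of A "\<lambda>_. 1"] integrable_indicator_mult[of A "\<lambda>z. U y z"]
    by (auto simp: K_bound)
  have "link1 s y = (\<integral>\<^sup>+z. ennreal (indicator A z - s * (indicator A z * U y z)) \<partial>M)"
    by (intro nn_integral_cong) (auto simp: indicator_def U_sym)
  also have "\<dots> = ennreal (\<integral>z. indicator A z - s * (indicator A z * U y z) \<partial>M)"
    using i by (intro nn_integral_eq_integral) (auto intro!: AE_I2 simp: indicator_def sU U_sym[of y])
  also have "(\<integral>z. indicator A z - s * (indicator A z * U y z) \<partial>M) = a - s * degree_on A y"
    using i by (simp add: A_integral[simplified] degree_on_def)
  finally show ?thesis .
qed

definition codegree_A :: "'a \<Rightarrow> 'a \<Rightarrow> real" where
  "codegree_A x y = (\<integral>z. indicator A z * (U z x * U z y) \<partial>M)"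

lemma codegree_A_measurable [measurable (raw)]:
  assumes [measurable]: "f \<in> N \<rightarrow>\<^sub>M M" "g \<in> N \<rightarrow>\<^sub>M M"
  shows "(\<lambda>x. codegree_A (f x) (g x)) \<in> borel_measurable N"
  unfolding codegree_A_def by measurable

lemma inner_2:
  assumes s: "0 \<le> s" "s \<le> 1" and [measurable]: "x \<in> space M" "y \<in> space M"
  shows "link2 s y x =
     ennreal (a - s * degree_on A y - s * degree_on A x + s\<^sup>2 * codegree_A y x)"
proof -
  have sU: "s * U z y \<le> 1" for z y using s U_le_1[of z y] U_ge_0[of z y] mult_mono[of s 1 "U z y" 1] by auto
  have i: "integrable M (\<lambda>z. indicator A z :: real)" "integrable M (\<lambda>z. indicator A z * U y z)" "integrable M (\<lambda>z. indicator A z * U x z)"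
    "integrable M (\<lambda>z. indicator A z * (U z y * U z x))"
    using integrable_indicator_mult[of A "\<lambda>_. 1"] integrable_indicator_mult[of A "\<lambda>z. U y z"]
      integrable_indicator_mult[of A "\<lambda>z. U x z"] integrable_indicator_mult[of A "\<lambda>z. U z y * U z x"]
    by (auto simp: K_bound abs_mult_le_one)
  have "link2 s y x =
     (\<integral>\<^sup>+z. ennreal (indicator A z - s * (indicator A z * U y z) - s * (indicator A z * U x z) + s\<^sup>2 * (indicator A z * (U z y * U z x))) \<partial>M)"
    by (intro nn_integral_cong)
       (auto simp: indicator_def U_sym[of y] U_sym[of x] sU algebra_simps power2_eq_square simp flip: ennreal_mult)
  also have "\<dots> = ennreal (\<integral>z. indicator A z - s * (indicator A z * U y z) - s * (indicator A z * U x z) + s\<^sup>2 * (indicator A z * (U z y * U z x)) \<partial>M)"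
  proof (intro nn_integral_eq_integral AE_I2)
    fix z
    have "0 \<le> (1 - s * U z y) * (1 - s * U z x)" using sU by (intro mult_nonneg_nonneg) auto
    then show "0 \<le> indicator A z - s * (indicator A z * U y z) - s * (indicator A z * U x z) + s\<^sup>2 * (indicator A z * (U z y * U z x))"
      by (auto simp: indicator_def U_sym[of y] U_sym[of x] algebra_simps power2_eq_square)
  qed (use i in auto)
  also have "(\<integral>z. indicator A z - s * (indicator A z * U y z) - s * (indicator A z * U x z) + s\<^sup>2 * (indicator A z * (U z y * U z x)) \<partial>M) =
     a - s * degree_on A y - s * degree_on A x + s\<^sup>2 * codegree_A y x"
    using i by (simp add: A_integral[simplified] degree_on_def codegree_A_def)
  finally show ?thesis .
qed

lemma AE_null_A: "a = 0 \<Longrightarrow> AE z in M. z \<notin> A"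
  using A_measure by (intro AE_not_in) (auto simp: null_sets_def emeasure_eq_measure)

lemma half: "0 < (1/2::real)" "(1/2::real) < 1" "0 < 1 - 1/2 * p" "1 - 1/2 * p \<le> 1"
  using p_pos p_le_1 by auto

text \<open>By \<open>mix_growth\<close> with J = 1, the moments of \<open>link1 (1/2)\<close> over
  B grow at most with base a (1 - p/2), which therefore bounds \<open>link1 (1/2)\<close> almost
  everywhere on B. As this link equals a - degree/2, with the degree taken into A, the upper bound
  on it is a lower bound on the degree.\<close>

lemma AE_degree_on_A_ge: "AE y in M. y \<in> B \<longrightarrow> a * p \<le> degree_on A y"
proof (cases "a = 0")
  case True
  then show ?thesis using degree_on_bounds by auto
next
  case False
  then have a: "0 < a" using a_ge_0 by simp
  have "AE y in M. indicator B y \<noteq> (0::ennreal) \<longrightarrow>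
    link1 (1/2) y \<le> ennreal (a * (1 - 1/2 * p) ^ Suc 0)"
  proof (rule AE_le_of_power_growth)
    show "0 < a * (1 - 1/2 * p) ^ Suc 0" using a half by simp
    fix \<eta> :: real assume "0 < \<eta>"
    then show "\<exists>C. \<forall>m. (\<integral>\<^sup>+y. indicator B y * link1 (1/2) y ^ m \<partial>M)
      \<le> ennreal (C * ((1 + \<eta>) * (a * (1 - 1/2 * p) ^ Suc 0)) ^ m)"
      using mix_growth[OF half(1,2) a _ \<open>0 < \<eta>\<close>, of "Suc 0"] mix_0[of "1/2"] mix_1[of "1/2"] by simp
  qed measurable
  then show ?thesis
  proof (rule AE_mp, intro AE_I2 impI)
    fix y assume y: "y \<in> space M" "y \<in> B" and
      le: "indicator B y \<noteq> (0::ennreal) \<longrightarrow> link1 (1/2) y \<le> ennreal (a * (1 - 1/2 * p) ^ Suc 0)"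
    then have "ennreal (a - 1/2 * degree_on A y) \<le> ennreal (a * (1 - 1/2 * p) ^ Suc 0)"
      using inner_1[of "1/2" y] by (simp add: indicator_def)
    then have "a - 1/2 * degree_on A y \<le> a * (1 - 1/2 * p)"
      using a half by (subst (asm) ennreal_le_iff) auto
    then show "a * p \<le> degree_on A y" by (simp add: algebra_simps)
  qed
qed

lemma degree_on_A_zero: "y \<in> A \<Longrightarrow> degree_on A y = 0"
  unfolding degree_on_def by (rule integral_eq_zero_AE) (auto simp: indicator_def U_A)

text \<open>Double counting of the pairs between A and B, as U vanishes inside A.\<close>

lemma integral_A_degree: "(\<integral>x. indicator A x * degree x \<partial>M) = (\<integral>y. indicator B y * degree_on A y \<partial>M)"
proof -
  interpret F: prob_space "M \<Otimes>\<^sub>M M" by (intro prob_space_pair prob_space_axioms)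
  have i: "integrable (M \<Otimes>\<^sub>M M) (\<lambda>(x, y). indicator A x * U x y)"
    by (rule F.integrable_const_bound[where B=1]) (auto simp: indicator_def U_ge_0 U_le_1 intro!: AE_I2)
  have "(\<integral>x. indicator A x * degree x \<partial>M) = (\<integral>x. \<integral>y. indicator A x * U x y \<partial>M \<partial>M)"
    by (simp add: degree_on_def)
  also have "\<dots> = (\<integral>y. \<integral>x. indicator A x * U x y \<partial>M \<partial>M)"
    by (rule pair.Fubini_integral[symmetric, OF i])
  also have "\<dots> = (\<integral>y. indicator B y * degree_on A y \<partial>M)"
  proof (intro Bochner_Integration.integral_cong refl)
    fix y assume y: "y \<in> space M"
    have "(\<integral>x. indicator A x * U x y \<partial>M) = degree_on A y"
      unfolding degree_on_def by (simp add: U_sym)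
    then show "(\<integral>x. indicator A x * U x y \<partial>M) = indicator B y * degree_on A y"
      using y degree_on_A_zero[of y] by (auto simp: indicator_def)
  qed
  finally show ?thesis .
qed

lemma integrable_degree_on:
  "S \<in> sets M \<Longrightarrow> integrable M (\<lambda>x. indicator S x * degree x :: real)"
  "S \<in> sets M \<Longrightarrow> integrable M (\<lambda>x. indicator S x * degree_on A x :: real)"
  "integrable M degree" "integrable M (\<lambda>x. (degree x)\<^sup>2)" "S \<in> sets M \<Longrightarrow> integrable M (\<lambda>x. indicator S x :: real)"
proof -
  show "S \<in> sets M \<Longrightarrow> integrable M (\<lambda>x. indicator S x * degree x :: real)"
    using degree_on_bounds by (intro integrable_indicator_mult) auto
  show "S \<in> sets M \<Longrightarrow> integrable M (\<lambda>x. indicator S x * degree_on A x :: real)"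
    using degree_on_bounds by (intro integrable_indicator_mult) auto
  show "integrable M degree"
    using degree_on_bounds by (intro integrable_bounded[where c=1]) auto
  show "integrable M (\<lambda>x. (degree x)\<^sup>2)"
    unfolding power2_eq_square using degree_on_bounds by (intro integrable_bounded[where c=1] abs_mult_le_one) auto
  show "S \<in> sets M \<Longrightarrow> integrable M (\<lambda>x. indicator S x :: real)"
    using integrable_indicator_mult[of S "\<lambda>_. 1"] by simp
qed

text \<open>The hypothesis \<open>\<beta> \<le> \<alpha>\<close> enters here: the sum of the squared deviations from the prescribed degrees
  is \<open>2 (\<alpha> - \<beta>) (a \<alpha> - \<integral>\<^sub>A degree)\<close>, which is not positive.\<close>

lemma AE_degree:
  "AE x in M. (x \<in> A \<longrightarrow> degree x = (1 - a) * p) \<and> (x \<in> B \<longrightarrow> degree x = a * p + (1 - a) * q \<and> degree_on A x = a * p)"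
proof -
  define \<alpha> where "\<alpha> = (1 - a) * p"
  define \<beta> where "\<beta> = a * p + (1 - a) * q"
  note i = integrable_degree_on
  note iA = i(1)[OF A_sets] i(2)[OF A_sets] i(5)[OF A_sets]
  note iB = i(1)[OF B_sets] i(2)[OF B_sets] i(5)[OF B_sets]
  have gap: "\<beta> \<le> \<alpha>" using degree_gap by (simp add: \<alpha>_def \<beta>_def algebra_simps)
  let ?IA = "\<integral>x. indicator A x * degree x \<partial>M"
  have IB: "(\<integral>x. indicator B x * (a * p) \<partial>M) = a * \<alpha>"
    using B_measure by (simp add: \<alpha>_def)
  have IA_ge: "a * \<alpha> \<le> ?IA"
    unfolding IB[symmetric] integral_A_degree
  proof (rule integral_mono_AE)
    show "AE x in M. indicator B x * (a * p) \<le> indicator B x * degree_on A x"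
      using AE_degree_on_A_ge by (rule AE_mp) (auto intro!: AE_I2 simp: indicator_def)
  qed (use iB in auto)
  let ?Z = "\<lambda>x. indicator A x * (degree x - \<alpha>)\<^sup>2 + indicator B x * (degree x - \<beta>)\<^sup>2"
  have Z_eq: "?Z x = (degree x)\<^sup>2 - 2 * \<alpha> * (indicator A x * degree x) - 2 * \<beta> * (degree x - indicator A x * degree x) +
      \<alpha>\<^sup>2 * indicator A x + \<beta>\<^sup>2 * indicator B x" if "x \<in> space M" for x
    using that by (cases "x \<in> A") (auto simp: power2_eq_square algebra_simps)
  have iZ: "integrable M ?Z"
    by (subst Bochner_Integration.integrable_cong[OF refl Z_eq]) (use i in auto)
  have "(\<integral>x. ?Z x \<partial>M) = (\<integral>x. (degree x)\<^sup>2 \<partial>M) - 2 * \<alpha> * ?IA - 2 * \<beta> * ((\<integral>x. degree x \<partial>M) - ?IA) + \<alpha>\<^sup>2 * a + \<beta>\<^sup>2 * (1 - a)"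
    by (subst Bochner_Integration.integral_cong[OF refl Z_eq]) (use i A_measure B_measure in auto)
  also have "\<dots> = 2 * (\<alpha> - \<beta>) * (a * \<alpha> - ?IA)"
    unfolding integral_degree integral_degree_squared \<alpha>_def[symmetric] \<beta>_def[symmetric]
    by (simp add: power2_eq_square algebra_simps)
  finally have Z: "(\<integral>x. ?Z x \<partial>M) = 2 * (\<alpha> - \<beta>) * (a * \<alpha> - ?IA)" .
  have "(\<integral>x. ?Z x \<partial>M) \<le> 0" unfolding Z using gap IA_ge by (intro mult_nonneg_nonpos) auto
  moreover have "0 \<le> (\<integral>x. ?Z x \<partial>M)" by (intro integral_nonneg_AE AE_I2) auto
  ultimately have "AE x in M. ?Z x = 0"
    using integral_nonneg_eq_0_iff_AE[OF iZ] by auto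
  then have deg: "AE x in M. (x \<in> A \<longrightarrow> degree x = \<alpha>) \<and> (x \<in> B \<longrightarrow> degree x = \<beta>)"
    by (rule AE_mp) (auto intro!: AE_I2 simp: indicator_def)
  \<comment> \<open>The integral is recomputed from the degrees just found, because the formula for
    the deviations says nothing about \<open>?IA\<close> when \<alpha> = \<beta>.\<close>
  have "?IA = (\<integral>x. indicator A x * \<alpha> \<partial>M)"
    by (rule integral_cong_AE) (use deg iA in \<open>auto elim!: AE_mp intro!: AE_I2 simp: indicator_def\<close>)
  also have "\<dots> = a * \<alpha>" using A_measure by simp
  finally have IA: "?IA = a * \<alpha>" .
  \<comment> \<open>The surplus of the degrees into A over their lower bound is nonnegative and, by
    the value of \<open>?IA\<close>, has integral 0.\<close>
  let ?D = "\<lambda>x. indicator B x * degree_on A x - indicator B x * (a * p)"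
  have D0: "AE x in M. 0 \<le> ?D x"
    using AE_degree_on_A_ge by (rule AE_mp) (auto intro!: AE_I2 simp: indicator_def)
  have iD: "integrable M ?D" using iB by auto
  have "(\<integral>x. ?D x \<partial>M) = (\<integral>x. indicator B x * degree_on A x \<partial>M) - (\<integral>x. indicator B x * (a * p) \<partial>M)"
    using iB by (intro Bochner_Integration.integral_diff) auto
  also have "\<dots> = 0" using IA IB integral_A_degree by linarith
  finally have "(\<integral>x. ?D x \<partial>M) = 0" .
  then have "AE x in M. ?D x = 0"
    using integral_nonneg_eq_0_iff_AE[OF iD D0] by simp
  with deg show ?thesis
    unfolding \<alpha>_def[symmetric] \<beta>_def[symmetric]
    by (elim AE_mp, intro AE_I2 impI) (auto simp: indicator_def)
qed

lemma AE_degree_on_A: "AE x in M. x \<in> B \<longrightarrow> degree_on A x = a * p"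
  using AE_degree by (rule AE_mp) (auto intro!: AE_I2)

lemma mix_1_eq:
  assumes "0 \<le> s" "s \<le> 1"
  shows "mix s m (Suc 0) = ennreal (step_weight a p q s m (Suc 0))"
proof -
  have sp: "s * p \<le> 1" using assms p_pos p_le_1 mult_mono[of s 1 p 1] by auto
  have "mix s m (Suc 0) = (\<integral>\<^sup>+y. indicator B y * ennreal (a * (1 - s * p)) ^ m \<partial>M)"
    unfolding mix_1
  proof (rule nn_integral_cong_AE)
    show "AE y in M. indicator B y * link1 s y ^ m =
        indicator B y * ennreal (a * (1 - s * p)) ^ m"
      using AE_degree_on_A
    proof (rule AE_mp, intro AE_I2 impI)
      fix y assume "y \<in> space M" "y \<in> B \<longrightarrow> degree_on A y = a * p"
      then show "indicator B y * link1 s y ^ m =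
        indicator B y * ennreal (a * (1 - s * p)) ^ m"
        using inner_1[OF assms, of y] by (cases "y \<in> B") (auto simp: algebra_simps)
    qed
  qed
  also have "\<dots> = ennreal (1 - a) * ennreal (a * (1 - s * p)) ^ m"
    by (subst nn_integral_multc) (auto simp: emeasure_eq_measure B_measure)
  finally show ?thesis
    using a_ge_0 a_less_1 sp by (simp add: step_weight_def ennreal_power binomial_eq_0 flip: ennreal_mult)
qed

text \<open>The growth comparison with J = 2, available since the terms j = 0 and j = 1 are now
  exact, gives \<open>link2 (1/2)\<close> <= a (1 - p/2)^2 for almost all pairs in B. The degrees
  into A equal a p, so the left side is a - a p + codegree/4 and the right side a - a p + a
  p^2/4.\<close>

lemma AE_codegree_A_le: "AE y in M. AE x in M. y \<in> B \<longrightarrow> x \<in> B \<longrightarrow> codegree_A y x \<le> a * p\<^sup>2"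
proof (cases "a = 0")
  case True
  have "codegree_A y x = 0" for y x
    unfolding codegree_A_def
    by (rule integral_eq_zero_AE, rule AE_mp[OF AE_null_A[OF True]]) (auto intro!: AE_I2)
  then show ?thesis using True by simp
next
  case False
  then have a: "0 < a" using a_ge_0 by simp
  let ?w = "\<lambda>(y, x). indicator B y * indicator B x * ennreal (1 - 1/2 * U x y)"
  let ?h = "\<lambda>(y, x). link2 (1/2) y x"
  let ?\<beta> = "a * (1 - 1/2 * p) ^ 2"
  have "AE p in M \<Otimes>\<^sub>M M. ?w p \<noteq> 0 \<longrightarrow> ?h p \<le> ennreal ?\<beta>"
  proof (rule AE_le_of_power_growth)
    show "0 < ?\<beta>" using a half by simp
    fix \<eta> :: real assume "0 < \<eta>"
    have "(\<integral>\<^sup>+p. ?w p * ?h p ^ m \<partial>(M \<Otimes>\<^sub>M M)) = mix (1/2) m 2" for m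
      unfolding mix_2 by (subst nn_integral_fst[symmetric]) auto
    moreover have "mix (1/2) m j = ennreal (step_weight a p q (1/2) m j)" if "j < 2" for m j
    proof -
      from that have "j = 0 \<or> j = Suc 0" by auto
      then show ?thesis using mix_0[of "1/2" m] mix_1_eq[of "1/2" m] by auto
    qed
    ultimately show "\<exists>C. \<forall>m. (\<integral>\<^sup>+p. ?w p * ?h p ^ m \<partial>(M \<Otimes>\<^sub>M M)) \<le> ennreal (C * ((1 + \<eta>) * ?\<beta>) ^ m)"
      using mix_growth[OF half(1,2) a _ \<open>0 < \<eta>\<close>, of 2] by simp
  qed measurable
  then have h: "AE y in M. AE x in M. ?w (y, x) \<noteq> 0 \<longrightarrow> ?h (y, x) \<le> ennreal ?\<beta>"
    by (rule pair.AE_pair)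
  show ?thesis
  proof (rule AE_mp[OF AE_degree_on_A AE_mp[OF h]], rule AE_I2, intro impI)
    fix y assume y: "y \<in> space M" "y \<in> B \<longrightarrow> degree_on A y = a * p"
      and "AE x in M. ?w (y, x) \<noteq> 0 \<longrightarrow> ?h (y, x) \<le> ennreal ?\<beta>"
    from this(3) AE_degree_on_A show "AE x in M. y \<in> B \<longrightarrow> x \<in> B \<longrightarrow> codegree_A y x \<le> a * p\<^sup>2"
    proof (elim AE_mp, intro AE_I2 impI)
      fix x assume x: "x \<in> space M" "x \<in> B \<longrightarrow> degree_on A x = a * p" "x \<in> B" "y \<in> B"
        and le: "?w (y, x) \<noteq> 0 \<longrightarrow> ?h (y, x) \<le> ennreal ?\<beta>"
      \<comment> \<open>At s = 1/2 no pair in B has weight 0, so the bound reaches every one of them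
        up to a null set.\<close>
      have "0 < 1 - 1/2 * U x y" using U_le_1[of x y] by simp
      then have "ennreal (a - 1/2 * degree_on A y - 1/2 * degree_on A x + (1/2)\<^sup>2 * codegree_A y x) \<le> ennreal ?\<beta>"
        using le x y inner_2[of "1/2" x y] by (simp add: ennreal_eq_0_iff)
      then have "a - 1/2 * degree_on A y - 1/2 * degree_on A x + (1/2)\<^sup>2 * codegree_A y x \<le> ?\<beta>"
        using a half by (subst (asm) ennreal_le_iff) auto
      then show "codegree_A y x \<le> a * p\<^sup>2"
        using x y by (simp add: power2_eq_square algebra_simps)
    qed
  qed
qed

lemma degree_on_B: "x \<in> space M \<Longrightarrow> degree_on B x = degree x - degree_on A x"
proof -
  assume [measurable]: "x \<in> space M"
  have "degree x - degree_on A x = (\<integral>y. indicator UNIV y * U x y - indicator A y * U x y \<partial>M)"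
    unfolding degree_on_def
    using integrable_indicator_mult[of "space M" "U x"] integrable_indicator_mult[of A "U x"]
    by (subst Bochner_Integration.integral_diff) (auto simp: K_bound intro!: integrable_bounded[where c=1])
  also have "\<dots> = degree_on B x"
    unfolding degree_on_def by (intro Bochner_Integration.integral_cong) (auto simp: indicator_def)
  finally show ?thesis by simp
qed

text \<open>When z in A is integrated outermost, it contributes the square of its degree into B;
  this is its whole degree (1 - a) p, as U vanishes inside A.\<close>

lemma integral_codegree_A:
  "(\<integral>y. \<integral>x. indicator B y * indicator B x * codegree_A y x \<partial>M \<partial>M) = a * ((1 - a) * p)\<^sup>2"
proof -
  interpret F: prob_space "M \<Otimes>\<^sub>M M" by (intro prob_space_pair prob_space_axioms)
  have "(\<integral>y. \<integral>x. indicator B y * indicator B x * codegree_A y x \<partial>M \<partial>M) =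
     (\<integral>y. \<integral>z. indicator B y * (indicator A z * (U z y * degree_on B z)) \<partial>M \<partial>M)"
  proof (rule Bochner_Integration.integral_cong[OF refl])
    fix y assume [measurable]: "y \<in> space M"
    let ?f = "\<lambda>x z. indicator B y * (indicator B x * (indicator A z * (U z y * U z x)))"
    have "integrable (M \<Otimes>\<^sub>M M) (\<lambda>(x, z). ?f x z)"
      by (rule F.integrable_const_bound[where B=1])
         (auto simp: indicator_def intro!: AE_I2 abs_mult_le_one K_bound)
    then have "(\<integral>x. \<integral>z. ?f x z \<partial>M \<partial>M) = (\<integral>z. \<integral>x. ?f x z \<partial>M \<partial>M)"
      by (rule pair.Fubini_integral[symmetric])
    moreover have "(\<integral>x. \<integral>z. ?f x z \<partial>M \<partial>M) = (\<integral>x. indicator B y * indicator B x * codegree_A y x \<partial>M)"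
      unfolding codegree_A_def by (simp add: mult.assoc)
    moreover have "(\<integral>z. \<integral>x. ?f x z \<partial>M \<partial>M) = (\<integral>z. indicator B y * (indicator A z * (U z y * degree_on B z)) \<partial>M)"
    proof (intro Bochner_Integration.integral_cong refl)
      fix z
      have "(\<integral>x. ?f x z \<partial>M) = (\<integral>x. (indicator B y * (indicator A z * U z y)) * (indicator B x * U z x) \<partial>M)"
        by (intro Bochner_Integration.integral_cong refl) (simp add: mult_ac)
      then show "(\<integral>x. ?f x z \<partial>M) = indicator B y * (indicator A z * (U z y * degree_on B z))"
        by (simp add: degree_on_def mult.assoc)
    qed
    ultimately show "(\<integral>x. indicator B y * indicator B x * codegree_A y x \<partial>M) =
       (\<integral>z. indicator B y * (indicator A z * (U z y * degree_on B z)) \<partial>M)" by metis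
  qed
  also have "\<dots> = (\<integral>z. \<integral>y. indicator B y * (indicator A z * (U z y * degree_on B z)) \<partial>M \<partial>M)"
  proof (rule pair.Fubini_integral[symmetric])
    show "integrable (M \<Otimes>\<^sub>M M) (\<lambda>(y, z). indicator B y * (indicator A z * (U z y * degree_on B z)))"
      using degree_on_bounds
      by (intro F.integrable_const_bound[where B=1])
         (auto simp: indicator_def intro!: AE_I2 abs_mult_le_one K_bound)
  qed
  also have "\<dots> = (\<integral>z. indicator A z * ((1 - a) * p)\<^sup>2 \<partial>M)"
  proof (rule integral_cong_AE)
    show "AE z in M. (\<integral>y. indicator B y * (indicator A z * (U z y * degree_on B z)) \<partial>M) = indicator A z * ((1 - a) * p)\<^sup>2"
      using AE_degree
    proof (rule AE_mp, intro AE_I2 impI)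
      fix z assume z: "z \<in> space M" and deg: "(z \<in> A \<longrightarrow> degree z = (1 - a) * p) \<and> (z \<in> B \<longrightarrow> degree z = a * p + (1 - a) * q \<and> degree_on A z = a * p)"
      have "(\<integral>y. indicator B y * (indicator A z * (U z y * degree_on B z)) \<partial>M) =
         (\<integral>y. (indicator A z * degree_on B z) * (indicator B y * U z y) \<partial>M)"
        by (intro Bochner_Integration.integral_cong) auto
      also have "\<dots> = indicator A z * (degree_on B z)\<^sup>2"
        by (simp add: degree_on_def power2_eq_square)
      finally show "(\<integral>y. indicator B y * (indicator A z * (U z y * degree_on B z)) \<partial>M) = indicator A z * ((1 - a) * p)\<^sup>2"
        using deg degree_on_B[OF z] degree_on_A_zero[of z] by (auto simp: indicator_def)
    qed
  qed measurable
  also have "\<dots> = a * ((1 - a) * p)\<^sup>2" using A_measure by simp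
  finally show ?thesis .
qed

text \<open>The average of the codegree over B x B is exactly the upper bound a p^2, so the
  nonnegative gap has integral 0.\<close>

lemma AE_codegree_A: "AE (y, x) in M \<Otimes>\<^sub>M M. y \<in> B \<longrightarrow> x \<in> B \<longrightarrow> codegree_A y x = a * p\<^sup>2"
proof -
  interpret F: prob_space "M \<Otimes>\<^sub>M M" by (intro prob_space_pair prob_space_axioms)
  define f1 where "f1 = (\<lambda>(y, x). indicator B y * indicator B x :: real)"
  define f2 where "f2 = (\<lambda>(y, x). indicator B y * indicator B x * codegree_A y x)"
  let ?D = "\<lambda>r. a * p\<^sup>2 * f1 r - f2 r"
  have cod: "\<bar>codegree_A y x\<bar> \<le> 1" for y x
  proof -
    have "\<bar>codegree_A y x\<bar> \<le> (\<integral>z. 1 \<partial>M)"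
      unfolding codegree_A_def
      by (rule order_trans[OF integral_abs_bound integral_mono'])
         (auto simp: indicator_def intro!: abs_mult_le_one K_bound)
    then show ?thesis by (simp add: prob_space)
  qed
  have i1: "integrable (M \<Otimes>\<^sub>M M) f1"
    unfolding f1_def by (rule F.integrable_const_bound[where B=1]) (auto simp: indicator_def intro!: AE_I2)
  have i2: "integrable (M \<Otimes>\<^sub>M M) f2"
    unfolding f2_def by (rule F.integrable_const_bound[where B=1]) (auto simp: indicator_def cod intro!: AE_I2)
  have iD: "integrable (M \<Otimes>\<^sub>M M) ?D"
    using i1 i2 by simp
  have D0: "AE r in M \<Otimes>\<^sub>M M. 0 \<le> ?D r"
  proof -
    have "AE (y, x) in M \<Otimes>\<^sub>M M. y \<in> B \<longrightarrow> x \<in> B \<longrightarrow> codegree_A y x \<le> a * p\<^sup>2"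
      using AE_codegree_A_le by (intro pair.AE_pair_measure) auto
    then show ?thesis by (rule AE_mp) (auto intro!: AE_I2 simp: indicator_def f1_def f2_def space_pair_measure)
  qed
  have "(\<integral>r. ?D r \<partial>(M \<Otimes>\<^sub>M M)) = a * p\<^sup>2 * (\<integral>r. f1 r \<partial>(M \<Otimes>\<^sub>M M)) - (\<integral>r. f2 r \<partial>(M \<Otimes>\<^sub>M M))"
    using i1 i2 by simp
  also have "(\<integral>r. f1 r \<partial>(M \<Otimes>\<^sub>M M)) = (1 - a) * (1 - a)"
    using pair.integral_fst'[OF i1] B_measure by (simp add: f1_def)
  also have "(\<integral>r. f2 r \<partial>(M \<Otimes>\<^sub>M M)) = a * ((1 - a) * p)\<^sup>2"
    using pair.integral_fst'[OF i2] integral_codegree_A by (simp add: f2_def)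
  finally have "(\<integral>r. ?D r \<partial>(M \<Otimes>\<^sub>M M)) = 0" by (simp add: power2_eq_square)
  then have "AE r in M \<Otimes>\<^sub>M M. ?D r = 0"
    using integral_nonneg_eq_0_iff_AE[OF iD D0] by simp
  then show ?thesis by (rule AE_mp) (auto intro!: AE_I2 simp: indicator_def f1_def f2_def space_pair_measure)
qed

text \<open>On B x B the Gram kernel of U - p over A is codegree - p (sum of the two degrees into A)
  + a p^2 = a p^2 - 2 a p^2 + a p^2 = 0.\<close>

lemma AE_U_eq_p: "AE (x, y) in M \<Otimes>\<^sub>M M. x \<in> A \<longrightarrow> y \<in> B \<longrightarrow> U x y = p"
proof -
  define K where "K x y = indicator A x * indicator B y * (U x y - p)" for x y
  have "AE (x, y) in M \<Otimes>\<^sub>M M. K x y = 0"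
  proof (rule AE_zero_of_gram_zero[where C=1])
    show "finite_measure M" "finite_measure M" by (rule finite_measure_axioms)+
    show "case_prod K \<in> borel_measurable (M \<Otimes>\<^sub>M M)" unfolding K_def by measurable
    show "\<bar>K x y\<bar> \<le> 1" for x y
      using p_pos p_le_1 U_ge_0[of x y] U_le_1[of x y] by (auto simp: K_def indicator_def)
    have gram: "(\<integral>x. K x y * K x z \<partial>M) =
        indicator B y * indicator B z * (codegree_A y z - p * degree_on A y - p * degree_on A z + a * p\<^sup>2)"
      if [measurable]: "y \<in> space M" "z \<in> space M" for y z
    proof -
      have i: "integrable M (\<lambda>x. indicator A x :: real)" "integrable M (\<lambda>x. indicator A x * U y x)" "integrable M (\<lambda>x. indicator A x * U z x)"
        "integrable M (\<lambda>x. indicator A x * (U x y * U x z))"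
        using integrable_indicator_mult[of A "\<lambda>_. 1"] integrable_indicator_mult[of A "\<lambda>x. U y x"]
          integrable_indicator_mult[of A "\<lambda>x. U z x"] integrable_indicator_mult[of A "\<lambda>x. U x y * U x z"]
        by (auto simp: K_bound abs_mult_le_one)
      have "(\<integral>x. K x y * K x z \<partial>M) = (\<integral>x. indicator B y * indicator B z * (indicator A x * (U x y * U x z) -
         p * (indicator A x * U y x) - p * (indicator A x * U z x) + p\<^sup>2 * indicator A x) \<partial>M)"
        by (intro Bochner_Integration.integral_cong refl)
           (auto simp: K_def indicator_def U_sym[of y] U_sym[of z] algebra_simps power2_eq_square)
      also have "\<dots> = indicator B y * indicator B z * (codegree_A y z - p * degree_on A y - p * degree_on A z + a * p\<^sup>2)"
        using i by (simp add: codegree_A_def degree_on_def A_integral[simplified])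
      finally show ?thesis .
    qed
    have h: "AE y in M. AE z in M. y \<in> B \<longrightarrow> z \<in> B \<longrightarrow> codegree_A y z = a * p\<^sup>2"
      using pair.AE_pair[OF AE_codegree_A] by simp
    have "AE y in M. AE z in M. (\<integral>x. K x y * K x z \<partial>M) = 0"
    proof (rule AE_mp[OF AE_degree_on_A AE_mp[OF h]], rule AE_I2, intro impI)
      fix y assume y: "y \<in> space M" "y \<in> B \<longrightarrow> degree_on A y = a * p"
        and "AE z in M. y \<in> B \<longrightarrow> z \<in> B \<longrightarrow> codegree_A y z = a * p\<^sup>2"
      from this(3) AE_degree_on_A show "AE z in M. (\<integral>x. K x y * K x z \<partial>M) = 0"
      proof (elim AE_mp, intro AE_I2 impI)
        fix z assume "z \<in> space M" "y \<in> B \<longrightarrow> z \<in> B \<longrightarrow> codegree_A y z = a * p\<^sup>2" "z \<in> B \<longrightarrow> degree_on A z = a * p"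
        then show "(\<integral>x. K x y * K x z \<partial>M) = 0"
          using y gram[of y z] by (auto simp: indicator_def power2_eq_square algebra_simps)
      qed
    qed
    moreover have "(\<lambda>(y, z). \<integral>x. K x y * K x z \<partial>M) \<in> borel_measurable (M \<Otimes>\<^sub>M M)"
      unfolding K_def by measurable
    then have "{p \<in> space (M \<Otimes>\<^sub>M M). case p of (y, z) \<Rightarrow> (\<integral>x. K x y * K x z \<partial>M) = 0} \<in> sets (M \<Otimes>\<^sub>M M)"
      by (simp add: case_prod_beta)
    ultimately show "AE (y, z) in M \<Otimes>\<^sub>M M. (\<integral>x. K x y * K x z \<partial>M) = 0"
      by (intro pair.AE_pair_measure) (auto simp: case_prod_beta)
  qed
  then show ?thesis by (rule AE_mp) (auto intro!: AE_I2 simp: K_def indicator_def)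
qed

end

section \<open>The restriction of the kernel to B\<close>

text \<open>Conditioning on B makes the restriction a kernel on a probability space, where
  \<open>AE_const_of_edge_gf_4\<close> applies; each of the k points costs one normalising
  factor.\<close>

lemma (in sym_kernel) cliques_uniform_measure:
  assumes [measurable]: "B \<in> sets M" and B: "emeasure M B \<noteq> 0" and f: "f \<in> borel_measurable M"
  shows "sym_kernel.cliques (uniform_measure M B) V k f * emeasure M B ^ k = cliques k (\<lambda>x. f x * indicator B x)"
proof -
  let ?N = "uniform_measure M B"
  interpret N: prob_space ?N by (rule prob_space_uniform_measure) (use B in auto)
  interpret VN: sym_kernel ?N V
  proof
    have "sets (?N \<Otimes>\<^sub>M ?N) = sets (M \<Otimes>\<^sub>M M)" by (rule sets_pair_measure_cong) simp_all
    then show "case_prod V \<in> borel_measurable (?N \<Otimes>\<^sub>M ?N)"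
      using V_measurable by (simp cong: measurable_cong_sets)
  qed (rule V_sym)
  show ?thesis
    using f
  proof (induction k arbitrary: f)
    case (Suc k)
    note [measurable] = Suc.prems
    have [measurable]: "f \<in> borel_measurable ?N" by simp
    note m = VN.cliques_step_measurable[OF this]
    then have [measurable]: "(\<lambda>y. VN.cliques k (\<lambda>x. f x * V x y)) \<in> borel_measurable M" by simp
    have fin: "emeasure M B \<noteq> \<top>" by simp
    have "VN.cliques (Suc k) f = (\<integral>\<^sup>+y. f y * VN.cliques k (\<lambda>x. f x * V x y) * indicator B y \<partial>M) / emeasure M B"
      by (subst VN.cliques_Suc) (auto simp: nn_integral_uniform_measure)
    then have "VN.cliques (Suc k) f * emeasure M B ^ Suc k =
       (\<integral>\<^sup>+y. f y * VN.cliques k (\<lambda>x. f x * V x y) * indicator B y \<partial>M) * emeasure M B ^ k"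
      using B fin by (simp add: ennreal_divide_times mult.assoc[symmetric] ennreal_times_divide mult_divide_eq_ennreal)
    also have "\<dots> = (\<integral>\<^sup>+y. f y * indicator B y * (VN.cliques k (\<lambda>x. f x * V x y) * emeasure M B ^ k) \<partial>M)"
      by (subst nn_integral_multc[symmetric]) (auto intro!: nn_integral_cong simp: mult_ac)
    also have "\<dots> = (\<integral>\<^sup>+y. f y * indicator B y * cliques k (\<lambda>x. f x * indicator B x * V x y) \<partial>M)"
    proof (rule nn_integral_cong)
      fix y assume [measurable]: "y \<in> space M"
      have "VN.cliques k (\<lambda>x. f x * V x y) * emeasure M B ^ k = cliques k (\<lambda>x. f x * V x y * indicator B x)"
        by (rule Suc.IH) measurable
      then show "f y * indicator B y * (VN.cliques k (\<lambda>x. f x * V x y) * emeasure M B ^ k) =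
         f y * indicator B y * cliques k (\<lambda>x. f x * indicator B x * V x y)"
        by (simp add: mult_ac)
    qed
    also have "\<dots> = cliques (Suc k) (\<lambda>x. f x * indicator B x)"
      by (subst cliques_Suc) auto
    finally show ?case .
  qed simp
qed

locale forced_kernel_AB = forced_kernel_A +
  assumes U_AB: "\<And>x y. x \<in> A \<Longrightarrow> y \<in> B \<Longrightarrow> U x y = p"
begin

lemma sp_le_1: "0 \<le> s \<Longrightarrow> s \<le> 1 \<Longrightarrow> s * p \<le> 1" for s
  using p_pos p_le_1 mult_mono[of s 1 p 1] by auto

lemma sq_le_1: "0 \<le> s \<Longrightarrow> s \<le> 1 \<Longrightarrow> s * q \<le> 1" for s
  using q_pos q_le_1 mult_mono[of s 1 q 1] by auto

lemma U_BA: "x \<in> B \<Longrightarrow> y \<in> A \<Longrightarrow> U x y = p"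
  using U_AB[of y x] U_sym[of x y] by simp

lemma mix_factor:
  assumes "0 \<le> s" "s \<le> 1"
  shows "mix s m j = ennreal ((a * (1 - s * p) ^ j) ^ m) * mix s 0 j"
proof -
  interpret V: sym_kernel M "\<lambda>x y. ennreal (1 - s * U x y)" by (rule sym_kernel_thinned)
  have "mix s m j = (1 * emeasure M A * ennreal (1 - s * p) ^ j) ^ m * mix s 0 j"
    by (rule V.mixed_const_between) (auto simp: U_BA[simplified])
  then show ?thesis
    using a_ge_0 sp_le_1[OF assms]
    by (simp add: emeasure_eq_measure A_measure ennreal_power flip: ennreal_mult)
qed

text \<open>Strong induction on k: \<open>mix_factor\<close> extends the values known for j < k to
  any number of points in A, \<open>mix_tail\<close> cancels these terms from the k-point expansion,
  and only the term with all k points in B is left.\<close>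

lemma mix_0_eq:
  assumes "0 \<le> s" "s \<le> 1"
  shows "mix s 0 k = ennreal ((1 - a) ^ k * (1 - s * q) ^ (k choose 2))"
proof (induction k rule: less_induct)
  case (less k)
  have "mix s m j = ennreal (step_weight a p q s m j)" if "j < k" for m j
    unfolding mix_factor[OF assms, of m] less.IH[OF that]
    using a_ge_0 a_less_1 sp_le_1[OF assms] sq_le_1[OF assms]
    by (simp add: step_weight_def mult_ac flip: ennreal_mult)
  then have "(\<Sum>j=k..k. of_nat (k choose j) * mix s (k - j) j) =
    (\<Sum>j=k..k. of_nat (k choose j) * ennreal (step_weight a p q s (k - j) j))"
    using assms by (intro mix_tail) auto
  then show ?case by (simp add: step_weight_def)
qed

text \<open>Conditioned on B the kernel is regular of degree q: the degree of a point of B into B is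
  (a p + (1 - a) q) - a p, and conditioning divides it by 1 - a.\<close>

lemma AE_U_eq_q: "AE (x, y) in M \<Otimes>\<^sub>M M. x \<in> B \<longrightarrow> y \<in> B \<longrightarrow> U x y = q"
proof -
  let ?N = "uniform_measure M B"
  have eB: "emeasure M B = ennreal (1 - a)" by (simp add: emeasure_eq_measure B_measure)
  then have B0: "emeasure M B \<noteq> 0" using a_less_1 by simp
  interpret N: prob_space ?N by (rule prob_space_uniform_measure) (use B0 in auto)
  interpret N: graphon_kernel ?N U
  proof
    have "sets (?N \<Otimes>\<^sub>M ?N) = sets (M \<Otimes>\<^sub>M M)" by (rule sets_pair_measure_cong) simp_all
    then show "case_prod U \<in> borel_measurable (?N \<Otimes>\<^sub>M ?N)"
      using U_measurable by (simp cong: measurable_cong_sets)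
  qed (auto simp: U_sym U_ge_0 U_le_1)
  have "AE (x, y) in ?N \<Otimes>\<^sub>M ?N. U x y = q"
  proof (rule N.AE_const_of_edge_gf_4)
    show "0 \<le> q" "q \<le> 1" using q_pos q_le_1 by auto
    have rows: "(\<integral>y. U x y \<partial>?N) = degree_on B x / (1 - a)" if [measurable]: "x \<in> space M" for x
    proof -
      have "uniform_measure M B = density M (\<lambda>y. ennreal (indicator B y / (1 - a)))"
        unfolding uniform_measure_def eB using a_less_1
        by (intro density_cong) (auto intro!: AE_I2 simp: indicator_def divide_ennreal simp flip: ennreal_1)
      then have "(\<integral>y. U x y \<partial>?N) = (\<integral>y. (indicator B y / (1 - a)) * U x y \<partial>M)"
        using a_less_1 by (simp add: integral_density)
      also have "\<dots> = degree_on B x / (1 - a)" by (simp add: degree_on_def)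
      finally show ?thesis .
    qed
    have "AE x in M. x \<in> B \<longrightarrow> (\<integral>y. U x y \<partial>?N) = q"
      using AE_degree
    proof (rule AE_mp, intro AE_I2 impI)
      fix x assume "x \<in> space M" "x \<in> B"
        "(x \<in> A \<longrightarrow> degree x = (1 - a) * p) \<and> (x \<in> B \<longrightarrow> degree x = a * p + (1 - a) * q \<and> degree_on A x = a * p)"
      then show "(\<integral>y. U x y \<partial>?N) = q"
        using rows[of x] degree_on_B[of x] a_less_1 by simp
    qed
    then show "AE x in ?N. (\<integral>y. U x y \<partial>?N) = q"
      by (intro AE_uniform_measureI) auto
    fix s :: real assume s: "0 \<le> s" "s \<le> 1"
    interpret V: sym_kernel M "\<lambda>x y. ennreal (1 - s * U x y)" by (rule sym_kernel_thinned)
    have "N.edge_gf s 4 * emeasure M B ^ 4 = V.cliques 4 (\<lambda>x. 1 * indicator B x)"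
      unfolding N.edge_gf_def by (rule V.cliques_uniform_measure) (use B0 in auto)
    also have "\<dots> = mix s 0 4" by (simp add: V.cliques_def V.mixed_def)
    also have "\<dots> = ennreal ((1 - a) ^ 4 * (1 - s * q) ^ (4 choose 2))" by (rule mix_0_eq[OF s])
    also have "(4::nat) choose 2 = 6" by (simp add: numeral_eq_Suc)
    also have "ennreal ((1 - a) ^ 4 * (1 - s * q) ^ 6) = ennreal ((1 - s * q) ^ 6) * emeasure M B ^ 4"
      using a_less_1 sq_le_1[OF s] by (simp add: eB ennreal_power mult_ac flip: ennreal_mult)
    finally have "emeasure M B ^ 4 * N.edge_gf s 4 = emeasure M B ^ 4 * ennreal ((1 - s * q) ^ 6)"
      by (simp only: mult.commute)
    moreover have "emeasure M B ^ 4 \<noteq> 0" "emeasure M B ^ 4 \<noteq> \<top>"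
      using B0 by (simp_all add: power_eq_top_ennreal)
    ultimately show "N.edge_gf s 4 = ennreal ((1 - s * q) ^ 6)"
      by (simp only: ennreal_mult_cancel_left) simp
  qed
  then have "AE x in ?N. AE y in ?N. U x y = q" by (rule N.pair.AE_pair[of "\<lambda>(x, y). U x y = q", simplified])
  then have "AE x in M. x \<in> B \<longrightarrow> (AE y in M. y \<in> B \<longrightarrow> U x y = q)"
    using B0 by (simp add: AE_uniform_measure less_top[symmetric])
  then have "AE x in M. AE y in M. x \<in> B \<longrightarrow> y \<in> B \<longrightarrow> U x y = q"
    by (rule AE_mp) (auto intro!: AE_I2)
  then show ?thesis by (intro pair.AE_pair_measure) auto
qed

end

text \<open>The independent set found so far may be larger than a; \<open>atomless\<close> cuts it
  down to measure exactly a. Then U is reset twice on null sets, to 0 on A x A (\<open>U1\<close>)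
  and to p across (\<open>U2\<close>), so that each further locale gets its hypothesis at every
  point; the generating functions do not notice.\<close>

theorem (in forced_kernel) AE_eq_step_kernel:
  assumes atomless: "\<And>S. S \<in> sets M \<Longrightarrow> a \<le> measure M S \<Longrightarrow> \<exists>T\<in>sets M. T \<subseteq> S \<and> measure M T = a"
  obtains A where "A \<in> sets M" "measure M A = a" "AE (x, y) in M \<Otimes>\<^sub>M M. U x y = step_kernel A p q x y"
proof -
  obtain S where S: "S \<in> sets M" "a \<le> measure M S" "AE (x, y) in M \<Otimes>\<^sub>M M. x \<in> S \<longrightarrow> y \<in> S \<longrightarrow> U x y = 0"
    by (rule independent_set)
  obtain A where [measurable]: "A \<in> sets M" and A: "A \<subseteq> S" "measure M A = a"
    using atomless[OF S(1,2)] by blast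
  have U: "graphon_kernel M U" ..
  define U1 where "U1 x y = (if x \<in> A \<and> y \<in> A then 0 else U x y)" for x y
  have U1: "graphon_kernel M U1"
    unfolding U1_def by (rule graphon_kernel_override[OF U]) auto
  have UU1: "AE (x, y) in M \<Otimes>\<^sub>M M. U x y = U1 x y"
    using S(3) by (rule AE_mp) (use A in \<open>auto intro!: AE_I2 simp: U1_def\<close>)
  have "graphon_kernel.edge_gf M U1 s k = ennreal (step_gf a p q s k)" if "-1 \<le> s" "s \<le> 1" for s k
    using gf[OF that] edge_gf_cong_AE[OF U U1 UU1] by simp
  moreover have "U1 x y = 0" if "x \<in> A" "y \<in> A" for x y using that by (simp add: U1_def)
  ultimately have U1': "forced_kernel_A M U1 a p q A"
    using U1 A a_ge_0 a_less_1 p_pos p_le_1 q_pos q_le_1 degree_gap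
    unfolding forced_kernel_A_def forced_kernel_def forced_kernel_axioms_def forced_kernel_A_axioms_def
    by simp
  then have AB: "AE (x, y) in M \<Otimes>\<^sub>M M. x \<in> A \<longrightarrow> y \<in> space M - A \<longrightarrow> U1 x y = p"
    by (rule forced_kernel_A.AE_U_eq_p)
  have BA: "AE (y, x) in M \<Otimes>\<^sub>M M. x \<in> A \<longrightarrow> y \<in> space M - A \<longrightarrow> U1 x y = p"
    using AB by (rule pair.AE_pair_swap)
  define U2 where "U2 x y = (if (x \<in> A) \<noteq> (y \<in> A) then p else U1 x y)" for x y
  have U2: "graphon_kernel M U2"
    unfolding U2_def by (rule graphon_kernel_override[OF U1]) (use p_pos p_le_1 in auto)
  have U1U2: "AE (x, y) in M \<Otimes>\<^sub>M M. U1 x y = U2 x y"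
    using AB BA graphon_kernel.U_sym[OF U1]
    by (elim AE_mp, intro AE_I2) (auto simp: U2_def space_pair_measure)
  interpret U1: forced_kernel_A M U1 a p q A by (rule U1')
  have "graphon_kernel.edge_gf M U2 s k = ennreal (step_gf a p q s k)" if "-1 \<le> s" "s \<le> 1" for s k
    using U1.gf[OF that] edge_gf_cong_AE[OF U1 U2 U1U2] by simp
  moreover have "U2 x y = 0" if "x \<in> A" "y \<in> A" for x y using that U1.U_A by (simp add: U2_def)
  moreover have "U2 x y = p" if "x \<in> A" "y \<in> space M - A" for x y using that by (simp add: U2_def)
  ultimately have "forced_kernel_AB M U2 a p q A"
    using U2 A a_ge_0 a_less_1 p_pos p_le_1 q_pos q_le_1 degree_gap
    unfolding forced_kernel_AB_def forced_kernel_AB_axioms_def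
      forced_kernel_A_def forced_kernel_def forced_kernel_axioms_def forced_kernel_A_axioms_def
    by simp
  then have BB: "AE (x, y) in M \<Otimes>\<^sub>M M. x \<in> space M - A \<longrightarrow> y \<in> space M - A \<longrightarrow> U2 x y = q"
    by (rule forced_kernel_AB.AE_U_eq_q)
  have "AE (x, y) in M \<Otimes>\<^sub>M M. U x y = step_kernel A p q x y"
    using UU1 U1U2 BB
    by (elim AE_mp, intro AE_I2) (auto simp: U1_def U2_def step_kernel_def space_pair_measure)
  then show thesis using A by (intro that[of A]) auto
qed

section \<open>The sampled random graph\<close>

definition edge_law :: "nat \<Rightarrow> (nat set \<Rightarrow> real) \<Rightarrow> nat set set \<Rightarrow> real" where
  "edge_law k w E = (\<Prod>e\<in>vertex_pairs k. if e \<in> E then w e else 1 - w e)"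

text \<open>The edge probabilities get a name of their own because they are read once from W itself
  and once from its Borel version.\<close>

context
  fixes k :: nat and W :: "real \<times> real \<Rightarrow> real" and x :: "nat \<Rightarrow> real" and w :: "nat set \<Rightarrow> real"
  assumes w: "\<And>e. e \<in> vertex_pairs k \<Longrightarrow> W (x (Min e), x (Max e)) = w e"
    and w01: "\<And>e. e \<in> vertex_pairs k \<Longrightarrow> 0 \<le> w e" "\<And>e. e \<in> vertex_pairs k \<Longrightarrow> w e \<le> 1"
begin

lemma set_pmf_random_edges: "set_pmf (random_edges k W x) \<subseteq> Pow (vertex_pairs k)"
  unfolding random_edges_def by auto

lemma expectation_random_edges:
  fixes h :: "nat set \<Rightarrow> bool \<Rightarrow> real"
  assumes "\<And>e b. 0 \<le> h e b"
  shows "(\<integral>E. (\<Prod>e\<in>vertex_pairs k. h e (e \<in> E)) \<partial>measure_pmf (random_edges k W x)) =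
    (\<Prod>e\<in>vertex_pairs k. h e True * w e + h e False * (1 - w e))"
proof -
  have "(\<integral>E. (\<Prod>e\<in>vertex_pairs k. h e (e \<in> E)) \<partial>measure_pmf (random_edges k W x)) =
    (\<integral>g. (\<Prod>e\<in>vertex_pairs k. h e (g e)) \<partial>measure_pmf (Pi_pmf (vertex_pairs k) False (\<lambda>e. bernoulli_pmf (W (x (Min e), x (Max e))))))"
    unfolding random_edges_def by simp
  also have "\<dots> = (\<Prod>e\<in>vertex_pairs k. \<integral>b. h e b \<partial>measure_pmf (bernoulli_pmf (W (x (Min e), x (Max e)))))"
    by (rule expectation_prod_Pi_pmf) (auto intro!: integrable_measure_pmf_finite assms)
  also have "\<dots> = (\<Prod>e\<in>vertex_pairs k. h e True * w e + h e False * (1 - w e))"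
    using w01 by (intro prod.cong refl) (simp add: w)
  finally show ?thesis .
qed

text \<open>Being equal to \<open>E\<close> is one condition per pair, so the indicator of {E} is a
  product to which \<open>expectation_random_edges\<close> applies.\<close>

lemma pmf_random_edges:
  assumes "E \<subseteq> vertex_pairs k"
  shows "pmf (random_edges k W x) E = edge_law k w E"
proof -
  have "pmf (random_edges k W x) E = (\<integral>F. indicator {E} F \<partial>measure_pmf (random_edges k W x))"
    by (simp add: pmf.rep_eq)
  also have "\<dots> = (\<integral>F. (\<Prod>e\<in>vertex_pairs k. of_bool ((e \<in> F) = (e \<in> E))) \<partial>measure_pmf (random_edges k W x))"
  proof (rule integral_cong_AE)
    show "AE F in measure_pmf (random_edges k W x). indicator {E} F = (\<Prod>e\<in>vertex_pairs k. of_bool ((e \<in> F) = (e \<in> E)) :: real)"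
    proof (rule AE_pmfI)
      fix F assume "F \<in> set_pmf (random_edges k W x)"
      then have F: "F \<subseteq> vertex_pairs k" using set_pmf_random_edges by auto
      show "indicator {E} F = (\<Prod>e\<in>vertex_pairs k. of_bool ((e \<in> F) = (e \<in> E)) :: real)"
      proof (cases "F = E")
        case False
        then obtain e where "e \<in> vertex_pairs k" "(e \<in> F) \<noteq> (e \<in> E)" using F assms by blast
        then have "(\<Prod>e\<in>vertex_pairs k. of_bool ((e \<in> F) = (e \<in> E)) :: real) = 0"
          by (intro prod_zero) (auto intro!: bexI[of _ e])
        then show ?thesis using False by simp
      qed simp
    qed
  qed auto
  also have "\<dots> = edge_law k w E"
    unfolding edge_law_def
    by (subst expectation_random_edges[of "\<lambda>e b. of_bool (b = (e \<in> E))"]) (auto intro!: prod.cong)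
  finally show ?thesis .
qed

lemma nn_integral_random_edges:
  "(\<integral>\<^sup>+E. \<phi> E \<partial>measure_pmf (random_edges k W x)) = (\<Sum>E\<in>Pow (vertex_pairs k). \<phi> E * ennreal (edge_law k w E))"
proof -
  have "(\<integral>\<^sup>+E. \<phi> E \<partial>measure_pmf (random_edges k W x)) =
    (\<Sum>E\<in>Pow (vertex_pairs k). \<phi> E * ennreal (pmf (random_edges k W x) E))"
    by (rule nn_integral_measure_pmf_support) (use set_pmf_random_edges in auto)
  then show ?thesis by (simp add: pmf_random_edges)
qed

lemma random_edges_gf:
  assumes "s \<le> 1"
  shows "(\<integral>\<^sup>+E. ennreal ((1 - s) ^ card E) \<partial>measure_pmf (random_edges k W x)) =
    ennreal (\<Prod>e\<in>vertex_pairs k. 1 - s * w e)"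
proof -
  let ?h = "\<lambda>b. if b then 1 - s else 1"
  have fin: "finite (set_pmf (random_edges k W x))"
    using set_pmf_random_edges by (rule finite_subset) simp
  have "(\<integral>\<^sup>+E. ennreal ((1 - s) ^ card E) \<partial>measure_pmf (random_edges k W x)) =
    (\<integral>\<^sup>+E. ennreal (\<Prod>e\<in>vertex_pairs k. ?h (e \<in> E)) \<partial>measure_pmf (random_edges k W x))"
  proof (rule nn_integral_cong_AE, rule AE_pmfI)
    fix E assume "E \<in> set_pmf (random_edges k W x)"
    then have "E \<subseteq> vertex_pairs k" using set_pmf_random_edges by auto
    then have "(\<Prod>e\<in>vertex_pairs k. ?h (e \<in> E)) = (1 - s) ^ card E"
      by (subst prod.If_cases) (auto simp: Int_absorb1)
    then show "ennreal ((1 - s) ^ card E) = ennreal (\<Prod>e\<in>vertex_pairs k. ?h (e \<in> E))" by simp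
  qed
  also have "\<dots> = ennreal (\<integral>E. (\<Prod>e\<in>vertex_pairs k. ?h (e \<in> E)) \<partial>measure_pmf (random_edges k W x))"
    by (rule nn_integral_eq_integral[OF integrable_measure_pmf_finite[OF fin]])
       (use assms in \<open>auto intro!: AE_I2 prod_nonneg\<close>)
  also have "(\<integral>E. (\<Prod>e\<in>vertex_pairs k. ?h (e \<in> E)) \<partial>measure_pmf (random_edges k W x)) =
      (\<Prod>e\<in>vertex_pairs k. 1 - s * w e)"
    using assms by (subst expectation_random_edges[of "\<lambda>_. ?h"]) (auto simp: algebra_simps)
  finally show ?thesis .
qed

end

section \<open>Borel versions of graphons and the laws of their samples\<close>

abbreviation unit_interval :: "real measure" where
  "unit_interval \<equiv> restrict_space lborel {0..1}"

abbreviation unit_square :: "(real \<times> real) measure" where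
  "unit_square \<equiv> unit_interval \<Otimes>\<^sub>M unit_interval"

lemma space_unit_interval: "space unit_interval = {0..1}"
  by (simp add: space_restrict_space)

lemma prob_space_unit_interval: "prob_space unit_interval"
  by (rule prob_spaceI) (simp add: emeasure_restrict_space space_unit_interval)

text \<open>W is only Lebesgue measurable, whereas the kernel theory works with the uncompleted
  product sigma-algebra. So u replaces W: jointly measurable, symmetric and bounded at every point,
  and almost everywhere equal to W.\<close>

locale graphon_version = graphon_kernel unit_interval u for u :: "real \<Rightarrow> real \<Rightarrow> real" +
  fixes W :: "real \<times> real \<Rightarrow> real"
  assumes graphon: "graphon W"
    and version: "AE (x, y) in unit_square. W (x, y) = u x y"
begin

abbreviation points :: "nat \<Rightarrow> (nat \<Rightarrow> real) measure" where
  "points k \<equiv> \<Pi>\<^sub>M i\<in>{1..k}. unit_interval"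

abbreviation weights :: "(nat \<Rightarrow> real) \<Rightarrow> nat set \<Rightarrow> real" where
  "weights x e \<equiv> u (x (Min e)) (x (Max e))"

lemma AE_version: "AE x in points k. \<forall>e\<in>vertex_pairs k. W (x (Min e), x (Max e)) = weights x e"
  by (rule AE_PiM_vertex_pairs[OF version])

lemma W_bounds:
  assumes "x \<in> space (points k)" "e \<in> vertex_pairs k"
  shows "0 \<le> W (x (Min e), x (Max e))" "W (x (Min e), x (Max e)) \<le> 1"
proof -
  have "x (Min e) \<in> {0..1}" "x (Max e) \<in> {0..1}"
    using assms(1) vertex_pairs_Min_Max[OF assms(2)] by (auto simp: space_PiM PiE_iff space_unit_interval)
  then show "0 \<le> W (x (Min e), x (Max e))" "W (x (Min e), x (Max e)) \<le> 1"
    using graphon unfolding graphon_def by blast+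
qed

lemma W_measurable:
  assumes "e \<in> vertex_pairs k"
  shows "(\<lambda>x. W (x (Min e), x (Max e))) \<in> borel_measurable (completion (points k))"
proof (rule borel_measurable_completion_AE_cong)
  have [measurable]: "(\<lambda>x. x (Min e)) \<in> points k \<rightarrow>\<^sub>M unit_interval"
       "(\<lambda>x. x (Max e)) \<in> points k \<rightarrow>\<^sub>M unit_interval"
    using vertex_pairs_Min_Max[OF assms] by (auto intro!: measurable_component_singleton)
  show "(\<lambda>x. weights x e) \<in> borel_measurable (points k)" by measurable
  show "AE x in points k. W (x (Min e), x (Max e)) = weights x e"
    using AE_version by (rule AE_mp) (use assms in \<open>auto intro!: AE_I2\<close>)
qed simp

text \<open>The conditional law lives on the finitely many subsets of \<open>vertex_pairs k\<close>,
  so the probability of any event is a finite sum of products of edge probabilities.\<close>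

lemma random_edges_measurable:
  "(\<lambda>x. measure_pmf (random_edges k W x)) \<in> completion (points k) \<rightarrow>\<^sub>M subprob_algebra (count_space UNIV)"
proof (rule measurable_subprob_algebra)
  fix X :: "nat set set set"
  note [measurable] = W_measurable[of _ k]
  have "(\<lambda>x. \<Sum>E\<in>Pow (vertex_pairs k). indicator X E * ennreal (edge_law k (\<lambda>e. W (x (Min e), x (Max e))) E))
      \<in> borel_measurable (completion (points k))"
    unfolding edge_law_def by measurable
  then show "(\<lambda>x. emeasure (measure_pmf (random_edges k W x)) X) \<in> borel_measurable (completion (points k))"
  proof (rule measurable_cong[THEN iffD1, rotated])
    fix x assume x: "x \<in> space (completion (points k))"
    have "emeasure (measure_pmf (random_edges k W x)) X = (\<integral>\<^sup>+E. indicator X E \<partial>measure_pmf (random_edges k W x))"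
      by simp
    also have "\<dots> = (\<Sum>E\<in>Pow (vertex_pairs k). indicator X E * ennreal (edge_law k (\<lambda>e. W (x (Min e), x (Max e))) E))"
      by (rule nn_integral_random_edges) (use W_bounds x in auto)
    finally show "(\<Sum>E\<in>Pow (vertex_pairs k). indicator X E * ennreal (edge_law k (\<lambda>e. W (x (Min e), x (Max e))) E)) =
      emeasure (measure_pmf (random_edges k W x)) X" by simp
  qed
qed (auto intro: prob_space_imp_subprob_space measure_pmf.prob_space_axioms)

lemma sets_k_sample: "sets (k_sample k W) = UNIV"
proof -
  have "space (completion (points k)) \<noteq> {}"
    by (simp add: space_PiM PiE_eq_empty_iff space_unit_interval)
  then show ?thesis
    unfolding k_sample_def by (subst sets_bind_measurable[OF random_edges_measurable]) auto
qed

lemma nn_integral_k_sample: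
  "(\<integral>\<^sup>+E. \<phi> E \<partial>k_sample k W) = (\<integral>\<^sup>+x. \<integral>\<^sup>+E. \<phi> E \<partial>measure_pmf (random_edges k W x) \<partial>points k)"
  unfolding k_sample_def
  by (subst nn_integral_bind[OF _ random_edges_measurable]) (auto simp: nn_integral_completion)

lemma nn_integral_k_sample_edge_law:
  "(\<integral>\<^sup>+E. \<phi> E \<partial>k_sample k W) = (\<integral>\<^sup>+x. (\<Sum>E\<in>Pow (vertex_pairs k). \<phi> E * ennreal (edge_law k (weights x) E)) \<partial>points k)"
  unfolding nn_integral_k_sample
proof (rule nn_integral_cong_AE)
  show "AE x in points k. (\<integral>\<^sup>+E. \<phi> E \<partial>measure_pmf (random_edges k W x)) =
    (\<Sum>E\<in>Pow (vertex_pairs k). \<phi> E * ennreal (edge_law k (weights x) E))"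
    using AE_version by (rule AE_mp) (auto intro!: AE_I2 nn_integral_random_edges U_ge_0 U_le_1)
qed

lemma edge_gf_eq_edge_count_distr:
  assumes "s \<le> 1"
  shows "edge_gf s k = (\<integral>\<^sup>+n. ennreal ((1 - s) ^ n) \<partial>edge_count_distr k W)"
proof -
  have "card \<in> measurable (k_sample k W) (count_space UNIV)"
    by (subst measurable_cong_sets[of _ "count_space UNIV" _ "count_space UNIV"]) (auto simp: sets_k_sample)
  then have "(\<integral>\<^sup>+n. ennreal ((1 - s) ^ n) \<partial>edge_count_distr k W) = (\<integral>\<^sup>+E. ennreal ((1 - s) ^ card E) \<partial>k_sample k W)"
    unfolding edge_count_distr_def by (subst nn_integral_distr) auto
  also have "\<dots> = (\<integral>\<^sup>+x. ennreal (\<Prod>e\<in>vertex_pairs k. 1 - s * weights x e) \<partial>points k)"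
    unfolding nn_integral_k_sample
  proof (rule nn_integral_cong_AE)
    show "AE x in points k. (\<integral>\<^sup>+E. ennreal ((1 - s) ^ card E) \<partial>measure_pmf (random_edges k W x)) =
       ennreal (\<Prod>e\<in>vertex_pairs k. 1 - s * weights x e)"
      using AE_version by (rule AE_mp) (auto intro!: AE_I2 random_edges_gf U_ge_0 U_le_1 assms)
  qed
  also have "\<dots> = edge_gf s k"
  proof -
    have "0 \<le> 1 - s * u x y" for x y
      using assms U_ge_0[of x y] U_le_1[of x y] mult_right_mono[of s 1 "u x y"] by auto
    then have "(\<Prod>e\<in>vertex_pairs k. ennreal (1 - s * weights x e)) = ennreal (\<Prod>e\<in>vertex_pairs k. 1 - s * weights x e)" for x
      by (intro prod_ennreal)
    then show ?thesis
      unfolding edge_gf_def sym_kernel.cliques_def[OF sym_kernel_thinned] by (simp only: prod.neutral_const mult_1)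
  qed
  finally show ?thesis by simp
qed

end

lemma graphon_version_exists:
  assumes "graphon W"
  obtains u where "graphon_version u W"
proof -
  interpret unit: prob_space unit_interval by (rule prob_space_unit_interval)
  interpret unit2: pair_sigma_finite unit_interval unit_interval ..
  let ?S = "{0..1::real} \<times> {0..1::real}"
  have "(\<lambda>r. if r \<in> ?S then W r else 0) \<in> borel_measurable lebesgue"
  proof (subst borel_measurable_if)
    have "?S \<in> sets lborel" by (auto intro!: borel_closed closed_Times)
    then show "?S \<in> sets lebesgue" by (rule sets_completionI_sets)
  qed (use assms in \<open>simp add: graphon_def\<close>)
  then obtain g where g [measurable]: "g \<in> borel_measurable lborel" and "AE r in lborel. (if r \<in> ?S then W r else 0) = g r"
    using completion_ex_borel_measurable_real by blast
  from AE_E3[OF this(2)] obtain N where N: "\<And>r. r \<in> space lborel - N \<Longrightarrow> (if r \<in> ?S then W r else 0) = g r" "N \<in> null_sets lborel"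
    by blast
  then have N_sets [measurable]: "N \<in> sets (borel \<Otimes>\<^sub>M borel)" unfolding borel_prod by auto
  have g' [measurable]: "g \<in> borel_measurable (borel \<Otimes>\<^sub>M borel)" using g unfolding borel_prod by simp
  \<comment> \<open>Averaging with the transpose gives symmetry and clipping gives the bounds;
    neither changes a value when both (x, y) and (y, x) in the square avoid the null set
    \<open>N\<close>, since W is symmetric and bounded there.\<close>
  define u where "u x y = max 0 (min 1 ((g (x, y) + g (y, x)) / 2))" for x y
  have id_meas [measurable]: "(\<lambda>x. x) \<in> unit_interval \<rightarrow>\<^sub>M borel"
    by (rule measurable_restrict_space1) simp
  have fst_meas [measurable]: "fst \<in> unit_square \<rightarrow>\<^sub>M borel"
    using measurable_compose[OF measurable_fst id_meas] by simp
  have snd_meas [measurable]: "snd \<in> unit_square \<rightarrow>\<^sub>M borel"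
    using measurable_compose[OF measurable_snd id_meas] by simp
  have kernel: "graphon_kernel unit_interval u"
  proof
    have "(\<lambda>r. u (fst r) (snd r)) \<in> borel_measurable (unit_square)"
      unfolding u_def by measurable
    then show "case_prod u \<in> borel_measurable (unit_square)" by (simp add: case_prod_beta')
  qed (auto simp: u_def add.commute)
  have "AE r in lborel \<Otimes>\<^sub>M lborel. r \<notin> N"
    unfolding lborel_prod using N(2) by (rule AE_not_in)
  moreover have "AE r in lborel \<Otimes>\<^sub>M lborel. (snd r, fst r) \<notin> N"
    using lborel_pair.AE_pair_swap[of "\<lambda>x y. (x, y) \<notin> N"] calculation by (simp add: case_prod_beta)
  ultimately have "AE (x, y) in lborel \<Otimes>\<^sub>M lborel. (x, y) \<notin> N \<and> (y, x) \<notin> N"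
    by eventually_elim auto
  then have "AE x in lborel. AE y in lborel. (x, y) \<notin> N \<and> (y, x) \<notin> N"
    using lborel_pair.AE_pair by fastforce
  note lborel_AE = this
  have restrict_AE: "AE x in unit_interval. P x" if "AE x in lborel. P x" for P
    using that by (subst AE_restrict_space_iff) (auto elim!: eventually_mono)
  have unit_AE: "AE x in unit_interval. AE y in unit_interval. (x, y) \<notin> N \<and> (y, x) \<notin> N"
    by (rule restrict_AE, rule eventually_mono[OF lborel_AE]) (rule restrict_AE)
  let ?Q = "unit_square"
  have "AE r in ?Q. (fst r, snd r) \<notin> N \<and> (snd r, fst r) \<notin> N"
  proof (rule unit2.AE_pair_measure)
    have "(\<lambda>r. (fst r, snd r)) -` N \<inter> space ?Q \<in> sets ?Q" "(\<lambda>r. (snd r, fst r)) -` N \<inter> space ?Q \<in> sets ?Q"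
      by (rule measurable_sets[OF measurable_Pair N_sets]; rule fst_meas snd_meas)+
    then have "space ?Q - ((\<lambda>r. (fst r, snd r)) -` N \<inter> space ?Q) - ((\<lambda>r. (snd r, fst r)) -` N \<inter> space ?Q) \<in> sets ?Q"
      by (intro sets.Diff sets.top)
    also have "space ?Q - ((\<lambda>r. (fst r, snd r)) -` N \<inter> space ?Q) - ((\<lambda>r. (snd r, fst r)) -` N \<inter> space ?Q) =
      {r \<in> space ?Q. (fst r, snd r) \<notin> N \<and> (snd r, fst r) \<notin> N}" by blast
    finally show "{r \<in> space ?Q. (fst r, snd r) \<notin> N \<and> (snd r, fst r) \<notin> N} \<in> sets ?Q" .
  qed (use unit_AE in simp)
  then have version: "AE (x, y) in unit_square. W (x, y) = u x y"
  proof (rule AE_mp, intro AE_I2 impI)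
    fix r assume r: "r \<in> space (unit_square)" "(fst r, snd r) \<notin> N \<and> (snd r, fst r) \<notin> N"
    obtain x y where xy: "r = (x, y)" by (cases r)
    then have "x \<in> {0..1}" "y \<in> {0..1}" using r by (auto simp: space_pair_measure space_unit_interval)
    moreover from this have "0 \<le> W (x, y)" "W (x, y) \<le> 1" "W (x, y) = W (y, x)"
      using assms unfolding graphon_def by blast+
    moreover have "(x, y) \<notin> N" "(y, x) \<notin> N" using r xy by auto
    ultimately show "case r of (x, y) \<Rightarrow> W (x, y) = u x y"
      using N(1)[of "(x, y)"] N(1)[of "(y, x)"] xy by (auto simp: u_def)
  qed
  show thesis
    by (rule that[of u]) (use kernel version assms in \<open>auto simp: graphon_version_def graphon_version_axioms_def\<close>)
qed

section \<open>Sets of prescribed measure, and the conclusion for graphons\<close>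

lemma Int_unit_interval_sets: "T \<in> sets borel \<Longrightarrow> T \<inter> {0..1} \<in> sets unit_interval"
  unfolding sets_restrict_space by (rule image_eqI[of _ _ T]) auto

text \<open>The measure of the part of S up to t is 1-Lipschitz in t and runs from 0 to the measure
  of S, so the intermediate value theorem finds the cut.\<close>

lemma unit_interval_subset_of_measure:
  assumes [measurable]: "S \<in> sets unit_interval" and a: "0 \<le> a" "a \<le> measure unit_interval S"
  shows "\<exists>T\<in>sets unit_interval. T \<subseteq> S \<and> measure unit_interval T = a"
proof -
  interpret unit: prob_space unit_interval by (rule prob_space_unit_interval)
  have [measurable]: "S \<inter> {..t} \<in> sets unit_interval" for t
  proof -
    have "S \<inter> ({..t} \<inter> {0..1}) \<in> sets unit_interval"
      by (intro sets.Int assms Int_unit_interval_sets) simp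
    moreover have "S \<inter> ({..t} \<inter> {0..1}) = S \<inter> {..t}"
      using sets.sets_into_space[OF assms(1)] by (auto simp: space_unit_interval)
    ultimately show ?thesis by simp
  qed
  define g where "g t = measure unit_interval (S \<inter> {..t})" for t
  have lip: "\<bar>g t - g s\<bar> \<le> \<bar>t - s\<bar>" for s t
  proof -
    have *: "g t - g s \<le> t - s \<and> g s \<le> g t" if "s \<le> t" for s t
    proof -
      have [measurable]: "{s<..t} \<inter> {0..1} \<in> sets unit_interval" by (rule Int_unit_interval_sets) simp
      have "g t \<le> measure unit_interval ((S \<inter> {..s}) \<union> ({s<..t} \<inter> {0..1}))"
        unfolding g_def using sets.sets_into_space[OF assms(1)]
        by (intro unit.finite_measure_mono) (auto simp: space_unit_interval)
      also have "\<dots> \<le> g s + measure unit_interval ({s<..t} \<inter> {0..1})"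
        unfolding g_def by (rule measure_Un_le) auto
      also have "measure unit_interval ({s<..t} \<inter> {0..1}) = measure lborel ({s<..t} \<inter> {0..1})"
        by (subst measure_restrict_space) auto
      also have "\<dots> \<le> measure lborel {s<..t}"
        using that by (intro measure_mono_fmeasurable) (auto simp: fmeasurable_def)
      also have "\<dots> = t - s" using that by simp
      finally show ?thesis
        using that by (auto simp: g_def intro!: unit.finite_measure_mono)
    qed
    show ?thesis using *[of s t] *[of t s] by (cases "s \<le> t") auto
  qed
  have "continuous_on {0..1} g"
    unfolding continuous_on_iff
  proof (intro ballI allI impI)
    fix x e :: real assume "0 < e"
    then show "\<exists>d>0. \<forall>x'\<in>{0..1}. dist x' x < d \<longrightarrow> dist (g x') (g x) < e"
      using lip by (intro exI[of _ e]) (auto simp: dist_real_def intro: order_le_less_trans)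
  qed
  moreover have "g 0 \<le> a"
  proof -
    have "g 0 \<le> measure unit_interval {0}"
      unfolding g_def using sets.sets_into_space[OF assms(1)]
      using Int_unit_interval_sets[of "{0}"]
      by (intro unit.finite_measure_mono) (auto simp: space_unit_interval)
    also have "\<dots> = 0" by (subst measure_restrict_space) auto
    finally show ?thesis using a by simp
  qed
  moreover have "g 1 = measure unit_interval S"
    unfolding g_def using sets.sets_into_space[OF assms(1)]
    by (intro arg_cong[where f="measure _"]) (auto simp: space_unit_interval)
  ultimately obtain t where "g t = a" using IVT'[of g 0 a 1] a by auto
  then show ?thesis by (intro bexI[of _ "S \<inter> {..t}"]) (auto simp: g_def)
qed

text \<open>Given the points, the law of the graph depends only on which of them lie in the set, and
  the joint law of these bits depends only on the measure of the set.\<close>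

lemma k_sample_eq_of_step_versions:
  assumes "graphon_version u U" "graphon_version v W"
    and A: "A \<in> sets unit_interval" "A' \<in> sets unit_interval" "measure unit_interval A = measure unit_interval A'"
    and u: "AE (x, y) in unit_square. u x y = step_kernel A p q x y"
    and v: "AE (x, y) in unit_square. v x y = step_kernel A' p q x y"
  shows "k_sample k U = k_sample k W"
proof (rule measure_eqI)
  interpret U: graphon_version u U by fact
  interpret W: graphon_version v W by fact
  show "sets (k_sample k U) = sets (k_sample k W)" by (simp add: U.sets_k_sample W.sets_k_sample)
  fix X
  let ?P = "\<Pi>\<^sub>M i\<in>{1..k}. unit_interval"
  let ?c = "\<lambda>\<alpha> \<beta>. if \<alpha> \<and> \<beta> then 0 else if \<alpha> \<or> \<beta> then p else q"
  let ?g = "\<lambda>\<sigma>. \<Sum>E\<in>Pow (vertex_pairs k). indicator X E * ennreal (edge_law k (\<lambda>e. ?c (\<sigma> (Min e)) (\<sigma> (Max e))) E)"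
  have law: "emeasure (k_sample k U') X = (\<integral>\<^sup>+x. ?g (\<lambda>i. x i \<in> S) \<partial>?P)"
    if "graphon_version u' U'" "AE (x, y) in unit_square. u' x y = step_kernel S p q x y" for u' U' S
  proof -
    interpret U': graphon_version u' U' by fact
    have "emeasure (k_sample k U') X = (\<integral>\<^sup>+E. indicator X E \<partial>k_sample k U')"
      by (simp add: U'.sets_k_sample)
    also have "\<dots> = (\<integral>\<^sup>+x. ?g (\<lambda>i. x i \<in> S) \<partial>?P)"
      unfolding U'.nn_integral_k_sample_edge_law
    proof (rule nn_integral_cong_AE)
      show "AE x in ?P. (\<Sum>E\<in>Pow (vertex_pairs k). indicator X E * ennreal (edge_law k (\<lambda>e. u' (x (Min e)) (x (Max e))) E)) = ?g (\<lambda>i. x i \<in> S)"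
        using U.AE_PiM_vertex_pairs[OF that(2)]
      proof (rule AE_mp, intro AE_I2 impI)
        fix x assume "\<forall>e\<in>vertex_pairs k. u' (x (Min e)) (x (Max e)) = step_kernel S p q (x (Min e)) (x (Max e))"
        then have "edge_law k (\<lambda>e. u' (x (Min e)) (x (Max e))) E = edge_law k (\<lambda>e. ?c (x (Min e) \<in> S) (x (Max e) \<in> S)) E" for E
          unfolding edge_law_def by (intro prod.cong) (auto simp: step_kernel_def)
        then show "(\<Sum>E\<in>Pow (vertex_pairs k). indicator X E * ennreal (edge_law k (\<lambda>e. u' (x (Min e)) (x (Max e))) E)) = ?g (\<lambda>i. x i \<in> S)"
          by simp
      qed
    qed
    finally show ?thesis .
  qed
  have "(\<integral>\<^sup>+x. ?g (\<lambda>i. x i \<in> A) \<partial>?P) = (\<integral>\<^sup>+x. ?g (\<lambda>i. x i \<in> A') \<partial>?P)"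
  proof (rule U.distr_PiM_indicator_cong[OF A])
    fix \<sigma> \<tau> :: "nat \<Rightarrow> bool" assume "\<And>i. i \<in> {1..k} \<Longrightarrow> \<sigma> i = \<tau> i"
    then have "\<sigma> (Min e) = \<tau> (Min e) \<and> \<sigma> (Max e) = \<tau> (Max e)" if "e \<in> vertex_pairs k" for e
      using vertex_pairs_Min_Max[OF that] by blast
    then have "edge_law k (\<lambda>e. ?c (\<sigma> (Min e)) (\<sigma> (Max e))) E = edge_law k (\<lambda>e. ?c (\<tau> (Min e)) (\<tau> (Max e))) E" for E
      unfolding edge_law_def by (intro prod.cong) auto
    then show "?g \<sigma> = ?g \<tau>" by simp
  qed simp
  then show "emeasure (k_sample k U) X = emeasure (k_sample k W) X"
    using law[OF assms(1) u] law[OF assms(2) v] by simp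
qed

theorem theorem3:
  fixes a p q :: real and A B :: "real set" and W :: "real \<times> real \<Rightarrow> real"
  assumes "0 \<le> a" "a \<le> 1" "0 < p" "p \<le> 1" "0 < q" "q \<le> 1"
    and "A = {0..<a}" "B = {a..1}"
    and "graphon W"
    and "\<And>z. z \<in> A \<times> A \<Longrightarrow> W z = 0"
    and "\<And>z. z \<in> (A \<times> B) \<union> (B \<times> A) \<Longrightarrow> W z = p"
    and "\<And>z. z \<in> B \<times> B \<Longrightarrow> W z = q"
    and "(1 - a) * q \<le> (1 - 2 * a) * p"
  shows "forced_by_edge_counts W"
  unfolding forced_by_edge_counts_def weakly_isomorphic_def
proof (intro allI impI)
  fix U :: "real \<times> real \<Rightarrow> real" and k :: nat
  assume U: "graphon U" and counts: "\<forall>k\<ge>1. edge_count_distr k U = edge_count_distr k W" and "1 \<le> k"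
  interpret unit: prob_space unit_interval by (rule prob_space_unit_interval)
  interpret unit2: pair_prob_space unit_interval unit_interval ..
  have "a < 1"
  proof (rule ccontr)
    assume "\<not> a < 1"
    \<comment> \<open>For a = 1 the last hypothesis reads 0 <= -p.\<close>
    then have "a = 1" using assms(2) by simp
    then show False using assms(3,13) by simp
  qed
  have A_sets [measurable]: "A \<in> sets unit_interval" and A_measure: "measure unit_interval A = a"
  proof -
    have "A \<subseteq> {0..1}" "A \<in> sets lborel" using assms(7) \<open>a < 1\<close> by auto
    then show "A \<in> sets unit_interval" using Int_unit_interval_sets[of A] by (simp add: Int_absorb2)
    show "measure unit_interval A = a"
      using \<open>A \<subseteq> {0..1}\<close> assms(1,7) by (subst measure_restrict_space) auto
  qed
  let ?w = "step_kernel A p q"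
  have kernel_w: "graphon_kernel unit_interval ?w"
  proof
    have "(\<lambda>r. ?w (fst r) (snd r)) \<in> borel_measurable (unit_square)"
      unfolding step_kernel_def by measurable
    then show "case_prod ?w \<in> borel_measurable (unit_square)" by (simp add: case_prod_beta')
  qed (use assms(3-6) in \<open>auto simp: step_kernel_def\<close>)
  have W: "graphon_version ?w W"
  proof -
    have "W (x, y) = ?w x y" if "x \<in> {0..1}" "y \<in> {0..1}" for x y
    proof -
      have "x \<in> A \<or> x \<in> B" "y \<in> A \<or> y \<in> B" "x \<in> B \<Longrightarrow> x \<notin> A" "y \<in> B \<Longrightarrow> y \<notin> A"
        using that assms(7,8) by auto
      then show ?thesis using assms(10-12)[of "(x, y)"] by (auto simp: step_kernel_def)
    qed
    then have "AE (x, y) in unit_square. W (x, y) = ?w x y"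
      by (intro AE_I2) (auto simp: space_pair_measure space_unit_interval)
    then show ?thesis using kernel_w assms(9) by (simp add: graphon_version_def graphon_version_axioms_def)
  qed
  obtain u where u: "graphon_version u U" using graphon_version_exists[OF U] .
  interpret W: graphon_version ?w W by (rule W)
  interpret U: graphon_version u U by (rule u)
  have "U.edge_gf s k = ennreal (step_gf a p q s k)" if "-1 \<le> s" "s \<le> 1" for s k
  \<comment> \<open>The laws are compared only for k >= 1, while \<open>forced_kernel\<close> asks
    for all k; at k = 0 both sides are 1.\<close>
  proof (cases "k = 0")
    case True
    then show ?thesis
      by (simp add: U.edge_gf_def sym_kernel.cliques_0[OF U.sym_kernel_thinned] step_gf_def step_weight_def binomial_eq_0)
  next
    case False
    then have "U.edge_gf s k = W.edge_gf s k"
      using that counts by (simp add: U.edge_gf_eq_edge_count_distr W.edge_gf_eq_edge_count_distr)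
    also have "\<dots> = ennreal (step_gf a p q s k)"
      by (rule W.edge_gf_step[OF A_sets A_measure]) (use assms(3-6) that in \<open>auto simp: step_kernel_def\<close>)
    finally show ?thesis .
  qed
  then interpret forced: forced_kernel unit_interval u a p q
    using assms(1-6,13) \<open>a < 1\<close> by unfold_locales
  obtain A' where A': "A' \<in> sets unit_interval" "measure unit_interval A' = a"
    "AE (x, y) in unit_square. u x y = step_kernel A' p q x y"
    by (rule forced.AE_eq_step_kernel[OF unit_interval_subset_of_measure[OF _ assms(1)]])
  then show "k_sample k U = k_sample k W"
    using A'(2) A_measure by (intro k_sample_eq_of_step_versions[OF u W A'(1) A_sets _ A'(3)]) auto
qed

end
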